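(* Let $(\varrho,E)$ be a limit pair of the discrete curves $(\varrho^\tau,E^\tau)$ built from the scheme in the context, i.e. along some sequence $\tau_j\to 0$ one has $\varrho^{\tau_j}_t\to\varrho_t$ uniformly in $t\in[0,T]$ for the distance $W_2$, and $E^{\tau_j}\rightharpoonup E$ weakly as vector measures on $[0,T]\times\Omega$. Then $(\varrho,E)$ satisfies, in the distributional sense, $$\partial_t\varrho+\nabla\cdot E=0,\qquad E=-\nabla\varrho-\varrho\nabla V,$$ with no-flux boundary conditions on $\partial\Omega$. In particular, $\varrho$ is a solution of $$\begin{cases}\partial_t\varrho-\Delta\varrho-\nabla\cdot(\varrho\nabla V)=0,\\ (\nabla\varrho+\varrho\nabla V)\cdot\mathbf n=0 \text{ on }\partial\Omega,\\ \varrho(0)=\varrho_0,\end{cases}$$ where the initial datum is intended in the following sense: the curve $t\mapsto\varrho_t$ is (absolutely) continuous in $(\mathcal P(\Omega),W_2)$, and its initial value is $\varrho_0$.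
   Context: $\Omega\subset\mathbb R^d$ is a compact domain, meaning the closure of a bounded connected open set; $V\in C^1(\Omega)$; $\mathcal P(\Omega)$ is the set of Borel probability measures on $\Omega$; $W_2$ is the quadratic Wasserstein distance, $W_2^2(\mu,\nu)=\min\{\int|x-y|^2\,d\gamma:\gamma\in\mathcal P(\Omega\times\Omega)\text{ with marginals }\mu,\nu\}$; $T>0$ is a fixed final time. Absolutely continuous measures are identified with their densities with respect to Lebesgue measure. The functional $J:\mathcal P(\Omega)\to\mathbb R\cup\{+\infty\}$ is $$J(\varrho)=\int_\Omega\varrho\log\varrho\,dx+\int_\Omega V\,d\varrho,$$ where the first (entropy) term is set to $+\infty$ if $\varrho$ is not absolutely continuous. The initial measure $\varrho_0\in\mathcal P(\Omega)$ satisfies $J(\varrho_0)<+\infty$. Scheme: for $\tau>0$ set $\varrho^\tau_{(0)}=\varrho_0$ and, for $k\ge 0$, let $\varrho^\tau_{(k+1)}$ be the (unique) minimizer over $\varrho\in\mathcal P(\Omega)$ of $J(\varrho)+\frac{1}{2\tau}W_2^2(\varrho,\varrho^\tau_{(k)})$. Let $T^\tau_k$ be the optimal transport map for the quadratic cost from $\varrho^\tau_{(k+1)}$ to $\varrho^\tau_{(k)}$. For $t\in(k\tau,(k+1)\tau]$ set $\varrho^\tau_t=\varrho^\tau_{(k+1)}$ and $\mathbf v^\tau_t=(\mathrm{id}-T^\tau_k)/\tau$; let $\varrho^\tau_0=\varrho_0$. The momentum is the $\mathbb R^d$-valued measure $E^\tau=\varrho^\tau\mathbf v^\tau$ on $[0,T]\times\Omega$,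 i.e. $\int f\cdot dE^\tau=\int_0^T\int_\Omega f(t,x)\cdot\mathbf v^\tau_t(x)\,d\varrho^\tau_t(x)\,dt$. Up to subsequences as $\tau\to0$ such curves converge in the sense described in the claim, and $(\varrho,E)$ denotes such a limit. Meaning of the distributional formulation: $\partial_t\varrho+\nabla\cdot E=0$ with no-flux boundary conditions means $\int_0^T\int_\Omega\partial_t\phi\,d\varrho_t\,dt+\int\nabla\phi\cdot dE=0$ for all $\phi\in C^1_c((0,T)\times\Omega)$ (test functions need not vanish on $\partial\Omega$); $E=-\nabla\varrho-\varrho\nabla V$ means $\int f\cdot dE=\int_0^T\int_\Omega(\nabla\cdot f)\,d\varrho_t\,dt-\int_0^T\int_\Omega f\cdot\nabla V\,d\varrho_t\,dt$ for all $f\in C^1$ with values in $\mathbb R^d$ and compact support in $(0,T)\times\mathrm{int}(\Omega)$. $\mathbf n$ is the outer normal to $\partial\Omega$; the boundary condition in the PDE system is understood in this weak sense. *)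

theory Defs
  imports "HOL-Probability.Probability"
begin

definition compact_domain :: "'a::euclidean_space set \<Rightarrow> bool" where
  "compact_domain \<Omega> \<longleftrightarrow> (\<exists>U. open U \<and> connected U \<and> bounded U \<and> \<Omega> = closure U)"

text \<open>Measures on a closed set \<open>K\<close> are Borel measures on the whole type that are concentrated
  on \<open>K\<close>. Integrals are always taken over \<open>K\<close> explicitly, so that values of integrands off
  \<open>K\<close> never matter.\<close>

definition prob_on :: "'b::topological_space set \<Rightarrow> 'b measure set" where
  "prob_on K = {\<mu>. prob_space \<mu> \<and> sets \<mu> = sets borel \<and> emeasure \<mu> (- K) = 0}"

definition couplings ::
  "'a::euclidean_space set \<Rightarrow> 'a measure \<Rightarrow> 'a measure \<Rightarrow> ('a \<times> 'a) measure set" where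
  "couplings \<Omega> \<mu> \<nu> =
     {\<gamma> \<in> prob_on (\<Omega> \<times> \<Omega>). distr \<gamma> borel fst = \<mu> \<and> distr \<gamma> borel snd = \<nu>}"

text \<open>The infimum is attained, \<open>\<Omega>\<close> being compact.\<close>

definition W2 :: "'a::euclidean_space set \<Rightarrow> 'a measure \<Rightarrow> 'a measure \<Rightarrow> real" where
  "W2 \<Omega> \<mu> \<nu> =
     sqrt (INF \<gamma>\<in>couplings \<Omega> \<mu> \<nu>. (LINT p:\<Omega> \<times> \<Omega>|\<gamma>. (norm (fst p - snd p))\<^sup>2))"

text \<open>\<open>T\<close> pushes \<open>\<mu>\<close> to \<open>\<nu>\<close>, and the plan \<open>(id, T)\<^sub># \<mu>\<close> is optimal.\<close>

definition optimal_map ::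
  "'a::euclidean_space set \<Rightarrow> 'a measure \<Rightarrow> 'a measure \<Rightarrow> ('a \<Rightarrow> 'a) \<Rightarrow> bool" where
  "optimal_map \<Omega> \<mu> \<nu> T \<longleftrightarrow>
     T \<in> borel_measurable borel \<and> distr \<mu> borel T = \<nu> \<and>
     (LINT x:\<Omega>|\<mu>. (norm (x - T x))\<^sup>2) = (W2 \<Omega> \<mu> \<nu>)\<^sup>2"

text \<open>Since \<open>s log s\<close> is bounded below and \<open>\<Omega>\<close> is bounded, the negative part of
  \<open>\<rho> log \<rho>\<close> is always integrable on \<open>\<Omega>\<close>; non-integrability therefore means that the
  integral is \<open>+\<infinity>\<close>. Note that \<open>ln 0 = 0\<close>, so \<open>0 log 0 = 0\<close> as usual.\<close>

definition entropy_fun :: "'a::euclidean_space set \<Rightarrow> 'a measure \<Rightarrow> ereal" where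
  "entropy_fun \<Omega> \<rho> =
     (let u = (\<lambda>x. enn2real (RN_deriv lborel \<rho> x)) in
      if absolutely_continuous lborel \<rho> \<and> set_integrable lborel \<Omega> (\<lambda>x. u x * ln (u x))
      then ereal (LINT x:\<Omega>|lborel. u x * ln (u x)) else \<infinity>)"

definition energy :: "'a::euclidean_space set \<Rightarrow> ('a \<Rightarrow> real) \<Rightarrow> 'a measure \<Rightarrow> ereal" where
  "energy \<Omega> V \<rho> = entropy_fun \<Omega> \<rho> + ereal (LINT x:\<Omega>|\<rho>. V x)"

definition jko_step ::
  "'a::euclidean_space set \<Rightarrow> ('a \<Rightarrow> real) \<Rightarrow> real \<Rightarrow> 'a measure \<Rightarrow> 'a measure \<Rightarrow> bool" where
  "jko_step \<Omega> V \<tau> \<mu> \<nu> \<longleftrightarrow>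
     is_arg_min (\<lambda>\<sigma>. energy \<Omega> V \<sigma> + ereal ((W2 \<Omega> \<sigma> \<mu>)\<^sup>2 / (2 * \<tau>))) (\<lambda>\<sigma>. \<sigma> \<in> prob_on \<Omega>) \<nu>"

definition jko_scheme ::
  "'a::euclidean_space set \<Rightarrow> ('a \<Rightarrow> real) \<Rightarrow> real \<Rightarrow> 'a measure \<Rightarrow> (nat \<Rightarrow> 'a measure) \<Rightarrow> bool" where
  "jko_scheme \<Omega> V \<tau> \<rho>0 R \<longleftrightarrow> R 0 = \<rho>0 \<and> (\<forall>k. jko_step \<Omega> V \<tau> (R k) (R (Suc k)))"

text \<open>For \<open>t \<in> (k\<tau>, (k+1)\<tau>]\<close> one has \<open>nat \<lceil>t / \<tau>\<rceil> = k + 1\<close>, and at \<open>t = 0\<close> the index is \<open>0\<close>.\<close>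

definition interp_curve :: "real \<Rightarrow> (nat \<Rightarrow> 'a measure) \<Rightarrow> real \<Rightarrow> 'a measure" where
  "interp_curve \<tau> R t = R (nat \<lceil>t / \<tau>\<rceil>)"

definition interp_velocity ::
  "real \<Rightarrow> (nat \<Rightarrow> 'a \<Rightarrow> 'a::euclidean_space) \<Rightarrow> real \<Rightarrow> 'a \<Rightarrow> 'a" where
  "interp_velocity \<tau> S t x = (x - S (nat \<lceil>t / \<tau>\<rceil> - 1) x) /\<^sub>R \<tau>"

text \<open>The integral of a field \<open>f\<close> against the discrete momentum \<open>\<rho>\<^sup>\<tau> v\<^sup>\<tau>\<close>.\<close>

definition discrete_momentum_integral ::
  "'a::euclidean_space set \<Rightarrow> real \<Rightarrow> real \<Rightarrow> (nat \<Rightarrow> 'a measure) \<Rightarrow> (nat \<Rightarrow> 'a \<Rightarrow> 'a) \<Rightarrow>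
     (real \<times> 'a \<Rightarrow> 'a) \<Rightarrow> real" where
  "discrete_momentum_integral \<Omega> T \<tau> R S f =
     (LINT t:{0..T}|lborel.
        (LINT x:\<Omega>|interp_curve \<tau> R t. f (t, x) \<bullet> interp_velocity \<tau> S t x))"

text \<open>A finite vector measure \<open>E\<close> is given by a finite positive measure \<open>\<lambda>\<close> and an integrable
  vector density \<open>\<theta>\<close>, as \<open>E = \<theta> \<lambda>\<close>. By the polar decomposition (with \<open>\<lambda>\<close> the total
  variation of \<open>E\<close>) every finite vector measure is of this form. The pair is not unique, but
  only the integrals below are ever used.\<close>

type_synonym ('b, 'c) vmeasure = "'b measure \<times> ('b \<Rightarrow> 'c)"

definition vector_measure_on ::
  "'b::topological_space set \<Rightarrow> ('b, 'c::euclidean_space) vmeasure \<Rightarrow> bool" where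
  "vector_measure_on K E \<longleftrightarrow>
     sets (fst E) = sets borel \<and> finite_measure (fst E) \<and> emeasure (fst E) (- K) = 0 \<and>
     integrable (fst E) (snd E)"

definition vintegral ::
  "'b set \<Rightarrow> ('b, 'c::euclidean_space) vmeasure \<Rightarrow> ('b \<Rightarrow> 'c) \<Rightarrow> real" where
  "vintegral A E f = (LINT z:A|fst E. f z \<bullet> snd E z)"

text \<open>\<open>C\<^sup>1\<close> regularity of the potential on the compact domain, in the weakest usual sense: \<open>V\<close> is
  differentiable in the interior, and \<open>V\<close> and its gradient extend continuously to \<open>\<Omega>\<close>
  (the extension of the gradient is unique, the interior being dense in \<open>\<Omega>\<close>).\<close>

definition C1_closure :: "'a::euclidean_space set \<Rightarrow> ('a \<Rightarrow> real) \<Rightarrow> ('a \<Rightarrow> 'a) \<Rightarrow> bool" where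
  "C1_closure \<Omega> V gradV \<longleftrightarrow>
     continuous_on \<Omega> V \<and> continuous_on \<Omega> gradV \<and> (\<forall>x\<in>interior \<Omega>. GDERIV V x :> gradV x)"

text \<open>Test functions: \<open>C\<^sup>1\<close> on a set that need not be open means being the restriction of a \<open>C\<^sup>1\<close>
  function on an open neighbourhood. The derivative is carried along as a parameter: a gradient
  for scalar functions, a bounded linear map for vector-valued ones.\<close>

definition C1_scalar :: "'b::euclidean_space set \<Rightarrow> ('b \<Rightarrow> real) \<Rightarrow> ('b \<Rightarrow> 'b) \<Rightarrow> bool" where
  "C1_scalar A \<phi> G \<longleftrightarrow>
     (\<exists>W. open W \<and> A \<subseteq> W \<and> continuous_on W G \<and> (\<forall>z\<in>W. GDERIV \<phi> z :> G z))"

definition C1_field ::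
  "'b::euclidean_space set \<Rightarrow> ('b \<Rightarrow> 'c::euclidean_space) \<Rightarrow> ('b \<Rightarrow> 'b \<Rightarrow>\<^sub>L 'c) \<Rightarrow> bool" where
  "C1_field A f D \<longleftrightarrow>
     (\<exists>W. open W \<and> A \<subseteq> W \<and> continuous_on W D \<and>
        (\<forall>z\<in>W. (f has_derivative blinfun_apply (D z)) (at z)))"

definition compactly_supported_in ::
  "'b::topological_space set \<Rightarrow> ('b \<Rightarrow> 'c::zero) \<Rightarrow> bool" where
  "compactly_supported_in A f \<longleftrightarrow> (\<exists>K. compact K \<and> K \<subseteq> A \<and> (\<forall>z\<in>A - K. f z = 0))"

text \<open>The divergence with respect to \<open>x\<close> of a field of \<open>(t, x)\<close> with total derivative \<open>D\<close>.\<close>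

definition space_div ::
  "(real \<times> 'a::euclidean_space \<Rightarrow> (real \<times> 'a) \<Rightarrow>\<^sub>L 'a) \<Rightarrow> real \<times> 'a \<Rightarrow> real" where
  "space_div D z = (\<Sum>b\<in>Basis. blinfun_apply (D z) (0, b) \<bullet> b)"

text \<open>A gradient \<open>G\<close> on space-time is the pair \<open>(\<partial>\<^sub>t \<phi>, \<nabla>\<phi>)\<close>. Test functions are only prescribed on
  the open time interval (and, for interior tests, on the interior of \<open>\<Omega>\<close>); as they are extended
  by zero, integrals run over those sets.\<close>

definition continuity_eq_noflux ::
  "'a::euclidean_space set \<Rightarrow> real \<Rightarrow> (real \<Rightarrow> 'a measure) \<Rightarrow> (real \<times> 'a, 'a) vmeasure \<Rightarrow> bool" where
  "continuity_eq_noflux \<Omega> T \<rho> E \<longleftrightarrow>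
     (\<forall>\<phi> G. C1_scalar ({0<..<T} \<times> \<Omega>) \<phi> G \<and> compactly_supported_in ({0<..<T} \<times> \<Omega>) \<phi> \<longrightarrow>
        (LINT t:{0<..<T}|lborel. (LINT x:\<Omega>|\<rho> t. fst (G (t, x))))
          + vintegral ({0<..<T} \<times> \<Omega>) E (\<lambda>z. snd (G z)) = 0)"

text \<open>\<open>E = - \<nabla>\<rho> - \<rho> \<nabla>V\<close>.\<close>

definition flux_law ::
  "'a::euclidean_space set \<Rightarrow> ('a \<Rightarrow> 'a) \<Rightarrow> real \<Rightarrow> (real \<Rightarrow> 'a measure) \<Rightarrow>
     (real \<times> 'a, 'a) vmeasure \<Rightarrow> bool" where
  "flux_law \<Omega> gradV T \<rho> E \<longleftrightarrow>
     (\<forall>f D. C1_field ({0<..<T} \<times> interior \<Omega>) f D \<and>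
            compactly_supported_in ({0<..<T} \<times> interior \<Omega>) f \<longrightarrow>
        vintegral ({0<..<T} \<times> interior \<Omega>) E f =
          (LINT t:{0<..<T}|lborel. (LINT x:interior \<Omega>|\<rho> t. space_div D (t, x)))
          - (LINT t:{0<..<T}|lborel. (LINT x:interior \<Omega>|\<rho> t. f (t, x) \<bullet> gradV x)))"

text \<open>\<open>\<partial>\<^sub>t \<rho> - \<Delta>\<rho> - \<nabla>\<cdot>(\<rho> \<nabla>V) = 0\<close> in the interior, all derivatives being moved to the test
  function. Here \<open>D\<close> is the derivative of \<open>\<nabla>\<phi>\<close>, so \<open>space_div D\<close> is \<open>\<Delta>\<phi>\<close>.\<close>

definition fokker_planck_interior ::
  "'a::euclidean_space set \<Rightarrow> ('a \<Rightarrow> 'a) \<Rightarrow> real \<Rightarrow> (real \<Rightarrow> 'a measure) \<Rightarrow> bool" where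
  "fokker_planck_interior \<Omega> gradV T \<rho> \<longleftrightarrow>
     (\<forall>\<phi> G D. C1_scalar ({0<..<T} \<times> interior \<Omega>) \<phi> G \<and>
              C1_field ({0<..<T} \<times> interior \<Omega>) (\<lambda>z. snd (G z)) D \<and>
              compactly_supported_in ({0<..<T} \<times> interior \<Omega>) \<phi> \<longrightarrow>
        (LINT t:{0<..<T}|lborel. (LINT x:interior \<Omega>|\<rho> t.
           fst (G (t, x)) + space_div D (t, x) - snd (G (t, x)) \<bullet> gradV x)) = 0)"

text \<open>The boundary condition \<open>(\<nabla>\<rho> + \<rho> \<nabla>V) \<cdot> n = 0\<close> is understood weakly: the flux
  \<open>E = - \<nabla>\<rho> - \<rho> \<nabla>V\<close> balances \<open>\<partial>\<^sub>t \<rho>\<close> against test functions that need not vanish on the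
  boundary. The flux is a parameter rather than existentially quantified: an arbitrary vector
  measure satisfying \<open>flux_law\<close> could charge the boundary and so spoil the condition.\<close>

definition fokker_planck_noflux ::
  "'a::euclidean_space set \<Rightarrow> ('a \<Rightarrow> 'a) \<Rightarrow> real \<Rightarrow> (real \<Rightarrow> 'a measure) \<Rightarrow>
     (real \<times> 'a, 'a) vmeasure \<Rightarrow> bool" where
  "fokker_planck_noflux \<Omega> gradV T \<rho> E \<longleftrightarrow>
     fokker_planck_interior \<Omega> gradV T \<rho> \<and>
     flux_law \<Omega> gradV T \<rho> E \<and> continuity_eq_noflux \<Omega> T \<rho> E"

definition W2_abs_continuous ::
  "'a::euclidean_space set \<Rightarrow> real \<Rightarrow> (real \<Rightarrow> 'a measure) \<Rightarrow> bool" where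
  "W2_abs_continuous \<Omega> T \<rho> \<longleftrightarrow>
     (\<exists>g. set_integrable lborel {0..T} g \<and>
        (\<forall>s t. 0 \<le> s \<and> s \<le> t \<and> t \<le> T \<longrightarrow> W2 \<Omega> (\<rho> s) (\<rho> t) \<le> (LINT r:{s..t}|lborel. g r)))"

end

theory Submission
  imports Defs
begin

text \<open>
  The proof rests on three ingredients: an a priori estimate that survives the limit, an exact
  Euler-Lagrange equation for every step, and a passage to the limit that uses nothing but the
  weak convergence of the curves and of the momenta.

  \<^bold>\<open>A priori estimate.\<close> Testing the minimality of a step with the previous measure and summing
  telescopes the energy, which is bounded below because \<open>s log s\<close> and \<open>V\<close> are
  (\<open>jko_total_cost_bound\<close>). Hence the squared distances of the first \<open>N\<close> steps sum up to at most \<open>C h\<close>,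
  with \<open>C\<close> independent of the time step \<open>h\<close> and of \<open>N\<close>; equivalently, the discrete velocities
  are bounded in \<open>L\<^sup>2\<close> of space-time.

  \<^bold>\<open>Euler-Lagrange equation.\<close> The minimiser is perturbed by pushing it forward along
  \<open>x + \<epsilon> \<psi>(x) b\<close> with \<open>b\<close> a coordinate direction and \<open>\<psi>\<close> supported in the interior. As points move
  parallel to one axis, the Jacobian determinant is \<open>1 + \<epsilon> \<partial>\<^sub>b \<psi>\<close> and the change of variables is
  Fubini's theorem plus one-dimensional substitution (\<open>lborel_eq_distr_Phi\<close>). The entropy then changes
  by exactly \<open>- \<integral> ln (1 + \<epsilon> \<partial>\<^sub>b \<psi>)\<close> (\<open>entropy_fun_distr_Phi\<close>), and the transport cost at most by what
  the old transport map gives. Letting \<open>\<epsilon>\<close> tend to \<open>0\<close> from both sides, and summing over the axes, gives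
  \<open>\<integral> \<xi> \<bullet> v = \<integral> div \<xi> - \<integral> \<xi> \<bullet> \<nabla>V\<close> for every step (\<open>jko_euler_lagrange\<close>). This identity is linear in the
  measure, so that both sides pass to the limit and give the flux law.

  \<^bold>\<open>Continuity equation.\<close> The discrete curve solves it up to an error: along a step,
  \<open>\<phi>(x) - \<phi>(S x)\<close> is \<open>\<nabla>\<phi>(x) \<bullet> (x - S x)\<close> up to \<open>\<eta> |x - S x| + C |x - S x|\<^sup>2\<close>, with \<open>\<eta>\<close> as small as desired.
  By the a priori estimate the total error is \<open>O(\<eta>) + O(h)\<close> (\<open>discrete_continuity_error\<close>). Since
  the test functions may be nonzero on the boundary, this is where the no-flux condition comes
  from: transport maps never leave the domain. Inserting the flux law into the continuity
  equation yields the Fokker-Planck equation.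

  \<^bold>\<open>Absolute continuity.\<close> In the limit the a priori estimate bounds the \<open>L\<^sup>2\<close> norm of the
  difference quotients of the curve on every uniform grid. On dyadic grids these
  quotients form a submartingale by the triangle inequality for \<open>W\<^sub>2\<close>; being bounded in \<open>L\<^sup>2\<close>, it is Cauchy
  there, and a rapidly converging subsequence has an integrable majorant, which is the density sought
  (\<open>finite_energy_curve_abs_continuous\<close>). The triangle inequality itself is proved by gluing plans
  approximately, cell by cell (\<open>approximate_gluing\<close>), instead of disintegrating them.
\<close>

section \<open>Measures concentrated on a compact set\<close>

lemma prob_onD:
  assumes "\<mu> \<in> prob_on K"
  shows "prob_space \<mu>" "sets \<mu> = sets borel" "space \<mu> = UNIV" "finite_measure \<mu>"
proof -
  show "prob_space \<mu>" and s: "sets \<mu> = sets borel" using assms by (auto simp: prob_on_def)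
  then show "space \<mu> = UNIV" "finite_measure \<mu>"
    by (auto dest: sets_eq_imp_space_eq simp: prob_space_def)
qed

lemma prob_on_AE:
  assumes "\<mu> \<in> prob_on K" "K \<in> sets borel"
  shows "AE x in \<mu>. x \<in> K"
proof (rule AE_I')
  show "-K \<in> null_sets \<mu>"
    using assms by (auto simp: prob_on_def null_sets_def)
qed auto

lemma prob_onI:
  assumes "prob_space \<mu>" "sets \<mu> = sets borel" "K \<in> sets borel" "AE x in \<mu>. x \<in> K"
  shows "\<mu> \<in> prob_on K"
proof -
  have sp: "space \<mu> = UNIV" using assms(2) by (auto dest: sets_eq_imp_space_eq)
  have "emeasure \<mu> (-K) = 0"
    using assms AE_iff_measurable[of "-K" \<mu> "\<lambda>x. x \<in> K"] by (auto simp: sp)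
  then show ?thesis using assms by (auto simp: prob_on_def)
qed

text \<open>Integrals in the definitions are restricted to the set on which the measure is concentrated;
  for integrands that are Borel on the whole space the restriction can be dropped.\<close>

lemma set_integral_prob_on:
  fixes g :: "'b::topological_space \<Rightarrow> 'c::{banach, second_countable_topology}"
  assumes "\<mu> \<in> prob_on K" "K \<in> sets borel" "g \<in> borel_measurable borel"
  shows "(LINT x:K|\<mu>. g x) = (LINT x|\<mu>. g x)"
proof -
  have [measurable]: "g \<in> borel_measurable \<mu>" "K \<in> sets \<mu>"
    using assms prob_onD(2)[OF assms(1)] by (auto cong: measurable_cong_sets)
  show ?thesis unfolding set_lebesgue_integral_def
    by (rule integral_cong_AE) (use prob_on_AE[OF assms(1,2)] in \<open>auto\<close>)
qed

lemma set_integrable_bounded: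
  fixes g :: "'b::topological_space \<Rightarrow> real"
  assumes "finite_measure \<mu>" "sets \<mu> = sets borel" "K \<in> sets borel"
    "(\<lambda>x. indicat_real K x * g x) \<in> borel_measurable borel" "\<And>x. x \<in> K \<Longrightarrow> \<bar>g x\<bar> \<le> B"
  shows "set_integrable \<mu> K g"
  unfolding set_integrable_def
proof (rule finite_measure.integrable_const_bound[OF assms(1), of _ "max B 0"])
  show "AE x in \<mu>. norm (indicat_real K x *\<^sub>R g x) \<le> max B 0"
    using assms(5) by (auto simp: indicator_def intro!: AE_I2) (meson le_max_iff_disj)
  show "(\<lambda>x. indicat_real K x *\<^sub>R g x) \<in> borel_measurable \<mu>"
    using assms by (auto cong: measurable_cong_sets)
qed

lemma continuous_on_indicator_measurable:
  fixes g :: "'b::topological_space \<Rightarrow> real"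
  assumes "K \<in> sets borel" "continuous_on K g"
  shows "(\<lambda>x. indicat_real K x * g x) \<in> borel_measurable borel"
  using borel_measurable_continuous_on_indicator[OF assms] by simp

lemma set_integrable_continuous_compact:
  fixes g :: "'b::t2_space \<Rightarrow> real"
  assumes "finite_measure \<mu>" "sets \<mu> = sets borel" "compact K" "continuous_on K g"
  shows "set_integrable \<mu> K g"
proof -
  obtain B where "\<And>x. x \<in> K \<Longrightarrow> \<bar>g x\<bar> \<le> B"
    using compact_imp_bounded[OF compact_continuous_image[OF assms(4,3)]]
    by (auto simp: bounded_iff)
  then show ?thesis using assms
    by (intro set_integrable_bounded[of _ _ _ B])
      (auto intro!: continuous_on_indicator_measurable borel_compact)
qed

lemma set_integral_abs_le_bound:
  fixes g :: "'b::topological_space \<Rightarrow> real"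
  assumes "\<mu> \<in> prob_on K" "\<And>x. x \<in> K \<Longrightarrow> \<bar>g x\<bar> \<le> B" "B \<ge> 0"
  shows "\<bar>LINT x:K|\<mu>. g x\<bar> \<le> B"
proof -
  interpret prob_space \<mu> using prob_onD[OF assms(1)] by simp
  show ?thesis
  proof (cases "set_integrable \<mu> K g")
    case True
    have "\<bar>LINT x:K|\<mu>. g x\<bar> \<le> (LINT x|\<mu>. \<bar>indicat_real K x * g x\<bar>)"
      unfolding set_lebesgue_integral_def using integral_abs_bound[of \<mu>] by simp
    also have "\<dots> \<le> (LINT x|\<mu>. B)"
      using assms(2,3) integrable_abs[OF True[unfolded set_integrable_def]]
      by (intro integral_mono) (auto simp: indicator_def abs_mult)
    finally show ?thesis by (simp add: prob_space)
  next
    case False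
    then show ?thesis using assms(3)
      by (simp add: set_lebesgue_integral_def set_integrable_def not_integrable_integral_eq)
  qed
qed

section \<open>Couplings and the quadratic Wasserstein distance\<close>

lemma measurable_fst_borel: "fst \<in> (borel :: ('b::topological_space \<times> 'c::topological_space) measure) \<rightarrow>\<^sub>M borel"
  and measurable_snd_borel: "snd \<in> (borel :: ('b::topological_space \<times> 'c::topological_space) measure) \<rightarrow>\<^sub>M borel"
  by (intro borel_measurable_continuous_onI continuous_intros)+

lemma measurable_quadratic_cost:
  "(\<lambda>p. (norm (fst p - snd p))\<^sup>2) \<in> borel_measurable (borel :: ('b::real_normed_vector \<times> 'b) measure)"
  by (intro borel_measurable_continuous_onI continuous_intros)

text \<open>A coupling is the joint law of two random variables on some probability space. In this form upper
  bounds for the distance are obtained by exhibiting the two variables, and the support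
  condition holds automatically because both laws are concentrated on \<open>\<Omega>\<close>.\<close>

lemma W2_le_random:
  assumes "closed \<Omega>" "prob_space M" and [measurable]: "X \<in> borel_measurable M" "Y \<in> borel_measurable M"
    and d: "distr M borel X = \<mu>" "distr M borel Y = \<nu>" "\<mu> \<in> prob_on \<Omega>" "\<nu> \<in> prob_on \<Omega>"
  shows "(W2 \<Omega> \<mu> \<nu>)\<^sup>2 \<le> (LINT z|M. (norm (X z - Y z))\<^sup>2)"
proof -
  interpret prob_space M by fact
  have O: "\<Omega> \<in> sets borel" "\<Omega> \<times> \<Omega> \<in> sets borel" using assms(1) by (auto intro!: borel_closed closed_Times)
  define \<gamma> where "\<gamma> = distr M borel (\<lambda>z. (X z, Y z))"
  have XY[measurable]: "(\<lambda>z. (X z, Y z)) \<in> borel_measurable M"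
    by (simp add: borel_prod[symmetric])
  have "AE z in M. X z \<in> \<Omega>" "AE z in M. Y z \<in> \<Omega>"
    using prob_on_AE[OF d(3) O(1)] prob_on_AE[OF d(4) O(1)] O(1)
    unfolding d(1)[symmetric] d(2)[symmetric] by (simp_all add: AE_distr_iff)
  then have AE: "AE p in \<gamma>. p \<in> \<Omega> \<times> \<Omega>"
    unfolding \<gamma>_def using O by (subst AE_distr_iff) (auto simp: )
  have \<gamma>: "\<gamma> \<in> couplings \<Omega> \<mu> \<nu>"
    unfolding couplings_def
  proof (intro CollectI conjI)
    show "\<gamma> \<in> prob_on (\<Omega> \<times> \<Omega>)"
      by (rule prob_onI[OF _ _ O(2) AE]) (auto simp: \<gamma>_def prob_space_distr)
    show "distr \<gamma> borel fst = \<mu>" "distr \<gamma> borel snd = \<nu>"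
      using distr_distr[OF measurable_fst_borel XY] distr_distr[OF measurable_snd_borel XY]
      by (simp_all add: \<gamma>_def d(1,2)[symmetric] comp_def)
  qed
  have "(INF \<gamma>\<in>couplings \<Omega> \<mu> \<nu>. (LINT p:\<Omega> \<times> \<Omega>|\<gamma>. (norm (fst p - snd p))\<^sup>2)) \<le> (LINT p:\<Omega> \<times> \<Omega>|\<gamma>. (norm (fst p - snd p))\<^sup>2)"
    by (rule cINF_lower[OF _ \<gamma>]) (auto intro!: bdd_belowI2[of _ 0] simp: set_lebesgue_integral_def)
  also have "\<dots> = (LINT p|\<gamma>. (norm (fst p - snd p))\<^sup>2)"
    using \<gamma> by (intro set_integral_prob_on O(2) measurable_quadratic_cost) (simp add: couplings_def)
  also have "\<dots> = (LINT z|M. (norm (X z - Y z))\<^sup>2)"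
    unfolding \<gamma>_def by (subst integral_distr) (simp_all add: measurable_quadratic_cost)
  finally have 1: "(INF \<gamma>\<in>couplings \<Omega> \<mu> \<nu>. (LINT p:\<Omega> \<times> \<Omega>|\<gamma>. (norm (fst p - snd p))\<^sup>2)) \<le> (LINT z|M. (norm (X z - Y z))\<^sup>2)" .
  have "0 \<le> (INF \<gamma>\<in>couplings \<Omega> \<mu> \<nu>. (LINT p:\<Omega> \<times> \<Omega>|\<gamma>. (norm (fst p - snd p))\<^sup>2))"
    by (rule cINF_greatest) (use \<gamma> in \<open>auto simp: set_lebesgue_integral_def\<close>)
  with 1 show ?thesis by (simp add: W2_def)
qed

text \<open>The product measure is a coupling, so that the infimum defining the distance ranges over a nonempty set.\<close>

lemma couplings_nonempty:
  assumes "closed \<Omega>" "\<mu> \<in> prob_on \<Omega>" "\<nu> \<in> prob_on \<Omega>"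
  shows "couplings \<Omega> \<mu> \<nu> \<noteq> {}"
proof -
  interpret \<mu>: prob_space \<mu> using prob_onD[OF assms(2)] by simp
  interpret \<nu>: prob_space \<nu> using prob_onD[OF assms(3)] by simp
  interpret pair_prob_space \<mu> \<nu> ..
  have O: "\<Omega> \<in> sets borel" "\<Omega> \<times> \<Omega> \<in> sets borel" using assms(1) by (auto intro!: borel_closed closed_Times)
  note s[measurable_cong] = prob_onD(2)[OF assms(2)] prob_onD(2)[OF assms(3)]
  have [simp]: "space \<mu> = UNIV" "space \<nu> = UNIV"
    using prob_onD(3) assms by blast+
  have sets: "sets (\<mu> \<Otimes>\<^sub>M \<nu>) = sets borel"
    using s sets_pair_measure_cong borel_prod by metis
  have "AE p in \<mu> \<Otimes>\<^sub>M \<nu>. p \<in> \<Omega> \<times> \<Omega>"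
  proof (rule AE_pair_measure)
    have "{p \<in> space (\<mu> \<Otimes>\<^sub>M \<nu>). p \<in> \<Omega> \<times> \<Omega>} = \<Omega> \<times> \<Omega>" by (auto simp: space_pair_measure)
    then show "{p \<in> space (\<mu> \<Otimes>\<^sub>M \<nu>). p \<in> \<Omega> \<times> \<Omega>} \<in> sets (\<mu> \<Otimes>\<^sub>M \<nu>)"
      using O sets by simp
    show "AE x in \<mu>. AE y in \<nu>. (x, y) \<in> \<Omega> \<times> \<Omega>"
      using prob_on_AE[OF assms(2) O(1)] prob_on_AE[OF assms(3) O(1)] by auto
  qed
  then have "\<mu> \<Otimes>\<^sub>M \<nu> \<in> prob_on (\<Omega> \<times> \<Omega>)"
    by (intro prob_onI sets O(2)) unfold_locales
  moreover have "distr (\<mu> \<Otimes>\<^sub>M \<nu>) borel fst = \<mu>"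
    using \<nu>.distr_pair_fst[of \<mu>] distr_cong[OF refl s(1)[symmetric], of "\<mu> \<Otimes>\<^sub>M \<nu>" fst fst] by simp
  moreover have "distr (\<mu> \<Otimes>\<^sub>M \<nu>) borel snd = \<nu>"
  proof (rule measure_eqI)
    fix A assume "A \<in> sets (distr (\<mu> \<Otimes>\<^sub>M \<nu>) borel snd)"
    then have A[measurable]: "A \<in> sets borel" by simp
    have "snd -` A \<inter> space (\<mu> \<Otimes>\<^sub>M \<nu>) = UNIV \<times> A" by (auto simp: space_pair_measure)
    moreover have "snd \<in> measurable (\<mu> \<Otimes>\<^sub>M \<nu>) borel" by measurable
    ultimately show "emeasure (distr (\<mu> \<Otimes>\<^sub>M \<nu>) borel snd) A = emeasure \<nu> A"
      using \<nu>.emeasure_pair_measure_Times[of UNIV \<mu> A] \<mu>.emeasure_space_1 s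
      by (simp add: emeasure_distr A)
  qed (simp add: s)
  ultimately show ?thesis by (auto simp: couplings_def)
qed

lemma W2_nonneg:
  assumes "closed \<Omega>" "\<mu> \<in> prob_on \<Omega>" "\<nu> \<in> prob_on \<Omega>"
  shows "0 \<le> W2 \<Omega> \<mu> \<nu>"
  unfolding W2_def
  by (simp, rule cINF_greatest[OF couplings_nonempty[OF assms]]) (auto simp: set_lebesgue_integral_def)

text \<open>Together with the preceding upper bound this characterises the distance. Plans that are optimal up to
  an arbitrary margin take the place of optimal plans between general measures.\<close>

lemma near_optimal_coupling:
  assumes "closed \<Omega>" "\<mu> \<in> prob_on \<Omega>" "\<nu> \<in> prob_on \<Omega>" "(W2 \<Omega> \<mu> \<nu>)\<^sup>2 < c"
  obtains \<gamma> where "\<gamma> \<in> prob_on (\<Omega> \<times> \<Omega>)" "distr \<gamma> borel fst = \<mu>" "distr \<gamma> borel snd = \<nu>"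
    "(LINT p|\<gamma>. (norm (fst p - snd p))\<^sup>2) < c"
proof -
  have O: "\<Omega> \<times> \<Omega> \<in> sets borel" using assms(1) by (auto intro!: borel_closed closed_Times)
  have ne: "couplings \<Omega> \<mu> \<nu> \<noteq> {}" by (rule couplings_nonempty) fact+
  have "0 \<le> (INF \<gamma>\<in>couplings \<Omega> \<mu> \<nu>. (LINT p:\<Omega> \<times> \<Omega>|\<gamma>. (norm (fst p - snd p))\<^sup>2))"
    by (rule cINF_greatest[OF ne]) (auto simp: set_lebesgue_integral_def)
  then have "(INF \<gamma>\<in>couplings \<Omega> \<mu> \<nu>. (LINT p:\<Omega> \<times> \<Omega>|\<gamma>. (norm (fst p - snd p))\<^sup>2)) < c"
    using assms(4) by (simp add: W2_def)
  then obtain \<gamma> where g: "\<gamma> \<in> couplings \<Omega> \<mu> \<nu>" "(LINT p:\<Omega> \<times> \<Omega>|\<gamma>. (norm (fst p - snd p))\<^sup>2) < c"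
    using cInf_lessD[of "(\<lambda>\<gamma>. (LINT p:\<Omega> \<times> \<Omega>|\<gamma>. (norm (fst p - snd p))\<^sup>2)) ` couplings \<Omega> \<mu> \<nu>" c] ne
    by blast
  have \<gamma>: "\<gamma> \<in> prob_on (\<Omega> \<times> \<Omega>)" "distr \<gamma> borel fst = \<mu>" "distr \<gamma> borel snd = \<nu>"
    using g(1) by (auto simp: couplings_def)
  show ?thesis
    using measurable_quadratic_cost[where 'b='a] that[OF \<gamma>] g(2)
      set_integral_prob_on[OF \<gamma>(1) O, of "\<lambda>p. (norm (fst p - snd p))\<^sup>2"] by simp
qed

section \<open>Wasserstein convergence implies weak convergence\<close>

text \<open>Uniform continuity controls close points; for points at distance at least \<open>d\<close> the oscillation, at most
  \<open>2 B\<close>, is dominated by the quadratic term. A modulus of continuity of this form can be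
  integrated against a plan of which only the quadratic cost is known.\<close>

lemma compact_quadratic_modulus:
  fixes g :: "'a::real_normed_vector \<Rightarrow> real"
  assumes "compact K" "continuous_on K g" "e > 0"
  obtains C where "C \<ge> 0" "\<And>x y. x \<in> K \<Longrightarrow> y \<in> K \<Longrightarrow> \<bar>g x - g y\<bar> \<le> e + C * (norm (x - y))\<^sup>2"
proof -
  obtain B where B: "\<And>x. x \<in> K \<Longrightarrow> \<bar>g x\<bar> \<le> B" "B > 0"
    using compact_imp_bounded[OF compact_continuous_image[OF assms(2,1)]]
    by (auto simp: bounded_pos)
  obtain d where d: "d > 0" "\<And>x y. x \<in> K \<Longrightarrow> y \<in> K \<Longrightarrow> dist y x < d \<Longrightarrow> dist (g y) (g x) < e"
    using compact_uniformly_continuous[OF assms(2,1)] assms(3)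
    by (metis uniformly_continuous_onE)
  show ?thesis
  proof (rule that[of "2 * B / d\<^sup>2"])
    fix x y assume xy: "x \<in> K" "y \<in> K"
    show "\<bar>g x - g y\<bar> \<le> e + 2 * B / d\<^sup>2 * (norm (x - y))\<^sup>2"
    proof (cases "dist x y < d")
      case True
      then have "\<bar>g x - g y\<bar> \<le> e" using d(2)[OF xy(2,1)] by (auto simp: dist_real_def)
      moreover have "0 \<le> 2 * B / d\<^sup>2 * (norm (x - y))\<^sup>2" using B by simp
      ultimately show ?thesis by linarith
    next
      case False
      then have "d\<^sup>2 \<le> (norm (x - y))\<^sup>2" using d(1) by (auto simp: dist_norm intro!: power_mono)
      then have "2 * B \<le> 2 * B / d\<^sup>2 * (norm (x - y))\<^sup>2"
        using B(2) d(1) by (simp add: field_simps)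
      moreover have "\<bar>g x - g y\<bar> \<le> 2 * B" using B(1)[OF xy(1)] B(1)[OF xy(2)] by linarith
      ultimately show ?thesis using assms(3) by linarith
    qed
  qed (use B in auto)
qed

lemma W2_test_function_bound:
  fixes g :: "'a::euclidean_space \<Rightarrow> real"
  assumes "compact \<Omega>" "continuous_on \<Omega> g" "\<mu> \<in> prob_on \<Omega>" "\<nu> \<in> prob_on \<Omega>"
    and C: "C \<ge> 0" "\<And>x y. x \<in> \<Omega> \<Longrightarrow> y \<in> \<Omega> \<Longrightarrow> \<bar>g x - g y\<bar> \<le> e + C * (norm (x - y))\<^sup>2"
  shows "\<bar>(LINT x:\<Omega>|\<mu>. g x) - (LINT x:\<Omega>|\<nu>. g x)\<bar> \<le> e + C * (W2 \<Omega> \<mu> \<nu>)\<^sup>2"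
proof (rule field_le_epsilon)
  fix r :: real assume r: "r > 0"
  have cl: "closed \<Omega>" and O: "\<Omega> \<in> sets borel" "\<Omega> \<times> \<Omega> \<in> sets borel"
    using compact_imp_closed[OF assms(1)] by (auto intro!: borel_closed closed_Times)
  have "(W2 \<Omega> \<mu> \<nu>)\<^sup>2 < (W2 \<Omega> \<mu> \<nu>)\<^sup>2 + r / (C + 1)" using r C by simp
  from near_optimal_coupling[OF cl assms(3,4) this]
  obtain \<gamma> where \<gamma>: "\<gamma> \<in> prob_on (\<Omega> \<times> \<Omega>)" "distr \<gamma> borel fst = \<mu>" "distr \<gamma> borel snd = \<nu>"
    "(LINT p|\<gamma>. (norm (fst p - snd p))\<^sup>2) < (W2 \<Omega> \<mu> \<nu>)\<^sup>2 + r / (C + 1)" .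
  interpret \<gamma>: prob_space \<gamma> using prob_onD[OF \<gamma>(1)] by simp
  have m: "fst \<in> \<gamma> \<rightarrow>\<^sub>M borel" "snd \<in> \<gamma> \<rightarrow>\<^sub>M borel"
    "(\<lambda>p. (norm (fst p - snd p))\<^sup>2) \<in> borel_measurable \<gamma>"
    using measurable_fst_borel measurable_snd_borel measurable_quadratic_cost
    by (simp_all add: measurable_cong_sets[OF prob_onD(2)[OF \<gamma>(1)] refl])
  define h where "h = (\<lambda>x. indicat_real \<Omega> x * g x)"
  have h[measurable]: "h \<in> borel_measurable borel"
    unfolding h_def by (rule continuous_on_indicator_measurable) fact+
  obtain B where B: "\<And>x. x \<in> \<Omega> \<Longrightarrow> \<bar>g x\<bar> \<le> B" "B > 0"
    using compact_imp_bounded[OF compact_continuous_image[OF assms(2,1)]]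
    by (auto simp: bounded_pos)
  obtain D where D: "\<And>x. x \<in> \<Omega> \<Longrightarrow> norm x \<le> D"
    using compact_imp_bounded[OF assms(1)] by (auto simp: bounded_iff)
  have hB: "\<bar>h x\<bar> \<le> B" for x using B by (auto simp: h_def indicator_def)
  have AE: "AE p in \<gamma>. p \<in> \<Omega> \<times> \<Omega>" by (rule prob_on_AE) fact+
  have ih: "integrable \<gamma> (\<lambda>p. h (fst p))" "integrable \<gamma> (\<lambda>p. h (snd p))"
    by (intro \<gamma>.integrable_const_bound[of _ B] measurable_compose[OF m(1)] measurable_compose[OF m(2)];
      use hB h in simp)+
  have ic: "integrable \<gamma> (\<lambda>p. (norm (fst p - snd p))\<^sup>2)"
  proof (rule \<gamma>.integrable_const_bound[of _ "(2 * D)\<^sup>2"])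
    show "AE p in \<gamma>. norm ((norm (fst p - snd p))\<^sup>2) \<le> (2 * D)\<^sup>2"
      using AE
    proof eventually_elim
      case (elim p)
      then have "norm (fst p - snd p) \<le> 2 * D"
        using D[of "fst p"] D[of "snd p"] norm_triangle_ineq4[of "fst p" "snd p"] by auto
      then show ?case
        using power_mono[of "norm (fst p - snd p)" "2 * D" 2] by simp
    qed
  qed (rule m)
  have "(LINT x:\<Omega>|\<mu>. g x) = (LINT p|\<gamma>. h (fst p))" "(LINT x:\<Omega>|\<nu>. g x) = (LINT p|\<gamma>. h (snd p))"
    unfolding set_lebesgue_integral_def \<gamma>(2,3)[symmetric] using integral_distr[OF m(1) h] integral_distr[OF m(2) h]
    by (simp_all add: h_def)
  then have "\<bar>(LINT x:\<Omega>|\<mu>. g x) - (LINT x:\<Omega>|\<nu>. g x)\<bar> = \<bar>LINT p|\<gamma>. h (fst p) - h (snd p)\<bar>"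
    using ih by simp
  also have "\<dots> \<le> (LINT p|\<gamma>. \<bar>h (fst p) - h (snd p)\<bar>)"
    using integral_abs_bound[of \<gamma>] by simp
  also have "\<dots> \<le> (LINT p|\<gamma>. e + C * (norm (fst p - snd p))\<^sup>2)"
  proof (rule integral_mono_AE)
    show "AE p in \<gamma>. \<bar>h (fst p) - h (snd p)\<bar> \<le> e + C * (norm (fst p - snd p))\<^sup>2"
      using AE by eventually_elim (use C in \<open>auto simp: h_def\<close>)
  qed (use ih ic in auto)
  also have "\<dots> = e + C * (LINT p|\<gamma>. (norm (fst p - snd p))\<^sup>2)"
    using ic by (simp add: \<gamma>.prob_space)
  also have "\<dots> \<le> e + C * ((W2 \<Omega> \<mu> \<nu>)\<^sup>2 + r / (C + 1))"
    using \<gamma>(4) C by (intro add_left_mono mult_left_mono) auto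
  also have "\<dots> \<le> e + C * (W2 \<Omega> \<mu> \<nu>)\<^sup>2 + r"
    using C r by (simp add: field_simps)
  finally show "\<bar>(LINT x:\<Omega>|\<mu>. g x) - (LINT x:\<Omega>|\<nu>. g x)\<bar> \<le> e + C * (W2 \<Omega> \<mu> \<nu>)\<^sup>2 + r" .
qed

text \<open>The half of the equivalence between Wasserstein and weak convergence that the limit passages use.\<close>

lemma W2_tendsto_imp_integral_tendsto:
  fixes g :: "'a::euclidean_space \<Rightarrow> real"
  assumes "compact \<Omega>" "continuous_on \<Omega> g" "\<And>j. \<mu> j \<in> prob_on \<Omega>" "\<nu> \<in> prob_on \<Omega>"
    and W: "((\<lambda>j. W2 \<Omega> (\<mu> j) \<nu>) \<longlongrightarrow> 0) F"
  shows "((\<lambda>j. LINT x:\<Omega>|\<mu> j. g x) \<longlongrightarrow> (LINT x:\<Omega>|\<nu>. g x)) F"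
proof (rule tendstoI)
  fix e :: real assume e: "e > 0"
  then obtain C where C: "C \<ge> 0" "\<And>x y. x \<in> \<Omega> \<Longrightarrow> y \<in> \<Omega> \<Longrightarrow> \<bar>g x - g y\<bar> \<le> e / 2 + C * (norm (x - y))\<^sup>2"
    using compact_quadratic_modulus[OF assms(1,2), of "e/2"] by auto
  have "((\<lambda>j. e / 2 + C * (W2 \<Omega> (\<mu> j) \<nu>)\<^sup>2) \<longlongrightarrow> e / 2 + C * 0\<^sup>2) F"
    by (intro tendsto_intros W)
  from order_tendstoD(2)[OF this, of e]
  have "eventually (\<lambda>j. e / 2 + C * (W2 \<Omega> (\<mu> j) \<nu>)\<^sup>2 < e) F"
    using e by simp
  then show "eventually (\<lambda>j. dist (LINT x:\<Omega>|\<mu> j. g x) (LINT x:\<Omega>|\<nu>. g x) < e) F"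
  proof eventually_elim
    case (elim j)
    then show ?case
      using W2_test_function_bound[OF assms(1,2,3) assms(4) C, of j] unfolding dist_real_def by linarith
  qed
qed

text \<open>The indicator of a closed set is the decreasing limit of the continuous functions
  \<open>max 0 (1 - n dist(\<cdot>, C))\<close>, and closed sets form an intersection-stable generator of the Borel sets.\<close>

lemma prob_on_eqI_continuous:
  fixes \<mu> \<nu> :: "'a::euclidean_space measure"
  assumes "compact \<Omega>" "\<mu> \<in> prob_on \<Omega>" "\<nu> \<in> prob_on \<Omega>"
    and eq: "\<And>g :: 'a \<Rightarrow> real. continuous_on UNIV g \<Longrightarrow> (LINT x:\<Omega>|\<mu>. g x) = (LINT x:\<Omega>|\<nu>. g x)"
  shows "\<mu> = \<nu>"
proof -
  have O: "\<Omega> \<in> sets borel" using assms(1) by (rule borel_compact)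
  have closed: "(\<lambda>n. LINT x:\<Omega>|M. max 0 (1 - real n * infdist x C)) \<longlonglongrightarrow> measure M C"
    if M: "M \<in> prob_on \<Omega>" and C: "closed C" "C \<noteq> {}" for M :: "'a measure" and C
  proof -
    interpret M: prob_space M using prob_onD[OF M] by simp
    note [measurable_cong] = prob_onD(2)[OF M]
    have [measurable]: "C \<in> sets M" using C prob_onD(2)[OF M] by simp
    have m[measurable]: "(\<lambda>x. max 0 (1 - real n * infdist x C)) \<in> borel_measurable borel" for n
      by (intro borel_measurable_continuous_onI continuous_intros)
    have "(\<lambda>n. LINT x|M. max 0 (1 - real n * infdist x C)) \<longlonglongrightarrow> (LINT x|M. indicat_real C x)"
    proof (rule integral_dominated_convergence[where w = "\<lambda>_. 1"])
      show "AE x in M. (\<lambda>n. max 0 (1 - real n * infdist x C)) \<longlonglongrightarrow> indicat_real C x"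
      proof (intro AE_I2)
        fix x
        show "(\<lambda>n. max 0 (1 - real n * infdist x C)) \<longlonglongrightarrow> indicat_real C x"
        proof (cases "x \<in> C")
          case False
          then have p: "infdist x C > 0"
            using C in_closed_iff_infdist_zero[of C x] infdist_nonneg[of x C] by force
          then obtain N where N: "1 < real N * infdist x C" using reals_Archimedean3 by blast
          have "max 0 (1 - real n * infdist x C) = 0" if "n \<ge> N" for n
          proof -
            have "real N * infdist x C \<le> real n * infdist x C"
              using that by (intro mult_right_mono) (auto simp: infdist_nonneg)
            then show ?thesis using N by simp
          qed
          then have "eventually (\<lambda>n. max 0 (1 - real n * infdist x C) = indicat_real C x) sequentially"
            using False by (auto simp: eventually_sequentially)
          then show ?thesis by (rule tendsto_eventually)
        qed auto
      qed
    qed (auto simp: infdist_nonneg)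
    then show ?thesis by (simp add: set_integral_prob_on[OF M O m])
  qed
  note s = prob_onD(2)[OF assms(2)] prob_onD(2)[OF assms(3)]
  interpret \<mu>: prob_space \<mu> using prob_onD[OF assms(2)] by simp
  interpret \<nu>: prob_space \<nu> using prob_onD[OF assms(3)] by simp
  show ?thesis
  proof (rule measure_eqI_generator_eq[where E = "Collect closed" and A = "\<lambda>_. UNIV" and \<Omega> = UNIV])
    fix C :: "'a set" assume C: "C \<in> Collect closed"
    show "emeasure \<mu> C = emeasure \<nu> C"
    proof (cases "C = {}")
      case False
      have "(LINT x:\<Omega>|\<mu>. max 0 (1 - real n * infdist x C)) = (LINT x:\<Omega>|\<nu>. max 0 (1 - real n * infdist x C))" for n
        by (rule eq) (intro continuous_intros)
      then have "measure \<mu> C = measure \<nu> C"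
        using closed[OF assms(2), of C] closed[OF assms(3), of C] C False
        by (auto intro: LIMSEQ_unique)
      then show ?thesis by (simp add: \<mu>.emeasure_eq_measure \<nu>.emeasure_eq_measure)
    qed simp
  qed (auto simp: s borel_eq_closed Int_stable_def \<mu>.emeasure_eq_measure)
qed

section \<open>Symmetry and the triangle inequality\<close>

lemma W2_commute:
  assumes "closed \<Omega>" "\<mu> \<in> prob_on \<Omega>" "\<nu> \<in> prob_on \<Omega>"
  shows "W2 \<Omega> \<mu> \<nu> = W2 \<Omega> \<nu> \<mu>"
proof -
  have le: "W2 \<Omega> \<mu> \<nu> \<le> W2 \<Omega> \<nu> \<mu>" if m: "\<mu> \<in> prob_on \<Omega>" "\<nu> \<in> prob_on \<Omega>" for \<mu> \<nu>
  proof (rule power2_le_imp_le[OF _ W2_nonneg[OF assms(1) m(2,1)]], rule ccontr)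
    assume "\<not> (W2 \<Omega> \<mu> \<nu>)\<^sup>2 \<le> (W2 \<Omega> \<nu> \<mu>)\<^sup>2"
    then have "(W2 \<Omega> \<nu> \<mu>)\<^sup>2 < (W2 \<Omega> \<mu> \<nu>)\<^sup>2" by simp
    from near_optimal_coupling[OF assms(1) m(2,1) this]
    obtain \<gamma> where \<gamma>: "\<gamma> \<in> prob_on (\<Omega> \<times> \<Omega>)" "distr \<gamma> borel fst = \<nu>" "distr \<gamma> borel snd = \<mu>"
      "(LINT p|\<gamma>. (norm (fst p - snd p))\<^sup>2) < (W2 \<Omega> \<mu> \<nu>)\<^sup>2" .
    have "(W2 \<Omega> \<mu> \<nu>)\<^sup>2 \<le> (LINT p|\<gamma>. (norm (snd p - fst p))\<^sup>2)"
      using \<gamma> m measurable_fst_borel measurable_snd_borel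
      by (intro W2_le_random[OF assms(1) prob_onD(1)[OF \<gamma>(1)]])
        (simp_all add: measurable_cong_sets[OF prob_onD(2)[OF \<gamma>(1)] refl])
    with \<gamma>(4) show False by (simp add: norm_minus_commute)
  qed
  show ?thesis using le[OF assms(2,3)] le[OF assms(3,2)] by simp
qed

lemma W2_self:
  assumes "closed \<Omega>" "\<mu> \<in> prob_on \<Omega>"
  shows "W2 \<Omega> \<mu> \<mu> = 0"
proof -
  have "(\<lambda>x. x) \<in> borel_measurable \<mu>" "distr \<mu> borel (\<lambda>x. x) = \<mu>"
    using prob_onD(2)[OF assms(2)] distr_id2[of borel \<mu>] by (simp_all add: measurable_ident_sets)
  then have "(W2 \<Omega> \<mu> \<mu>)\<^sup>2 \<le> 0"
    using W2_le_random[OF assms(1) prob_onD(1)[OF assms(2)], of "\<lambda>x. x" "\<lambda>x. x" \<mu> \<mu>] assms(2) by simp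
  then show ?thesis by simp
qed

text \<open>The cell of a point is determined by the first member of a dense sequence that is closer than \<open>r / 2\<close>.\<close>

lemma fine_countable_partition:
  assumes "r > 0"
  obtains I :: "'a::euclidean_space \<Rightarrow> nat" where "I \<in> borel \<rightarrow>\<^sub>M count_space UNIV"
    "\<And>y y'. I y = I y' \<Longrightarrow> norm (y - y') \<le> r"
proof -
  obtain D :: "'a set" where D: "countable D" "\<And>X. open X \<Longrightarrow> X \<noteq> {} \<Longrightarrow> \<exists>d\<in>D. d \<in> X"
    using countable_dense_setE by blast
  have "D \<noteq> {}" using D(2)[of UNIV] by auto
  define d where "d = from_nat_into D"
  define I where "I = (\<lambda>y. LEAST n. dist (d n) y < r / 2)"
  have ex: "\<exists>n. dist (d n) y < r / 2" for y
  proof -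
    obtain z where z: "z \<in> D" "z \<in> ball y (r/2)" using D(2)[of "ball y (r/2)"] assms by auto
    then obtain n where "z = d n" using D(1) from_nat_into_surj[of D z] by (auto simp: d_def)
    then show ?thesis using z by (auto simp: dist_commute)
  qed
  have I: "dist (d (I y)) y < r / 2" for y
    unfolding I_def using LeastI_ex[OF ex] .
  show ?thesis
  proof (rule that[of I])
    show "I \<in> borel \<rightarrow>\<^sub>M count_space UNIV" unfolding I_def by measurable
    show "norm (y - y') \<le> r" if "I y = I y'" for y y'
      using I[of y] I[of y'] that dist_triangle2[of y y' "d (I y)"] by (simp add: dist_norm[symmetric] dist_commute)
  qed
qed

text \<open>Gluing two plans along their common marginal \<open>\<nu>\<close> would require conditional measures. Instead the
  middle space is cut into countably many cells of diameter at most \<open>r\<close>, and within a cell the plans are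
  combined independently: the density with respect to \<open>\<gamma>1 \<Otimes> \<gamma>2\<close> is \<open>1 / \<nu>(cell)\<close> if both middle points
  lie in the same cell, and \<open>0\<close> otherwise. The marginals are exact; the price is that the two middle
  points agree only up to \<open>r\<close>.\<close>

lemma approximate_gluing:
  fixes \<gamma>1 \<gamma>2 :: "('a::euclidean_space \<times> 'a) measure"
  assumes p: "prob_space \<gamma>1" "prob_space \<gamma>2" and s: "sets \<gamma>1 = sets borel" "sets \<gamma>2 = sets borel"
    and mid: "distr \<gamma>1 borel snd = \<nu>" "distr \<gamma>2 borel fst = \<nu>" and r: "r > 0"
  obtains \<pi> where "prob_space \<pi>" "sets \<pi> = sets (\<gamma>1 \<Otimes>\<^sub>M \<gamma>2)" "distr \<pi> borel fst = \<gamma>1" "distr \<pi> borel snd = \<gamma>2"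
    "AE w in \<pi>. norm (snd (fst w) - fst (snd w)) \<le> r"
proof -
  interpret \<gamma>1: prob_space \<gamma>1 by fact
  interpret \<gamma>2: prob_space \<gamma>2 by fact
  interpret pair_prob_space \<gamma>1 \<gamma>2 ..
  note [measurable_cong] = s
  note [measurable] = measurable_fst_borel measurable_snd_borel
  obtain I :: "'a \<Rightarrow> nat" where I[measurable]: "I \<in> borel \<rightarrow>\<^sub>M count_space UNIV"
    and Ir: "\<And>y y'. I y = I y' \<Longrightarrow> norm (y - y') \<le> r"
    using fine_countable_partition[OF r] by blast
  define m where "m n = emeasure \<nu> {y. I y = n}" for n
  have snu: "sets \<nu> = sets borel" "space \<nu> = UNIV" using mid(1) by auto
  have pnu: "prob_space \<nu>" unfolding mid(1)[symmetric]
    by (rule \<gamma>1.prob_space_distr) (simp add: measurable_cong_sets[OF s(1) refl] measurable_snd_borel)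
  interpret \<nu>: prob_space \<nu> by (rule pnu)
  have cell[measurable]: "{y. I y = n} \<in> sets borel" for n
    using measurable_sets[OF I, of "{n}"] by (simp add: vimage_def)
  have m1: "emeasure \<gamma>1 {p. I (snd p) = n} = m n" and m2: "emeasure \<gamma>2 {p. I (fst p) = n} = m n" for n
  proof -
    have "emeasure (distr \<gamma>1 borel snd) {y. I y = n} = emeasure \<gamma>1 {p. I (snd p) = n}"
      by (subst emeasure_distr) (auto simp: measurable_cong_sets[OF s(1) refl] measurable_snd_borel cell
        sets_eq_imp_space_eq[OF s(1)] intro!: arg_cong[where f="emeasure \<gamma>1"])
    then show "emeasure \<gamma>1 {p. I (snd p) = n} = m n" using mid(1) by (simp add: m_def)
    have "emeasure (distr \<gamma>2 borel fst) {y. I y = n} = emeasure \<gamma>2 {p. I (fst p) = n}"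
      by (subst emeasure_distr) (auto simp: measurable_cong_sets[OF s(2) refl] measurable_fst_borel cell
        sets_eq_imp_space_eq[OF s(2)] intro!: arg_cong[where f="emeasure \<gamma>2"])
    then show "emeasure \<gamma>2 {p. I (fst p) = n} = m n" using mid(2) by (simp add: m_def)
  qed
  have S1[measurable]: "{p. I (snd p) = n} \<in> sets \<gamma>1" and S2[measurable]: "{p. I (fst p) = n} \<in> sets \<gamma>2" for n
  proof -
    have "(\<lambda>p. I (snd p)) \<in> \<gamma>1 \<rightarrow>\<^sub>M count_space UNIV"
      using measurable_compose[OF measurable_snd_borel I] by (simp add: measurable_cong_sets[OF s(1) refl])
    from measurable_sets[OF this, of "{n}"] show "{p. I (snd p) = n} \<in> sets \<gamma>1"
      by (simp add: vimage_def sets_eq_imp_space_eq[OF s(1)])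
    have "(\<lambda>p. I (fst p)) \<in> \<gamma>2 \<rightarrow>\<^sub>M count_space UNIV"
      using measurable_compose[OF measurable_fst_borel I] by (simp add: measurable_cong_sets[OF s(2) refl])
    from measurable_sets[OF this, of "{n}"] show "{p. I (fst p) = n} \<in> sets \<gamma>2"
      by (simp add: vimage_def sets_eq_imp_space_eq[OF s(2)])
  qed
  have mfin: "m n < \<top>" for n unfolding m_def by (simp add: \<nu>.emeasure_eq_measure)
  have AE1: "AE p in \<gamma>1. m (I (snd p)) \<noteq> 0"
  proof -
    have "AE p in \<gamma>1. \<forall>n. m n = 0 \<longrightarrow> I (snd p) \<noteq> n"
      unfolding AE_all_countable
    proof
      fix n show "AE p in \<gamma>1. m n = 0 \<longrightarrow> I (snd p) \<noteq> n"
      proof (cases "m n = 0")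
        case True
        then have "{p. I (snd p) = n} \<in> null_sets \<gamma>1" using m1 S1 by (auto simp: null_sets_def)
        then show ?thesis by (rule AE_I') auto
      qed auto
    qed
    then show ?thesis by eventually_elim auto
  qed
  have AE2: "AE p in \<gamma>2. m (I (fst p)) \<noteq> 0"
  proof -
    have "AE p in \<gamma>2. \<forall>n. m n = 0 \<longrightarrow> I (fst p) \<noteq> n"
      unfolding AE_all_countable
    proof
      fix n show "AE p in \<gamma>2. m n = 0 \<longrightarrow> I (fst p) \<noteq> n"
      proof (cases "m n = 0")
        case True
        then have "{p. I (fst p) = n} \<in> null_sets \<gamma>2" using m2 S2 by (auto simp: null_sets_def)
        then show ?thesis by (rule AE_I') auto
      qed auto
    qed
    then show ?thesis by eventually_elim auto
  qed
  \<comment> \<open>The density of the glued plan; \<open>m n\<close> is the mass of the \<open>n\<close>-th cell.\<close>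
  define h :: "('a \<times> 'a) \<times> ('a \<times> 'a) \<Rightarrow> ennreal" where
    "h = (\<lambda>(p, q). indicator {q. I (fst q) = I (snd p)} q / m (I (snd p)))"
  have h_alt: "h (p, q) = indicator {p. I (snd p) = I (fst q)} p / m (I (fst q))" for p q
    by (auto simp: h_def indicator_def)
  have h_meas[measurable]: "h \<in> borel_measurable (\<gamma>1 \<Otimes>\<^sub>M \<gamma>2)"
  proof -
    have a[measurable]: "(\<lambda>w. I (snd (fst w))) \<in> (\<gamma>1 \<Otimes>\<^sub>M \<gamma>2) \<rightarrow>\<^sub>M count_space UNIV"
         "(\<lambda>w. I (fst (snd w))) \<in> (\<gamma>1 \<Otimes>\<^sub>M \<gamma>2) \<rightarrow>\<^sub>M count_space UNIV"
      using measurable_compose[OF measurable_snd_borel I] measurable_compose[OF measurable_fst_borel I]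
      by (auto intro: measurable_compose[OF measurable_fst] measurable_compose[OF measurable_snd]
        simp: measurable_cong_sets[OF s(1) refl] measurable_cong_sets[OF s(2) refl])
    have "(\<lambda>w. (if I (fst (snd w)) = I (snd (fst w)) then 1 else 0 :: ennreal) / m (I (snd (fst w)))) 
        \<in> borel_measurable (\<gamma>1 \<Otimes>\<^sub>M \<gamma>2)"
      using measurable_compose[OF measurable_Pair[OF a],
        of "\<lambda>(i, k). (if k = i then 1 else 0) / m i" borel]
      by (simp add: pair_measure_countable)
    also have "(\<lambda>w. (if I (fst (snd w)) = I (snd (fst w)) then 1 else 0 :: ennreal) / m (I (snd (fst w)))) = h"
      by (auto simp: h_def fun_eq_iff indicator_def)
    finally show ?thesis .
  qed
  have h1: "(\<lambda>q. h (p, q)) \<in> borel_measurable \<gamma>2" and h2: "(\<lambda>p. h (p, q)) \<in> borel_measurable \<gamma>1" for p q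
    by (rule measurable_compose[OF measurable_Pair1' h_meas], simp add: sets_eq_imp_space_eq[OF s(1)])
      (rule measurable_compose[OF measurable_Pair2' h_meas], simp add: sets_eq_imp_space_eq[OF s(2)])
  have inner1: "(\<integral>\<^sup>+q. h (p, q) \<partial>\<gamma>2) = 1" if "m (I (snd p)) \<noteq> 0" for p
    unfolding h_def using that mfin[of "I (snd p)"]
    by (simp add: nn_integral_divide m2)
  have inner2: "(\<integral>\<^sup>+p. h (p, q) \<partial>\<gamma>1) = 1" if "m (I (fst q)) \<noteq> 0" for q
    unfolding h_alt using that mfin[of "I (fst q)"]
    by (simp add: nn_integral_divide m1)
  define \<pi> where "\<pi> = density (\<gamma>1 \<Otimes>\<^sub>M \<gamma>2) h"
  have spi[simp]: "sets \<pi> = sets (\<gamma>1 \<Otimes>\<^sub>M \<gamma>2)" "space \<pi> = UNIV"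
    by (simp_all add: \<pi>_def space_pair_measure sets_eq_imp_space_eq[OF s(1)] sets_eq_imp_space_eq[OF s(2)])
  have mf: "fst \<in> \<pi> \<rightarrow>\<^sub>M borel" "snd \<in> \<pi> \<rightarrow>\<^sub>M borel"
    using measurable_fst[of \<gamma>1 \<gamma>2] measurable_snd[of \<gamma>1 \<gamma>2]
    by (simp_all add: measurable_cong_sets[OF spi(1)] s)
  have d1: "distr \<pi> borel fst = \<gamma>1"
  proof (rule measure_eqI)
    fix A assume "A \<in> sets (distr \<pi> borel fst)"
    then have A: "A \<in> sets borel" "A \<in> sets \<gamma>1" by (auto simp: s)
    have "emeasure (distr \<pi> borel fst) A = (\<integral>\<^sup>+w. h w * indicator A (fst w) \<partial>(\<gamma>1 \<Otimes>\<^sub>M \<gamma>2))"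
      using A measurable_sets[OF mf(1) A(1)] by (simp add: emeasure_distr mf)
        (subst \<pi>_def, subst emeasure_density, auto simp: \<pi>_def intro!: nn_integral_cong split: split_indicator)
    also have "\<dots> = (\<integral>\<^sup>+p. \<integral>\<^sup>+q. h (p, q) * indicator A p \<partial>\<gamma>2 \<partial>\<gamma>1)"
      using A by (subst \<gamma>2.nn_integral_fst[symmetric]) auto
    also have "\<dots> = (\<integral>\<^sup>+p. indicator A p \<partial>\<gamma>1)"
    proof (rule nn_integral_cong_AE)
      show "AE p in \<gamma>1. (\<integral>\<^sup>+q. h (p, q) * indicator A p \<partial>\<gamma>2) = indicator A p"
        using AE1 by eventually_elim (simp add: nn_integral_multc[OF h1] inner1)
    qed
    finally show "emeasure (distr \<pi> borel fst) A = emeasure \<gamma>1 A" using A by simp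
  qed (simp add: s)
  have d2: "distr \<pi> borel snd = \<gamma>2"
  proof (rule measure_eqI)
    fix A assume "A \<in> sets (distr \<pi> borel snd)"
    then have A: "A \<in> sets borel" "A \<in> sets \<gamma>2" by (auto simp: s)
    have "emeasure (distr \<pi> borel snd) A = (\<integral>\<^sup>+w. h w * indicator A (snd w) \<partial>(\<gamma>1 \<Otimes>\<^sub>M \<gamma>2))"
      using A measurable_sets[OF mf(2) A(1)] by (simp add: emeasure_distr mf)
        (subst \<pi>_def, subst emeasure_density, auto simp: \<pi>_def intro!: nn_integral_cong split: split_indicator)
    also have "\<dots> = (\<integral>\<^sup>+q. \<integral>\<^sup>+p. h (p, q) * indicator A q \<partial>\<gamma>1 \<partial>\<gamma>2)"
      using A by (subst nn_integral_snd[symmetric]) auto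
    also have "\<dots> = (\<integral>\<^sup>+q. indicator A q \<partial>\<gamma>2)"
    proof (rule nn_integral_cong_AE)
      show "AE q in \<gamma>2. (\<integral>\<^sup>+p. h (p, q) * indicator A q \<partial>\<gamma>1) = indicator A q"
        using AE2 by eventually_elim (simp add: nn_integral_multc[OF h2] inner2)
    qed
    finally show "emeasure (distr \<pi> borel snd) A = emeasure \<gamma>2 A" using A by simp
  qed (simp add: s)
  have "prob_space \<pi>"
    using \<gamma>1.prob_space_axioms d1 prob_space_distrD[OF mf(1)] by simp
  moreover have "AE w in \<pi>. norm (snd (fst w) - fst (snd w)) \<le> r"
  proof -
    have "norm (snd (fst w) - fst (snd w)) \<le> r" if "h w > 0" for w
    proof (cases "I (snd (fst w)) = I (fst (snd w))")
      case True then show ?thesis by (rule Ir)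
    next
      case False then show ?thesis using that by (auto simp: h_def split_beta)
    qed
    then show ?thesis unfolding \<pi>_def by (subst AE_density[OF h_meas]) auto
  qed
  ultimately show ?thesis using that[of \<pi>] spi d1 d2 by blast
qed

text \<open>The Cauchy-Schwarz inequality in Engel form. If \<open>p\<close>, \<open>q\<close>, \<open>r\<close> bound the \<open>L\<^sup>2\<close> norms of \<open>a\<close>, \<open>b\<close>, \<open>c\<close>, the right-hand
  side integrates to at most \<open>(p + q + r)\<^sup>2\<close>, which is Minkowski's inequality.\<close>

lemma titu_three:
  fixes a b c p q r :: real
  assumes "p > 0" "q > 0" "r > 0"
  shows "(a + b + c)\<^sup>2 \<le> (p + q + r) * (a\<^sup>2 / p + b\<^sup>2 / q + c\<^sup>2 / r)"
proof -
  have *: "2 * x * y \<le> u / v * y\<^sup>2 + v / u * x\<^sup>2" if "u > 0" "v > 0" for x y u v :: real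
  proof -
    have "0 \<le> (u * y - v * x)\<^sup>2 / (u * v)" using that by simp
    also have "\<dots> = u / v * y\<^sup>2 + v / u * x\<^sup>2 - 2 * x * y"
      using that by (simp add: field_simps power2_eq_square)
    finally show ?thesis by simp
  qed
  have "(p + q + r) * (a\<^sup>2 / p + b\<^sup>2 / q + c\<^sup>2 / r) = a\<^sup>2 + b\<^sup>2 + c\<^sup>2
     + (p / q * b\<^sup>2 + q / p * a\<^sup>2) + (q / r * c\<^sup>2 + r / q * b\<^sup>2) + (p / r * c\<^sup>2 + r / p * a\<^sup>2)"
    using assms by (simp add: field_simps)
  moreover have "(a + b + c)\<^sup>2 = a\<^sup>2 + b\<^sup>2 + c\<^sup>2 + 2 * a * b + 2 * b * c + 2 * a * c"
    by (simp add: power2_eq_square algebra_simps)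
  ultimately show ?thesis
    using *[of p q a b] *[of q r b c] *[of p r a c] assms by linarith
qed

lemma quadratic_cost_integrable:
  fixes \<gamma> :: "('a::euclidean_space \<times> 'a) measure"
  assumes "compact \<Omega>" "\<gamma> \<in> prob_on (\<Omega> \<times> \<Omega>)"
  shows "integrable \<gamma> (\<lambda>p. (norm (fst p - snd p))\<^sup>2)"
proof -
  have O: "\<Omega> \<times> \<Omega> \<in> sets borel"
    using compact_imp_closed[OF assms(1)] by (auto intro!: borel_closed closed_Times)
  interpret \<gamma>: prob_space \<gamma> using prob_onD[OF assms(2)] by simp
  obtain D where D: "\<And>x. x \<in> \<Omega> \<Longrightarrow> norm x \<le> D"
    using compact_imp_bounded[OF assms(1)] by (auto simp: bounded_iff)
  show ?thesis
  proof (rule \<gamma>.integrable_const_bound[of _ "(2 * D)\<^sup>2"])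
    show "AE p in \<gamma>. norm ((norm (fst p - snd p))\<^sup>2) \<le> (2 * D)\<^sup>2"
      using prob_on_AE[OF assms(2) O]
    proof eventually_elim
      case (elim p)
      then have "norm (fst p - snd p) \<le> 2 * D"
        using D[of "fst p"] D[of "snd p"] norm_triangle_ineq4[of "fst p" "snd p"] by auto
      then show ?case using power_mono[of "norm (fst p - snd p)" "2 * D" 2] by simp
    qed
    show "(\<lambda>p. (norm (fst p - snd p))\<^sup>2) \<in> borel_measurable \<gamma>"
      using measurable_quadratic_cost by (simp add: measurable_cong_sets[OF prob_onD(2)[OF assms(2)] refl])
  qed
qed

text \<open>The cost of the glued plan is split into the two given costs and the mismatch of the middle points,
  which is at most the mesh \<open>r\<close> of the partition; then \<open>r\<close> and the margins of optimality tend to \<open>0\<close> together.\<close>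

lemma W2_triangle:
  fixes \<mu> \<nu> \<sigma> :: "'a::euclidean_space measure"
  assumes c: "compact \<Omega>" and P: "\<mu> \<in> prob_on \<Omega>" "\<nu> \<in> prob_on \<Omega>" "\<sigma> \<in> prob_on \<Omega>"
  shows "W2 \<Omega> \<mu> \<sigma> \<le> W2 \<Omega> \<mu> \<nu> + W2 \<Omega> \<nu> \<sigma>"
proof (rule field_le_epsilon)
  fix e :: real assume e: "e > 0"
  have cl: "closed \<Omega>" using c by (rule compact_imp_closed)
  \<comment> \<open>\<open>p\<close> and \<open>q\<close> strictly exceed the two distances, so that plans of cost below \<open>p\<^sup>2\<close> and \<open>q\<^sup>2\<close> exist.\<close>
  define p where "p = W2 \<Omega> \<mu> \<nu> + e / 3"
  define q where "q = W2 \<Omega> \<nu> \<sigma> + e / 3"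
  define r where "r = e / 3"
  note nn = W2_nonneg[OF cl P(1,2)] W2_nonneg[OF cl P(2,3)]
  have pos: "p > 0" "q > 0" "r > 0" using nn e by (auto simp: p_def q_def r_def)
  have "(W2 \<Omega> \<mu> \<nu>)\<^sup>2 < p\<^sup>2" using nn e by (auto simp: p_def intro!: power_strict_mono)
  from near_optimal_coupling[OF cl P(1,2) this] obtain \<gamma>1
    where g1: "\<gamma>1 \<in> prob_on (\<Omega> \<times> \<Omega>)" "distr \<gamma>1 borel fst = \<mu>" "distr \<gamma>1 borel snd = \<nu>"
      "(LINT p|\<gamma>1. (norm (fst p - snd p))\<^sup>2) < p\<^sup>2" .
  have "(W2 \<Omega> \<nu> \<sigma>)\<^sup>2 < q\<^sup>2" using nn e by (auto simp: q_def intro!: power_strict_mono)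
  from near_optimal_coupling[OF cl P(2,3) this] obtain \<gamma>2
    where g2: "\<gamma>2 \<in> prob_on (\<Omega> \<times> \<Omega>)" "distr \<gamma>2 borel fst = \<nu>" "distr \<gamma>2 borel snd = \<sigma>"
      "(LINT p|\<gamma>2. (norm (fst p - snd p))\<^sup>2) < q\<^sup>2" .
  note s = prob_onD(2)[OF g1(1)] prob_onD(2)[OF g2(1)]
  from approximate_gluing[OF prob_onD(1)[OF g1(1)] prob_onD(1)[OF g2(1)] s g1(3) g2(2) pos(3)]
  obtain \<pi> where pi: "prob_space \<pi>" "sets \<pi> = sets (\<gamma>1 \<Otimes>\<^sub>M \<gamma>2)" "distr \<pi> borel fst = \<gamma>1" "distr \<pi> borel snd = \<gamma>2"
    "AE w in \<pi>. norm (snd (fst w) - fst (snd w)) \<le> r" .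
  interpret pi: prob_space \<pi> by fact
  have mf: "fst \<in> \<pi> \<rightarrow>\<^sub>M borel" "snd \<in> \<pi> \<rightarrow>\<^sub>M borel"
    using measurable_fst[of \<gamma>1 \<gamma>2] measurable_snd[of \<gamma>1 \<gamma>2]
    by (simp_all only: measurable_cong_sets[OF pi(2)[symmetric] s(1)] measurable_cong_sets[OF pi(2)[symmetric] s(2)])
  have mX: "(\<lambda>w. fst (fst w)) \<in> borel_measurable \<pi>" and mY: "(\<lambda>w. snd (snd w)) \<in> borel_measurable \<pi>"
    using measurable_compose[OF mf(1) measurable_fst_borel] measurable_compose[OF mf(2) measurable_snd_borel] by auto
  have dX: "distr \<pi> borel (\<lambda>w. fst (fst w)) = \<mu>" and dY: "distr \<pi> borel (\<lambda>w. snd (snd w)) = \<sigma>"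
    using distr_distr[OF measurable_fst_borel mf(1)] distr_distr[OF measurable_snd_borel mf(2)]
    by (simp_all add: comp_def pi(3,4) g1 g2)
  have i1: "integrable \<pi> (\<lambda>w. (norm (fst (fst w) - snd (fst w)))\<^sup>2)"
    and e1: "(LINT w|\<pi>. (norm (fst (fst w) - snd (fst w)))\<^sup>2) < p\<^sup>2"
    using quadratic_cost_integrable[OF c g1(1)] g1(4)
      integrable_distr_eq[OF mf(1) measurable_quadratic_cost] integral_distr[OF mf(1) measurable_quadratic_cost]
    by (simp_all add: pi(3))
  have i2: "integrable \<pi> (\<lambda>w. (norm (fst (snd w) - snd (snd w)))\<^sup>2)"
    and e2: "(LINT w|\<pi>. (norm (fst (snd w) - snd (snd w)))\<^sup>2) < q\<^sup>2"
    using quadratic_cost_integrable[OF c g2(1)] g2(4)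
      integrable_distr_eq[OF mf(2) measurable_quadratic_cost] integral_distr[OF mf(2) measurable_quadratic_cost]
    by (simp_all add: pi(4))
  have bound: "AE w in \<pi>. (norm (fst (fst w) - snd (snd w)))\<^sup>2
     \<le> (p + q + r) * ((norm (fst (fst w) - snd (fst w)))\<^sup>2 / p + (norm (fst (snd w) - snd (snd w)))\<^sup>2 / q + r)"
    using pi(5)
  proof eventually_elim
    case (elim w)
    let ?a = "norm (fst (fst w) - snd (fst w))" and ?b = "norm (fst (snd w) - snd (snd w))"
    let ?c = "norm (snd (fst w) - fst (snd w))"
    have "fst (fst w) - snd (snd w) = (fst (fst w) - snd (fst w)) + (fst (snd w) - snd (snd w)) + (snd (fst w) - fst (snd w))"
      by simp
    then have "norm (fst (fst w) - snd (snd w)) \<le> ?a + ?b + ?c"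
      by (metis norm_triangle_le norm_triangle_mono order_refl)
    then have "norm (fst (fst w) - snd (snd w)) \<le> ?a + ?b + r" using elim by linarith
    then have "(norm (fst (fst w) - snd (snd w)))\<^sup>2 \<le> (?a + ?b + r)\<^sup>2" by (intro power_mono) auto
    also have "\<dots> \<le> (p + q + r) * (?a\<^sup>2 / p + ?b\<^sup>2 / q + r\<^sup>2 / r)" by (rule titu_three) fact+
    finally show ?case by (simp add: power2_eq_square)
  qed
  have "(W2 \<Omega> \<mu> \<sigma>)\<^sup>2 \<le> (LINT w|\<pi>. (norm (fst (fst w) - snd (snd w)))\<^sup>2)"
    by (rule W2_le_random[OF cl pi(1) mX mY dX dY P(1,3)])
  also have "\<dots> \<le> (LINT w|\<pi>. (p + q + r) * ((norm (fst (fst w) - snd (fst w)))\<^sup>2 / p + (norm (fst (snd w) - snd (snd w)))\<^sup>2 / q + r))"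
  proof (rule integral_mono_AE'[OF _ bound])
    show "integrable \<pi> (\<lambda>w. (p + q + r) * ((norm (fst (fst w) - snd (fst w)))\<^sup>2 / p + (norm (fst (snd w) - snd (snd w)))\<^sup>2 / q + r))"
      using i1 i2 by simp
  qed (use pos in \<open>auto intro!: AE_I2 mult_nonneg_nonneg add_nonneg_nonneg\<close>)
  also have "\<dots> = (p + q + r) * ((LINT w|\<pi>. (norm (fst (fst w) - snd (fst w)))\<^sup>2) / p + (LINT w|\<pi>. (norm (fst (snd w) - snd (snd w)))\<^sup>2) / q + r)"
    using i1 i2 by (simp add: pi.prob_space)
  also have "\<dots> \<le> (p + q + r) * (p\<^sup>2 / p + q\<^sup>2 / q + r)"
    using pos e1 e2 by (intro mult_left_mono add_mono divide_right_mono) auto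
  also have "\<dots> = (p + q + r)\<^sup>2" using pos by (simp add: power2_eq_square)
  finally have "W2 \<Omega> \<mu> \<sigma> \<le> p + q + r" by (rule power2_le_imp_le) (use pos in simp)
  then show "W2 \<Omega> \<mu> \<sigma> \<le> W2 \<Omega> \<mu> \<nu> + W2 \<Omega> \<nu> \<sigma> + e" by (simp add: p_def q_def r_def)
qed

section \<open>Dissipation of energy along the scheme\<close>

lemma mult_ln_ge:
  fixes s :: real
  assumes "s \<ge> 0"
  shows "- 1 \<le> s * ln s"
proof (cases "s = 0")
  case False
  then have s: "s > 0" using assms by simp
  have "ln (1 / s) \<le> 1 / s - 1" by (rule ln_le_minus_one) (use s in simp)
  then have "s * (1 - 1 / s) \<le> s * ln s" using s by (intro mult_left_mono) (auto simp: ln_div)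
  then show ?thesis using s by (simp add: algebra_simps)
qed auto

lemma entropy_fun_lower_bound:
  fixes \<Omega> :: "'a::euclidean_space set"
  assumes "compact \<Omega>"
  shows "ereal (- measure lborel \<Omega>) \<le> entropy_fun \<Omega> \<rho>"
proof (cases "absolutely_continuous lborel \<rho> \<and>
    set_integrable lborel \<Omega> (\<lambda>x. enn2real (RN_deriv lborel \<rho> x) * ln (enn2real (RN_deriv lborel \<rho> x)))")
  case True
  let ?u = "\<lambda>x. enn2real (RN_deriv lborel \<rho> x)"
  have fin: "emeasure lborel \<Omega> < \<infinity>" using emeasure_compact_finite[OF assms] .
  have O: "\<Omega> \<in> sets borel" using assms by (rule borel_compact)
  have "- measure lborel \<Omega> = (LINT x:\<Omega>|lborel. - 1)"
    using O fin by (simp add: set_lebesgue_integral_def)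
  also have "\<dots> \<le> (LINT x:\<Omega>|lborel. ?u x * ln (?u x))"
    using O fin True by (intro set_integral_mono) (auto simp: set_integrable_def mult_ln_ge intro: integrable_real_indicator)
  finally show ?thesis using True by (simp add: entropy_fun_def Let_def)
qed (auto simp: entropy_fun_def Let_def)

text \<open>Both terms are bounded below on a compact set: \<open>s ln s \<ge> - 1\<close> and \<open>\<Omega>\<close> has finite volume.\<close>

lemma energy_lower_bound:
  fixes \<Omega> :: "'a::euclidean_space set"
  assumes "compact \<Omega>" "continuous_on \<Omega> V"
  obtains L where "\<And>\<rho>. \<rho> \<in> prob_on \<Omega> \<Longrightarrow> ereal L \<le> energy \<Omega> V \<rho>"
proof -
  obtain B where B: "\<And>x. x \<in> \<Omega> \<Longrightarrow> \<bar>V x\<bar> \<le> B" "B > 0"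
    using compact_imp_bounded[OF compact_continuous_image[OF assms(2,1)]]
    by (auto simp: bounded_pos)
  show ?thesis
  proof (rule that[of "- measure lborel \<Omega> + - B"])
    fix \<rho> assume \<rho>: "\<rho> \<in> prob_on \<Omega>"
    have "- B \<le> (LINT x:\<Omega>|\<rho>. V x)"
      using set_integral_abs_le_bound[OF \<rho> B(1)] B(2) by force
    then show "ereal (- measure lborel \<Omega> + - B) \<le> energy \<Omega> V \<rho>"
      unfolding energy_def plus_ereal.simps(1)[symmetric]
      using entropy_fun_lower_bound[OF assms(1), of \<rho>] by (intro add_mono) auto
  qed
qed

lemma jko_step_minimal:
  assumes "jko_step \<Omega> V h \<mu> \<nu>" "\<sigma> \<in> prob_on \<Omega>"
  shows "energy \<Omega> V \<nu> + ereal ((W2 \<Omega> \<nu> \<mu>)\<^sup>2 / (2 * h)) \<le> energy \<Omega> V \<sigma> + ereal ((W2 \<Omega> \<sigma> \<mu>)\<^sup>2 / (2 * h))"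
  using assms unfolding jko_step_def is_arg_min_def by (auto simp: not_less)

lemma jko_scheme_prob_on:
  assumes "jko_scheme \<Omega> V h \<rho>0 R" "\<rho>0 \<in> prob_on \<Omega>"
  shows "R k \<in> prob_on \<Omega>"
  using assms by (cases k) (auto simp: jko_scheme_def jko_step_def is_arg_min_def)

text \<open>The previous measure is a competitor at distance \<open>0\<close> from itself.\<close>

lemma jko_step_dissipation:
  assumes "compact \<Omega>" "jko_step \<Omega> V h \<mu> \<nu>" "\<mu> \<in> prob_on \<Omega>"
  shows "energy \<Omega> V \<nu> + ereal ((W2 \<Omega> \<nu> \<mu>)\<^sup>2 / (2 * h)) \<le> energy \<Omega> V \<mu>"
  using jko_step_minimal[OF assms(2,3)] W2_self[OF compact_imp_closed[OF assms(1)] assms(3)] by simp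

lemma jko_step_energy_finite:
  assumes "compact \<Omega>" "jko_step \<Omega> V h \<mu> \<nu>" "\<mu> \<in> prob_on \<Omega>" "energy \<Omega> V \<mu> < \<infinity>"
  shows "energy \<Omega> V \<nu> < \<infinity>"
  using jko_step_dissipation[OF assms(1-3)] assms(4) by (cases "energy \<Omega> V \<nu>") auto

lemma jko_scheme_energy_finite:
  assumes "compact \<Omega>" "jko_scheme \<Omega> V h \<rho>0 R" "\<rho>0 \<in> prob_on \<Omega>" "energy \<Omega> V \<rho>0 < \<infinity>"
  shows "energy \<Omega> V (R k) < \<infinity>"
proof (induction k)
  case 0 then show ?case using assms by (simp add: jko_scheme_def)
next
  case (Suc k)
  have "jko_step \<Omega> V h (R k) (R (Suc k))" using assms(2) by (simp add: jko_scheme_def)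
  from jko_step_energy_finite[OF assms(1) this jko_scheme_prob_on[OF assms(2,3)] Suc] show ?case .
qed

text \<open>Summing the dissipation over the steps telescopes the energies, which stay above a constant.
  That \<open>C\<close> depends neither on \<open>h\<close> nor on the number of steps is what makes every later limit possible.\<close>

lemma jko_total_cost_bound:
  fixes \<Omega> :: "'a::euclidean_space set"
  assumes "compact \<Omega>" "continuous_on \<Omega> V" "\<rho>0 \<in> prob_on \<Omega>" "energy \<Omega> V \<rho>0 < \<infinity>"
  obtains C where "C \<ge> 0" "\<And>h R N. h > 0 \<Longrightarrow> jko_scheme \<Omega> V h \<rho>0 R \<Longrightarrow>
    (\<Sum>k<N. (W2 \<Omega> (R (Suc k)) (R k))\<^sup>2) \<le> h * C"
proof -
  obtain L where L: "\<And>\<rho>. \<rho> \<in> prob_on \<Omega> \<Longrightarrow> ereal L \<le> energy \<Omega> V \<rho>"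
    using energy_lower_bound[OF assms(1,2)] by blast
  define e0 where "e0 = real_of_ereal (energy \<Omega> V \<rho>0)"
  have fin: "\<exists>e. energy \<Omega> V \<rho> = ereal e \<and> L \<le> e" if "\<rho> \<in> prob_on \<Omega>" "energy \<Omega> V \<rho> < \<infinity>" for \<rho>
    using L[OF that(1)] that(2) by (cases "energy \<Omega> V \<rho>") auto
  have e0: "energy \<Omega> V \<rho>0 = ereal e0" "L \<le> e0" using fin[OF assms(3,4)] by (auto simp: e0_def)
  show ?thesis
  proof (rule that[of "2 * (e0 - L)"])
    fix h :: real and R :: "nat \<Rightarrow> 'a measure" and N
    assume h: "h > 0" and R: "jko_scheme \<Omega> V h \<rho>0 R"
    have *: "energy \<Omega> V (R N) + ereal ((\<Sum>k<N. (W2 \<Omega> (R (Suc k)) (R k))\<^sup>2) / (2 * h)) \<le> ereal e0" for N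
    proof (induction N)
      case 0 then show ?case using R e0 by (simp add: jko_scheme_def)
    next
      case (Suc N)
      have "energy \<Omega> V (R (Suc N)) + ereal ((W2 \<Omega> (R (Suc N)) (R N))\<^sup>2 / (2 * h)) \<le> energy \<Omega> V (R N)"
        using R by (intro jko_step_dissipation[OF assms(1)] jko_scheme_prob_on[OF R assms(3)]) (simp add: jko_scheme_def)
      with Suc show ?case
        using fin[OF jko_scheme_prob_on[OF R assms(3)] jko_scheme_energy_finite[OF assms(1) R assms(3,4)], of N]
          fin[OF jko_scheme_prob_on[OF R assms(3)] jko_scheme_energy_finite[OF assms(1) R assms(3,4)], of "Suc N"]
        by (auto simp: add_divide_distrib)
    qed
    have "(\<Sum>k<N. (W2 \<Omega> (R (Suc k)) (R k))\<^sup>2) / (2 * h) \<le> e0 - L"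
      using *[of N] fin[OF jko_scheme_prob_on[OF R assms(3)] jko_scheme_energy_finite[OF assms(1) R assms(3,4)], of N]
      by auto
    then show "(\<Sum>k<N. (W2 \<Omega> (R (Suc k)) (R k))\<^sup>2) \<le> h * (2 * (e0 - L))"
      using h by (simp add: field_simps)
  qed (use e0 in simp)
qed

section \<open>Change of variables and entropy under a shear\<close>

text \<open>Fubini's theorem with one coordinate singled out: the inner integral runs along a line parallel to \<open>b\<close>.\<close>

lemma nn_integral_lborel_along_Basis:
  fixes f :: "'a::euclidean_space \<Rightarrow> ennreal"
  assumes b: "b \<in> Basis" and f[measurable]: "f \<in> borel_measurable borel"
  shows "(\<integral>\<^sup>+x. f x \<partial>lborel) =
    (\<integral>\<^sup>+z. (\<integral>\<^sup>+s. f ((\<Sum>c\<in>Basis - {b}. z c *\<^sub>R c) + s *\<^sub>R b) \<partial>lborel) \<partial>(\<Pi>\<^sub>M c\<in>Basis - {b}. lborel))"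
proof -
  interpret product_sigma_finite "\<lambda>_::'a. lborel :: real measure" ..
  have ins: "insert b (Basis - {b}) = (Basis :: 'a set)" using b by auto
  have m: "(\<lambda>g. \<Sum>c\<in>Basis. g c *\<^sub>R c) \<in> (\<Pi>\<^sub>M c\<in>(Basis::'a set). lborel) \<rightarrow>\<^sub>M borel"
    by measurable
  have "(\<integral>\<^sup>+x. f x \<partial>lborel) = (\<integral>\<^sup>+g. f (\<Sum>c\<in>Basis. g c *\<^sub>R c) \<partial>(\<Pi>\<^sub>M c\<in>(Basis::'a set). lborel))"
    by (subst lborel_eq, subst nn_integral_distr[OF m]) simp_all
  also have "\<dots> = (\<integral>\<^sup>+g. f (\<Sum>c\<in>Basis. g c *\<^sub>R c) \<partial>(\<Pi>\<^sub>M c\<in>insert b (Basis - {b}). lborel))"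
    by (simp only: ins)
  also have "\<dots> = (\<integral>\<^sup>+z. (\<integral>\<^sup>+s. f (\<Sum>c\<in>Basis. (z(b := s)) c *\<^sub>R c) \<partial>lborel) \<partial>(\<Pi>\<^sub>M c\<in>Basis - {b}. lborel))"
    using measurable_compose[OF m f] by (intro product_nn_integral_insert) (simp_all add: ins)
  also have "\<dots> = (\<integral>\<^sup>+z. (\<integral>\<^sup>+s. f ((\<Sum>c\<in>Basis - {b}. z c *\<^sub>R c) + s *\<^sub>R b) \<partial>lborel) \<partial>(\<Pi>\<^sub>M c\<in>Basis - {b}. lborel))"
  proof -
    have "(\<Sum>c\<in>Basis. (z(b := s)) c *\<^sub>R c) = (\<Sum>c\<in>Basis - {b}. z c *\<^sub>R c) + s *\<^sub>R b" for z :: "'a \<Rightarrow> real" and s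
      using b by (simp add: sum.remove[of Basis b] add.commute)
    then show ?thesis by presburger
  qed
  finally show ?thesis .
qed

text \<open>Outside \<open>[- L, L]\<close> the map is the identity and nothing changes; inside it is the substitution rule on a
  compact interval, which \<open>g\<close> maps to itself.\<close>

lemma nn_integral_substitution_real_line:
  fixes g g' :: "real \<Rightarrow> real"
  assumes A[measurable]: "A \<in> sets borel"
    and d: "\<And>s. (g has_real_derivative g' s) (at s)" and c: "continuous_on UNIV g'"
    and nn: "\<And>s. g' s \<ge> 0" and L: "L \<ge> 0"
    and id: "\<And>s. \<bar>s\<bar> \<ge> L \<Longrightarrow> g s = s" "\<And>s. \<bar>s\<bar> > L \<Longrightarrow> g' s = 1"
  shows "(\<integral>\<^sup>+s. ennreal (g' s) * indicator A (g s) \<partial>lborel) = emeasure lborel A"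
proof -
  have [measurable]: "g \<in> borel_measurable borel" "g' \<in> borel_measurable borel"
    using c d by (auto intro!: borel_measurable_continuous_onI continuous_at_imp_continuous_on DERIV_isCont)
  have ends: "g (-L) = -L" "g L = L" using id(1)[of L] id(1)[of "-L"] L by auto
  have "(\<integral>\<^sup>+s. ennreal (g' s) * indicator A (g s) \<partial>lborel) =
    (\<integral>\<^sup>+s. ennreal (indicator A (g s) * g' s * indicator {-L..L} s) + indicator (A - {-L..L}) s \<partial>lborel)"
    using id by (intro nn_integral_cong) (auto simp: indicator_def)
  also have "\<dots> = (\<integral>\<^sup>+s. ennreal (indicator A (g s) * g' s * indicator {-L..L} s) \<partial>lborel)
     + (\<integral>\<^sup>+s. indicator (A - {-L..L}) s \<partial>lborel)"
    by (rule nn_integral_add) auto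
  also have "(\<integral>\<^sup>+s. ennreal (indicator A (g s) * g' s * indicator {-L..L} s) \<partial>lborel) =
      (\<integral>\<^sup>+s. ennreal (indicator A s * indicator {g (-L)..g L} s) \<partial>lborel)"
    using d L nn by (intro nn_integral_substitution[symmetric] continuous_on_subset[OF c])
      (auto simp: set_borel_measurable_def)
  also have "\<dots> = emeasure lborel (A \<inter> {-L..L})"
  proof -
    have "(\<integral>\<^sup>+s. ennreal (indicator A s * indicator {g (-L)..g L} s) \<partial>lborel) =
      (\<integral>\<^sup>+s. indicator (A \<inter> {-L..L}) s \<partial>lborel)"
      unfolding ends by (rule nn_integral_cong) (auto simp: indicator_def)
    then show ?thesis by simp
  qed
  also have "\<dots> + (\<integral>\<^sup>+s. indicator (A - {-L..L}) s \<partial>lborel) = emeasure lborel A"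
  proof -
    have "(A \<inter> {-L..L}) \<union> (A - {-L..L}) = A" by auto
    then show ?thesis
      using plus_emeasure[of "A \<inter> {-L..L}" lborel "A - {-L..L}"] by auto
  qed
  finally show ?thesis .
qed

lemma GDERIV_locally_zero:
  assumes "GDERIV f x :> D" "open U" "x \<in> U" "\<And>y. y \<in> U \<Longrightarrow> f y = 0"
  shows "D = 0"
proof -
  have "((\<lambda>_. 0) has_derivative (\<lambda>h. h \<bullet> D)) (at x)"
    by (rule has_derivative_transform_within_open[of f]) (use assms in \<open>auto simp: gderiv_def\<close>)
  from has_derivative_unique[OF this has_derivative_const] have *: "(\<lambda>h. h \<bullet> D) = (\<lambda>_. 0)" .
  have "D \<bullet> D = 0" using fun_cong[OF *, of D] .
  then show ?thesis by simp
qed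

text \<open>A shear \<open>x + \<phi>(x) b\<close> moves points parallel to the axis \<open>b\<close>, so that its Jacobian determinant is the
  derivative \<open>1 + \<partial>\<^sub>b \<phi>\<close> along that axis and the change of variables takes place on
  each line separately. The bound \<open>1 / 2\<close> on the gradient makes the shear bi-Lipschitz and keeps the
  Jacobian away from \<open>0\<close>.\<close>

locale directional_shear =
  fixes b :: "'a::euclidean_space" and \<phi> :: "'a \<Rightarrow> real" and G :: "'a \<Rightarrow> 'a" and K :: "'a set"
  assumes b: "b \<in> Basis"
    and grad: "\<And>x. GDERIV \<phi> x :> G x" and cont: "continuous_on UNIV G"
    and K: "compact K" and outside: "\<And>x. x \<notin> K \<Longrightarrow> \<phi> x = 0"
    and small: "\<And>x. norm (G x) \<le> 1 / 2"
begin

definition "\<Phi> x = x + \<phi> x *\<^sub>R b"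
definition "J x = 1 + G x \<bullet> b"
definition "\<Psi> = inv \<Phi>"

lemma norm_b: "norm b = 1" using b by simp

lemma G_outside: "x \<notin> K \<Longrightarrow> G x = 0"
proof -
  assume x: "x \<notin> K"
  show "G x = 0"
  proof (rule GDERIV_locally_zero[OF grad])
    show "open (- K)" using compact_imp_closed[OF K] by (rule open_Compl)
  qed (use x outside in auto)
qed

lemma J_bounds: "1 / 2 \<le> J x" "J x \<le> 3 / 2"
proof -
  have "\<bar>G x \<bullet> b\<bar> \<le> 1 / 2" using Cauchy_Schwarz_ineq2[of "G x" b] small[of x] norm_b by simp
  then show "1 / 2 \<le> J x" "J x \<le> 3 / 2" unfolding J_def by linarith+
qed

lemma J_pos: "0 < J x" using J_bounds[of x] by linarith

lemma phi_continuous: "continuous_on UNIV \<phi>"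
  using grad unfolding gderiv_def
  by (auto intro!: continuous_at_imp_continuous_on has_derivative_continuous)

lemma Phi_continuous: "continuous_on UNIV \<Phi>"
  unfolding \<Phi>_def by (intro continuous_intros phi_continuous)

lemma J_continuous: "continuous_on UNIV J"
  unfolding J_def by (intro continuous_intros cont)

lemma Phi_measurable[measurable]: "\<Phi> \<in> borel_measurable borel"
  and J_measurable[measurable]: "J \<in> borel_measurable borel"
  and phi_measurable[measurable]: "\<phi> \<in> borel_measurable borel"
  by (intro borel_measurable_continuous_onI Phi_continuous J_continuous phi_continuous)+

lemma phi_lipschitz: "\<bar>\<phi> x - \<phi> y\<bar> \<le> 1 / 2 * norm (x - y)"
proof -
  have "norm (\<phi> x - \<phi> y) \<le> 1 / 2 * norm (x - y)"
  proof (rule differentiable_bound[where S = UNIV and f' = "\<lambda>x h. h \<bullet> G x"])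
    show "(\<phi> has_derivative (\<lambda>h. h \<bullet> G x)) (at x within UNIV)" for x using grad by (simp add: gderiv_def)
    show "onorm (\<lambda>h. h \<bullet> G x) \<le> 1 / 2" for x
    proof (rule onorm_le)
      fix h
      have "norm (h \<bullet> G x) \<le> norm h * norm (G x)" using Cauchy_Schwarz_ineq2 by simp
      also have "\<dots> \<le> norm h * (1 / 2)" using small by (intro mult_left_mono) auto
      finally show "norm (h \<bullet> G x) \<le> 1 / 2 * norm h" by simp
    qed
  qed auto
  then show ?thesis by simp
qed

text \<open>The perturbation is Lipschitz with constant \<open>1 / 2\<close>. Besides injectivity this gives the Lipschitz bound of the
  inverse, hence its measurability.\<close>

lemma Phi_expansive: "norm (x - y) \<le> 2 * norm (\<Phi> x - \<Phi> y)"
proof -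
  have "x - y = (\<Phi> x - \<Phi> y) - (\<phi> x - \<phi> y) *\<^sub>R b" by (simp add: \<Phi>_def algebra_simps)
  then have "norm (x - y) \<le> norm (\<Phi> x - \<Phi> y) + norm ((\<phi> x - \<phi> y) *\<^sub>R b)"
    by (metis norm_triangle_ineq4)
  then show ?thesis using phi_lipschitz[of x y] norm_b by simp
qed

lemma inj_Phi: "inj \<Phi>"
proof (rule injI)
  fix x y assume "\<Phi> x = \<Phi> y"
  then show "x = y" using Phi_expansive[of x y] by simp
qed

lemma line_leaves_K:
  obtains L where "L \<ge> 0" "\<And>s. \<bar>s\<bar> \<ge> L \<Longrightarrow> y + s *\<^sub>R b \<notin> K"
proof -
  obtain B where B: "\<And>x. x \<in> K \<Longrightarrow> norm x \<le> B" using compact_imp_bounded[OF K] by (auto simp: bounded_iff)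
  show ?thesis
  proof (rule that[of "\<bar>B\<bar> + norm y + 1"])
    fix s :: real assume s: "\<bar>B\<bar> + norm y + 1 \<le> \<bar>s\<bar>"
    have "\<bar>s\<bar> \<le> norm (y + s *\<^sub>R b) + norm y"
      using norm_triangle_ineq4[of "y + s *\<^sub>R b" y] norm_b by simp
    then show "y + s *\<^sub>R b \<notin> K" using B s by force
  qed simp
qed

text \<open>On each line parallel to \<open>b\<close> the equation to be solved is a scalar one, and the intermediate value
  theorem applies because \<open>\<phi>\<close> vanishes far out.\<close>

lemma surj_Phi: "surj \<Phi>"
  unfolding surj_def
proof
  fix y
  obtain L where L: "L \<ge> 0" "\<And>s. \<bar>s\<bar> \<ge> L \<Longrightarrow> y + s *\<^sub>R b \<notin> K" using line_leaves_K by blast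
  have "\<exists>s\<ge>-L. s \<le> L \<and> s + \<phi> (y + s *\<^sub>R b) = 0"
  proof (rule IVT')
    show "- L + \<phi> (y + - L *\<^sub>R b) \<le> 0" "0 \<le> L + \<phi> (y + L *\<^sub>R b)"
      using L outside[of "y + L *\<^sub>R b"] outside[of "y + - L *\<^sub>R b"] L(2)[of L] L(2)[of "- L"] by auto
    show "continuous_on {- L..L} (\<lambda>s. s + \<phi> (y + s *\<^sub>R b))"
      by (intro continuous_intros continuous_on_compose2[OF phi_continuous]) auto
  qed (use L in auto)
  then obtain s where "s + \<phi> (y + s *\<^sub>R b) = 0" by blast
  then have "\<Phi> (y + s *\<^sub>R b) = y" by (simp add: \<Phi>_def add.assoc scaleR_left_distrib[symmetric])
  then show "\<exists>x. y = \<Phi> x" by metis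
qed

lemma Psi_Phi[simp]: "\<Psi> (\<Phi> x) = x" unfolding \<Psi>_def by (rule inv_f_f[OF inj_Phi])

lemma Phi_Psi[simp]: "\<Phi> (\<Psi> y) = y" unfolding \<Psi>_def by (rule surj_f_inv_f[OF surj_Phi])

lemma Psi_measurable[measurable]: "\<Psi> \<in> borel_measurable borel"
proof -
  have "2-lipschitz_on UNIV \<Psi>"
    using Phi_expansive[of "\<Psi> _" "\<Psi> _"] by (intro lipschitz_onI) (auto simp: dist_norm)
  then show ?thesis
    by (intro borel_measurable_continuous_onI lipschitz_on_continuous_on)
qed

text \<open>The change of variables formula, as an identity of measures. On each line it is the one-dimensional
  substitution rule.\<close>

lemma lborel_eq_distr_Phi: "distr (density lborel (\<lambda>x. ennreal (J x))) borel \<Phi> = lborel"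
proof (rule measure_eqI)
  fix A assume "A \<in> sets (distr (density lborel (\<lambda>x. ennreal (J x))) borel \<Phi>)"
  then have A[measurable]: "A \<in> sets borel" by simp
  have "emeasure (distr (density lborel (\<lambda>x. ennreal (J x))) borel \<Phi>) A =
     (\<integral>\<^sup>+x. ennreal (J x) * indicator A (\<Phi> x) \<partial>lborel)"
  proof -
    have "\<Phi> -` A \<in> sets borel" using measurable_sets[OF Phi_measurable A] by simp
    then show ?thesis
      by (simp add: emeasure_distr emeasure_density) (auto intro!: nn_integral_cong simp: indicator_def)
  qed
  also have "\<dots> = (\<integral>\<^sup>+z. (\<integral>\<^sup>+s. ennreal (J ((\<Sum>c\<in>Basis - {b}. z c *\<^sub>R c) + s *\<^sub>R b)) *
     indicator A (\<Phi> ((\<Sum>c\<in>Basis - {b}. z c *\<^sub>R c) + s *\<^sub>R b)) \<partial>lborel) \<partial>(\<Pi>\<^sub>M c\<in>Basis - {b}. lborel))"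
    by (rule nn_integral_lborel_along_Basis[OF b]) measurable
  also have "\<dots> = (\<integral>\<^sup>+z. (\<integral>\<^sup>+s. indicator A ((\<Sum>c\<in>Basis - {b}. z c *\<^sub>R c) + s *\<^sub>R b) \<partial>lborel)
      \<partial>(\<Pi>\<^sub>M c\<in>Basis - {b}. lborel))"
  proof (rule nn_integral_cong)
    fix z :: "'a \<Rightarrow> real"
    define y where "y = (\<Sum>c\<in>Basis - {b}. z c *\<^sub>R c)"
    define A' where "A' = (\<lambda>r. y + r *\<^sub>R b) -` A"
    have mA: "A' \<in> sets borel"
    proof -
      have "(\<lambda>r. y + r *\<^sub>R b) \<in> borel_measurable borel"
        by (intro borel_measurable_continuous_onI continuous_intros)
      from measurable_sets[OF this A] show ?thesis by (simp add: A'_def)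
    qed
    obtain L where L: "L \<ge> 0" "\<And>s. \<bar>s\<bar> \<ge> L \<Longrightarrow> y + s *\<^sub>R b \<notin> K" using line_leaves_K by blast
    have "(\<integral>\<^sup>+s. ennreal (J (y + s *\<^sub>R b)) * indicator A' (s + \<phi> (y + s *\<^sub>R b)) \<partial>lborel) = emeasure lborel A'"
    proof (rule nn_integral_substitution_real_line[OF mA _ _ _ L(1)])
      fix s :: real
      have 1: "(\<phi> has_derivative (\<lambda>h. h \<bullet> G (y + s *\<^sub>R b))) (at (y + s *\<^sub>R b))"
        using grad by (simp add: gderiv_def)
      have 2: "((\<lambda>s. y + s *\<^sub>R b) has_derivative (\<lambda>r. r *\<^sub>R b)) (at s)"
        by (auto intro!: derivative_eq_intros)
      from has_derivative_compose[OF 2 1]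
      have "((\<lambda>s. \<phi> (y + s *\<^sub>R b)) has_derivative (\<lambda>r. (r *\<^sub>R b) \<bullet> G (y + s *\<^sub>R b))) (at s)" .
      then have "((\<lambda>s. \<phi> (y + s *\<^sub>R b)) has_real_derivative G (y + s *\<^sub>R b) \<bullet> b) (at s)"
        by (simp add: has_field_derivative_def inner_commute mult_commute_abs)
      then show "((\<lambda>s. s + \<phi> (y + s *\<^sub>R b)) has_real_derivative J (y + s *\<^sub>R b)) (at s)"
        unfolding J_def by (auto intro!: derivative_eq_intros)
      show "0 \<le> J (y + s *\<^sub>R b)" by (rule less_imp_le[OF J_pos])
      show "s + \<phi> (y + s *\<^sub>R b) = s" if "L \<le> \<bar>s\<bar>" using outside L that by simp
      show "J (y + s *\<^sub>R b) = 1" if "L < \<bar>s\<bar>" using G_outside L that by (simp add: J_def)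
    next
      show "continuous_on UNIV (\<lambda>s. J (y + s *\<^sub>R b))"
        by (intro continuous_on_compose2[OF J_continuous] continuous_intros) auto
    qed
    also have "\<dots> = (\<integral>\<^sup>+s. indicator A (y + s *\<^sub>R b) \<partial>lborel)"
    proof -
      have "emeasure lborel A' = (\<integral>\<^sup>+s. indicator A' s \<partial>lborel)" using mA by simp
      then show ?thesis by (simp add: A'_def indicator_def)
    qed
    finally show "(\<integral>\<^sup>+s. ennreal (J ((\<Sum>c\<in>Basis - {b}. z c *\<^sub>R c) + s *\<^sub>R b)) *
       indicator A (\<Phi> ((\<Sum>c\<in>Basis - {b}. z c *\<^sub>R c) + s *\<^sub>R b)) \<partial>lborel) =
       (\<integral>\<^sup>+s. indicator A ((\<Sum>c\<in>Basis - {b}. z c *\<^sub>R c) + s *\<^sub>R b) \<partial>lborel)"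
      unfolding y_def[symmetric] by (simp add: \<Phi>_def A'_def indicator_def scaleR_left_distrib add.assoc)
  qed
  also have "\<dots> = (\<integral>\<^sup>+x. indicator A x \<partial>lborel)"
    by (rule nn_integral_lborel_along_Basis[OF b, symmetric]) measurable
  finally show "emeasure (distr (density lborel (\<lambda>x. ennreal (J x))) borel \<Phi>) A = emeasure lborel A" by simp
qed simp

text \<open>Mass is conserved, so the density is transported and divided by the Jacobian.\<close>

lemma distr_density_Phi:
  assumes [measurable]: "u \<in> borel_measurable borel" and nn: "\<And>x. 0 \<le> u x"
  shows "distr (density lborel (\<lambda>x. ennreal (u x))) borel \<Phi> = density lborel (\<lambda>y. ennreal (u (\<Psi> y) / J (\<Psi> y)))"
proof (rule measure_eqI)
  fix A assume "A \<in> sets (distr (density lborel (\<lambda>x. ennreal (u x))) borel \<Phi>)"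
  then have A[measurable]: "A \<in> sets borel" by simp
  have PA: "\<Phi> -` A \<in> sets borel" using measurable_sets[OF Phi_measurable A] by simp
  have "emeasure (density lborel (\<lambda>y. ennreal (u (\<Psi> y) / J (\<Psi> y)))) A
      = (\<integral>\<^sup>+y. ennreal (u (\<Psi> y) / J (\<Psi> y)) * indicator A y \<partial>lborel)"
    by (rule emeasure_density) auto
  also have "\<dots> = (\<integral>\<^sup>+y. ennreal (u (\<Psi> y) / J (\<Psi> y)) * indicator A y \<partial>(distr (density lborel (\<lambda>x. ennreal (J x))) borel \<Phi>))"
    by (simp add: lborel_eq_distr_Phi)
  also have "\<dots> = (\<integral>\<^sup>+x. ennreal (J x) * (ennreal (u x / J x) * indicator A (\<Phi> x)) \<partial>lborel)"
    by (subst nn_integral_distr, simp, simp, subst nn_integral_density) auto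
  also have "\<dots> = (\<integral>\<^sup>+x. ennreal (u x) * indicator (\<Phi> -` A) x \<partial>lborel)"
    using J_pos nn by (intro nn_integral_cong)
      (auto simp: indicator_def ennreal_mult'[symmetric] less_imp_le order_less_imp_not_eq2)
  also have "\<dots> = emeasure (distr (density lborel (\<lambda>x. ennreal (u x))) borel \<Phi>) A"
    using PA by (simp add: emeasure_distr emeasure_density)
  finally show "emeasure (distr (density lborel (\<lambda>x. ennreal (u x))) borel \<Phi>) A =
    emeasure (density lborel (\<lambda>y. ennreal (u (\<Psi> y) / J (\<Psi> y)))) A" ..
qed simp

text \<open>If \<open>u\<close> is the density of \<open>\<mu>\<close>, the density of the image at \<open>\<Phi> x\<close> is \<open>u x / J x\<close>. Substituting \<open>y = \<Phi> x\<close> turns its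
  entropy into the integral of \<open>u ln (u / J)\<close>.\<close>

lemma entropy_fun_distr_Phi:
  assumes \<Omega>: "compact \<Omega>" "K \<subseteq> \<Omega>" "\<And>x. x \<in> K \<Longrightarrow> \<Phi> x \<in> \<Omega>"
    and \<mu>: "\<mu> \<in> prob_on \<Omega>" "entropy_fun \<Omega> \<mu> < \<infinity>"
  shows "entropy_fun \<Omega> (distr \<mu> borel \<Phi>) = entropy_fun \<Omega> \<mu> - ereal (LINT x:\<Omega>|\<mu>. ln (J x))"
proof -
  define u where "u = (\<lambda>x. enn2real (RN_deriv lborel \<mu> x))"
  define w where "w = (\<lambda>y. u (\<Psi> y) / J (\<Psi> y))"
  have s: "sets \<mu> = sets borel" by (rule prob_onD[OF \<mu>(1)])
  interpret \<mu>: prob_space \<mu> using prob_onD[OF \<mu>(1)] by simp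
  have O[measurable]: "\<Omega> \<in> sets borel" using \<Omega>(1) by (rule borel_compact)
  have ent_if: "entropy_fun \<Omega> \<mu> = (if absolutely_continuous lborel \<mu> \<and> set_integrable lborel \<Omega> (\<lambda>x. u x * ln (u x))
      then ereal (LINT x:\<Omega>|lborel. u x * ln (u x)) else \<infinity>)"
    unfolding entropy_fun_def Let_def u_def ..
  have both: "absolutely_continuous lborel \<mu> \<and> set_integrable lborel \<Omega> (\<lambda>x. u x * ln (u x))"
  proof (rule ccontr)
    assume "\<not> ?thesis"
    then have "entropy_fun \<Omega> \<mu> = \<infinity>" unfolding ent_if by (rule if_not_P)
    with \<mu>(2) show False by simp
  qed
  then have ac: "absolutely_continuous lborel \<mu>" and int: "set_integrable lborel \<Omega> (\<lambda>x. u x * ln (u x))"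
    by blast+
  have ent: "entropy_fun \<Omega> \<mu> = ereal (LINT x:\<Omega>|lborel. u x * ln (u x))"
    unfolding ent_if using both by (rule if_P)
  have u[measurable]: "u \<in> borel_measurable borel" unfolding u_def by measurable
  have nn: "0 \<le> u x" for x by (simp add: u_def)
  have fin: "AE x in lborel. RN_deriv lborel \<mu> x \<noteq> \<infinity>"
    by (rule sigma_finite_measure.RN_deriv_finite[OF lborel.sigma_finite_measure_axioms \<mu>.sigma_finite_measure ac]) (simp add: s)
  have dens: "density lborel (\<lambda>x. ennreal (u x)) = \<mu>"
  proof -
    have "density lborel (\<lambda>x. ennreal (u x)) = density lborel (RN_deriv lborel \<mu>)"
      by (rule density_cong) (use fin in \<open>auto simp: u_def top.not_eq_extremum\<close>)
    also have "\<dots> = \<mu>" by (rule sigma_finite_measure.density_RN_deriv[OF lborel.sigma_finite_measure_axioms ac]) (simp add: s)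
    finally show ?thesis .
  qed
  have iu: "integrable lborel u"
  proof (rule integrableI_nonneg)
    have "(\<integral>\<^sup>+x. ennreal (u x) \<partial>lborel) = emeasure (density lborel (\<lambda>x. ennreal (u x))) UNIV"
      by (subst emeasure_density) auto
    then show "(\<integral>\<^sup>+x. ennreal (u x) \<partial>lborel) < \<infinity>" by (simp add: dens \<mu>.emeasure_eq_measure)
  qed (auto simp: nn)
  have w[measurable]: "w \<in> borel_measurable borel" unfolding w_def by measurable
  have wn: "0 \<le> w y" for y using nn J_pos[of "\<Psi> y"] by (simp add: w_def)
  have dens': "density lborel (\<lambda>y. ennreal (w y)) = distr \<mu> borel \<Phi>"
    using distr_density_Phi[OF u nn] dens by (simp add: w_def)
  have RN: "AE y in lborel. w y = enn2real (RN_deriv lborel (distr \<mu> borel \<Phi>) y)"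
    using sigma_finite_measure.RN_deriv_unique[OF lborel.sigma_finite_measure_axioms _ dens'] by (auto elim!: eventually_mono simp: wn dest: sym)
  have ac': "absolutely_continuous lborel (distr \<mu> borel \<Phi>)"
    unfolding dens'[symmetric] by (rule absolutely_continuousI_density) simp
  have \<Phi>\<Omega>: "\<Phi> x \<in> \<Omega> \<longleftrightarrow> x \<in> \<Omega>" for x
    using \<Omega>(2,3) outside[of x] by (cases "x \<in> K") (auto simp: \<Phi>_def)
  have lnJ: "\<bar>ln (J x)\<bar> \<le> 1" for x
  proof -
    have "ln (J x) \<le> J x - 1" using ln_le_minus_one[OF J_pos] .
    moreover have "- ln (J x) \<le> 1 / J x - 1" using ln_le_minus_one[of "1 / J x"] J_pos[of x] by (simp add: ln_div)
    moreover have "1 / J x \<le> 2" using J_bounds[of x] by (simp add: field_simps)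
    ultimately show ?thesis using J_bounds[of x] by linarith
  qed
  have iJ: "integrable lborel (\<lambda>x. indicat_real \<Omega> x * (u x * ln (J x)))"
  proof (rule Bochner_Integration.integrable_bound[OF iu])
    show "AE x in lborel. norm (indicat_real \<Omega> x * (u x * ln (J x))) \<le> norm (u x)"
      using lnJ nn by (intro AE_I2) (auto simp: indicator_def abs_mult mult_left_le)
  qed measurable
  have pt: "J x * (indicat_real \<Omega> (\<Phi> x) * (w (\<Phi> x) * ln (w (\<Phi> x)))) =
     indicat_real \<Omega> x * (u x * ln (u x)) - indicat_real \<Omega> x * (u x * ln (J x))" for x
    using nn[of x] J_pos[of x] by (cases "u x = 0") (auto simp: w_def \<Phi>\<Omega> indicator_def ln_div algebra_simps)
  have i1: "integrable lborel (\<lambda>x. J x * (indicat_real \<Omega> (\<Phi> x) * (w (\<Phi> x) * ln (w (\<Phi> x)))))"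
    unfolding pt using int iJ by (intro Bochner_Integration.integrable_diff) (auto simp: set_integrable_def)
  have i2: "integrable (density lborel (\<lambda>x. ennreal (J x))) (\<lambda>x. indicat_real \<Omega> (\<Phi> x) * (w (\<Phi> x) * ln (w (\<Phi> x))))"
    using i1 J_pos by (subst integrable_density) (auto simp: less_imp_le)
  have i3: "integrable lborel (\<lambda>y. indicat_real \<Omega> y * (w y * ln (w y)))"
    using i2 by (subst lborel_eq_distr_Phi[symmetric], subst integrable_distr_eq) auto
  have "(LINT y|lborel. indicat_real \<Omega> y * (w y * ln (w y))) =
     (LINT x|density lborel (\<lambda>x. ennreal (J x)). indicat_real \<Omega> (\<Phi> x) * (w (\<Phi> x) * ln (w (\<Phi> x))))"
    by (subst lborel_eq_distr_Phi[symmetric], subst integral_distr) auto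
  also have "\<dots> = (LINT x|lborel. J x * (indicat_real \<Omega> (\<Phi> x) * (w (\<Phi> x) * ln (w (\<Phi> x)))))"
    using J_pos by (subst integral_density) (auto simp: less_imp_le)
  also have "\<dots> = (LINT x:\<Omega>|lborel. u x * ln (u x)) - (LINT x|lborel. indicat_real \<Omega> x * (u x * ln (J x)))"
    unfolding pt using int iJ by (subst Bochner_Integration.integral_diff) (auto simp: set_integrable_def set_lebesgue_integral_def)
  also have "(LINT x|lborel. indicat_real \<Omega> x * (u x * ln (J x))) = (LINT x:\<Omega>|\<mu>. ln (J x))"
    unfolding dens[symmetric] set_lebesgue_integral_def
    by (subst integral_density) (auto simp: nn ac_simps)
  finally have val: "(LINT y|lborel. indicat_real \<Omega> y * (w y * ln (w y))) =
    (LINT x:\<Omega>|lborel. u x * ln (u x)) - (LINT x:\<Omega>|\<mu>. ln (J x))" .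
  let ?v = "\<lambda>y. enn2real (RN_deriv lborel (distr \<mu> borel \<Phi>) y)"
  have eq: "AE y in lborel. indicat_real \<Omega> y * (w y * ln (w y)) = indicat_real \<Omega> y * (?v y * ln (?v y))"
    using RN by eventually_elim simp
  have "set_integrable lborel \<Omega> (\<lambda>y. ?v y * ln (?v y))"
    unfolding set_integrable_def real_scaleR_def
    by (rule integrable_cong_AE_imp[OF i3 _ eq]) measurable
  moreover have "(LINT y:\<Omega>|lborel. ?v y * ln (?v y)) = (LINT y|lborel. indicat_real \<Omega> y * (w y * ln (w y)))"
    unfolding set_lebesgue_integral_def using eq by (intro integral_cong_AE) (auto elim: eventually_mono)
  ultimately show ?thesis
    using ac' by (simp add: entropy_fun_def[of \<Omega> "distr \<mu> borel \<Phi>"] Let_def val ent)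
qed

end

section \<open>The Euler-Lagrange equation of one step\<close>

lemma continuous_bounded_on_compact:
  fixes f :: "'b::topological_space \<Rightarrow> 'c::real_normed_vector"
  assumes "compact K" "continuous_on K f"
  obtains B where "B > 0" "\<And>x. x \<in> K \<Longrightarrow> norm (f x) \<le> B"
  using compact_imp_bounded[OF compact_continuous_image[OF assms(2,1)]] by (auto simp: bounded_pos)

lemma abs_ln_one_plus_le:
  fixes x :: real
  assumes "\<bar>x\<bar> \<le> 1 / 2"
  shows "\<bar>ln (1 + x)\<bar> \<le> 2 * \<bar>x\<bar>"
proof -
  have "\<bar>ln (1 + x) - x\<bar> \<le> 2 * x\<^sup>2" by (rule abs_ln_one_plus_x_minus_x_bound) fact
  also have "\<dots> \<le> \<bar>x\<bar>"
    using mult_right_mono[OF assms, of "\<bar>x\<bar>"] by (simp add: power2_eq_square abs_mult[symmetric])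
  finally show ?thesis by linarith
qed

lemma norm_add_scaleR_Basis:
  fixes y b :: "'a::euclidean_space"
  assumes "b \<in> Basis"
  shows "(norm (y + c *\<^sub>R b))\<^sup>2 = (norm y)\<^sup>2 + 2 * c * (b \<bullet> y) + c\<^sup>2"
  unfolding power2_norm_eq_inner using assms
  by (simp add: inner_add_left inner_add_right inner_commute power2_eq_square)

text \<open>The image of \<open>\<nu>\<close> is concentrated on \<open>\<Omega>\<close>, so almost every point is mapped into \<open>\<Omega>\<close>.\<close>

lemma optimal_map_AE:
  assumes "closed \<Omega>" "optimal_map \<Omega> \<nu> \<mu> S" "\<nu> \<in> prob_on \<Omega>" "\<mu> \<in> prob_on \<Omega>"
  shows "AE x in \<nu>. x \<in> \<Omega> \<and> S x \<in> \<Omega>"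
proof -
  have O: "\<Omega> \<in> sets borel" using assms(1) by (rule borel_closed)
  have S: "S \<in> \<nu> \<rightarrow>\<^sub>M borel" "distr \<nu> borel S = \<mu>"
    using assms(2) by (auto simp: optimal_map_def measurable_cong_sets[OF prob_onD(2)[OF assms(3)] refl])
  have "AE x in \<nu>. S x \<in> \<Omega>"
    using prob_on_AE[OF assms(4) O] O unfolding S(2)[symmetric] by (simp add: AE_distr_iff[OF S(1)])
  then show ?thesis using prob_on_AE[OF assms(3) O] by eventually_elim simp
qed

text \<open>The competitor is the image of the minimiser under the shear \<open>x + \<epsilon> \<psi>(x) b\<close>, coupled to \<open>\<mu>\<close> through the old
  map \<open>S\<close>. Minimality says that the integral of \<open>Q \<epsilon>\<close>, the difference of the integrands, is nonnegative for all small \<open>\<epsilon>\<close>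
  of either sign. Its difference quotients at \<open>0\<close> converge dominatedly to \<open>q\<close>, so that the integral
  of \<open>q\<close> is both nonnegative and nonpositive.\<close>

lemma jko_first_variation_direction:
  fixes \<Omega> :: "'a::euclidean_space set"
  assumes \<Omega>: "compact \<Omega>" and V: "C1_closure \<Omega> V gradV" and h: "h > 0"
    and step: "jko_step \<Omega> V h \<mu> \<nu>" and \<mu>: "\<mu> \<in> prob_on \<Omega>" and \<nu>: "\<nu> \<in> prob_on \<Omega>"
    and fin: "energy \<Omega> V \<nu> < \<infinity>" and S: "optimal_map \<Omega> \<nu> \<mu> S"
    and b: "b \<in> Basis" and \<psi>: "\<And>x. GDERIV \<psi> x :> G x" and G: "continuous_on UNIV G"
    and K: "compact K" "K \<subseteq> interior \<Omega>" and supp: "\<And>x. x \<notin> K \<Longrightarrow> \<psi> x = 0"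
  shows "(LINT x:\<Omega>|\<nu>. \<psi> x * (b \<bullet> (x - S x)) / h - G x \<bullet> b + \<psi> x * (gradV x \<bullet> b)) = 0"
proof -
  have cl: "closed \<Omega>" and O[measurable]: "\<Omega> \<in> sets borel"
    using \<Omega> by (auto intro: compact_imp_closed borel_compact)
  interpret \<nu>: prob_space \<nu> using prob_onD[OF \<nu>] by simp
  note s = prob_onD(2)[OF \<nu>]
  note [measurable_cong] = s
  have Vc: "continuous_on \<Omega> V" and gVc: "continuous_on \<Omega> gradV"
    and Vd: "\<And>x. x \<in> interior \<Omega> \<Longrightarrow> GDERIV V x :> gradV x"
    using V by (auto simp: C1_closure_def)
  have Sm[measurable]: "S \<in> borel_measurable borel" and Sd: "distr \<nu> borel S = \<mu>"
    and Sopt: "(LINT x:\<Omega>|\<nu>. (norm (x - S x))\<^sup>2) = (W2 \<Omega> \<nu> \<mu>)\<^sup>2"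
    using S by (auto simp: optimal_map_def)
  have \<psi>c: "continuous_on UNIV \<psi>"
    using \<psi> unfolding gderiv_def by (auto intro!: continuous_at_imp_continuous_on has_derivative_continuous)
  have [measurable]: "\<psi> \<in> borel_measurable borel" "G \<in> borel_measurable borel"
    by (intro borel_measurable_continuous_onI \<psi>c G)+
  have gVm[measurable]: "(\<lambda>x. indicat_real \<Omega> x *\<^sub>R gradV x) \<in> borel_measurable borel"
    using borel_measurable_continuous_on_indicator[OF O gVc] .
  have Vm[measurable]: "(\<lambda>x. indicat_real \<Omega> x * V x) \<in> borel_measurable borel"
    using continuous_on_indicator_measurable[OF O Vc] .
  have K\<Omega>: "K \<subseteq> \<Omega>" using K(2) interior_subset by blast
  have \<psi>abs: "continuous_on K \<psi>" using \<psi>c continuous_on_subset by blast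
  have G0: "G x = 0" if "x \<notin> K" for x
  proof (rule GDERIV_locally_zero[OF \<psi>])
    show "open (- K)" using compact_imp_closed[OF K(1)] by (rule open_Compl)
  qed (use that supp in auto)
  obtain B1 where B1: "B1 > 0" "\<And>x. x \<in> K \<Longrightarrow> norm (\<psi> x) \<le> B1"
    using continuous_bounded_on_compact[OF K(1) \<psi>abs] by blast
  obtain B2 where B2: "B2 > 0" "\<And>x. x \<in> K \<Longrightarrow> norm (G x) \<le> B2"
    using continuous_bounded_on_compact[OF K(1) continuous_on_subset[OF G]] by blast
  define B where "B = max B1 B2"
  have B: "B > 0" "\<And>x. \<bar>\<psi> x\<bar> \<le> B" "\<And>x. norm (G x) \<le> B"
  proof -
    show "B > 0" using B1 by (simp add: B_def)
    show "\<bar>\<psi> x\<bar> \<le> B" for x using B1 B2(1) supp[of x] by (cases "x \<in> K") (auto simp: B_def intro: max.coboundedI1)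
    show "norm (G x) \<le> B" for x using B2 B1(1) G0[of x] by (cases "x \<in> K") (auto simp: B_def intro: max.coboundedI2)
  qed
  obtain BV where BV: "BV > 0" "\<And>x. x \<in> \<Omega> \<Longrightarrow> norm (gradV x) \<le> BV"
    using continuous_bounded_on_compact[OF \<Omega> gVc] by blast
  obtain BW where BW: "BW > 0" "\<And>x. x \<in> \<Omega> \<Longrightarrow> norm (V x) \<le> BW"
    using continuous_bounded_on_compact[OF \<Omega> Vc] by blast
  obtain D where D: "D > 0" "\<And>x. x \<in> \<Omega> \<Longrightarrow> norm x \<le> D"
    using continuous_bounded_on_compact[OF \<Omega> continuous_on_id[of \<Omega>]] by blast
  obtain r where r: "r > 0" "(\<Union>x\<in>K. cball x r) \<subseteq> interior \<Omega>"
    using compact_subset_open_imp_cball_epsilon_subset[OF K(1) open_interior K(2)] by blast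
  \<comment> \<open>The first bound keeps the gradient of the perturbation at most \<open>1 / 2\<close>, the second keeps the moved points of \<open>K\<close> inside \<open>\<Omega>\<close>.\<close>
  define \<epsilon>0 where "\<epsilon>0 = min (1 / (2 * B)) (r / B)"
  have \<epsilon>0: "\<epsilon>0 > 0" "\<epsilon>0 * B \<le> 1 / 2" "\<epsilon>0 * B \<le> r"
  proof -
    show "\<epsilon>0 > 0" using B r by (simp add: \<epsilon>0_def)
    have "\<epsilon>0 \<le> 1 / (2 * B)" "\<epsilon>0 \<le> r / B" by (simp_all add: \<epsilon>0_def)
    then show "\<epsilon>0 * B \<le> 1 / 2" "\<epsilon>0 * B \<le> r" using B(1) by (simp_all add: field_simps)
  qed
  have nb: "norm b = 1" using b by simp
  define Q where "Q \<epsilon> x = - ln (1 + \<epsilon> * (G x \<bullet> b)) + (V (x + (\<epsilon> * \<psi> x) *\<^sub>R b) - V x)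
     + (2 * (\<epsilon> * \<psi> x) * (b \<bullet> (x - S x)) + (\<epsilon> * \<psi> x)\<^sup>2) / (2 * h)" for \<epsilon> x
  define q where "q x = \<psi> x * (b \<bullet> (x - S x)) / h - G x \<bullet> b + \<psi> x * (gradV x \<bullet> b)" for x
  have AES: "AE x in \<nu>. x \<in> \<Omega> \<and> S x \<in> \<Omega>" by (rule optimal_map_AE[OF cl S \<nu> \<mu>])
  have Gb: "\<bar>G x \<bullet> b\<bar> \<le> B" for x
    using Cauchy_Schwarz_ineq2[of "G x" b] B(3)[of x] nb by simp
  have move: "norm ((\<epsilon> * \<psi> x) *\<^sub>R b) \<le> r" if "\<bar>\<epsilon>\<bar> \<le> \<epsilon>0" for \<epsilon> x
  proof -
    have "\<bar>\<epsilon>\<bar> * \<bar>\<psi> x\<bar> \<le> \<epsilon>0 * B" by (rule mult_mono) (use that B \<epsilon>0 in auto)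
    then show ?thesis using \<epsilon>0(3) nb by (simp add: abs_mult)
  qed
  have small: "\<bar>\<epsilon> * (G x \<bullet> b)\<bar> \<le> 1 / 2" if "\<bar>\<epsilon>\<bar> \<le> \<epsilon>0" for \<epsilon> x
  proof -
    have "\<bar>\<epsilon>\<bar> * \<bar>G x \<bullet> b\<bar> \<le> \<epsilon>0 * B" by (rule mult_mono) (use that B Gb \<epsilon>0 in auto)
    then show ?thesis using \<epsilon>0(2) by (simp add: abs_mult)
  qed
  have in\<Omega>: "x + (\<epsilon> * \<psi> x) *\<^sub>R b \<in> interior \<Omega>" if "\<bar>\<epsilon>\<bar> \<le> \<epsilon>0" "x \<in> K" for \<epsilon> x
  proof -
    have "x + (\<epsilon> * \<psi> x) *\<^sub>R b \<in> cball x r" using move[OF that(1), of x] by (simp add: dist_norm)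
    then show ?thesis using r(2) that(2) by blast
  qed
  have \<Omega>iff: "x + (\<epsilon> * \<psi> x) *\<^sub>R b \<in> \<Omega> \<longleftrightarrow> x \<in> \<Omega>" if "\<bar>\<epsilon>\<bar> \<le> \<epsilon>0" for \<epsilon> x
    using in\<Omega>[OF that, of x] supp[of x] K\<Omega> interior_subset[of \<Omega>] by (cases "x \<in> K") auto
  have Vdiff: "\<bar>V (x + (\<epsilon> * \<psi> x) *\<^sub>R b) - V x\<bar> \<le> \<bar>\<epsilon>\<bar> * (BV * B)" if "\<bar>\<epsilon>\<bar> \<le> \<epsilon>0" "x \<in> \<Omega>" for \<epsilon> x
  proof (cases "x \<in> K")
    case True
    have sub: "cball x r \<subseteq> interior \<Omega>" using r(2) True by blast
    have "norm (V (x + (\<epsilon> * \<psi> x) *\<^sub>R b) - V x) \<le> BV * norm (x + (\<epsilon> * \<psi> x) *\<^sub>R b - x)"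
    proof (rule differentiable_bound[where S = "cball x r" and f' = "\<lambda>y h. h \<bullet> gradV y"])
      show "(V has_derivative (\<lambda>h. h \<bullet> gradV y)) (at y within cball x r)" if "y \<in> cball x r" for y
      proof -
        have "y \<in> interior \<Omega>" using that sub by blast
        then show ?thesis using Vd[of y] by (simp add: gderiv_def has_derivative_at_withinI)
      qed
      show "onorm (\<lambda>h. h \<bullet> gradV y) \<le> BV" if "y \<in> cball x r" for y
      proof (rule onorm_le)
        fix k :: 'a
        have "y \<in> \<Omega>" using that sub interior_subset by blast
        then have "norm k * norm (gradV y) \<le> norm k * BV" using BV by (intro mult_left_mono) auto
        then show "norm (k \<bullet> gradV y) \<le> BV * norm k"
          using Cauchy_Schwarz_ineq2[of k "gradV y"] by (simp add: mult.commute)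
      qed
      show "x + (\<epsilon> * \<psi> x) *\<^sub>R b \<in> cball x r" using move[OF that(1), of x] by (simp add: dist_norm)
    qed (use r in auto)
    also have "\<dots> = BV * (\<bar>\<epsilon>\<bar> * \<bar>\<psi> x\<bar>)" using nb by (simp add: abs_mult)
    also have "\<dots> \<le> BV * (\<bar>\<epsilon>\<bar> * B)" using BV B by (intro mult_left_mono) auto
    finally show ?thesis by (simp add: ac_simps)
  qed (use supp BV B in auto)
  \<comment> \<open>Dominating constant for the difference quotients: entropy, potential and transport cost in turn.\<close>
  define C where "C = 2 * B + BV * B + (4 * D * B + \<epsilon>0 * B\<^sup>2) / (2 * h)"
  have Qbound: "\<bar>Q \<epsilon> x\<bar> \<le> \<bar>\<epsilon>\<bar> * C" if e: "\<bar>\<epsilon>\<bar> \<le> \<epsilon>0" and x: "x \<in> \<Omega>" "S x \<in> \<Omega>" for \<epsilon> x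
  proof -
    have 1: "\<bar>ln (1 + \<epsilon> * (G x \<bullet> b))\<bar> \<le> \<bar>\<epsilon>\<bar> * (2 * B)"
    proof -
      have "\<bar>ln (1 + \<epsilon> * (G x \<bullet> b))\<bar> \<le> 2 * \<bar>\<epsilon> * (G x \<bullet> b)\<bar>" by (rule abs_ln_one_plus_le[OF small[OF e]])
      also have "\<dots> = \<bar>\<epsilon>\<bar> * (2 * \<bar>G x \<bullet> b\<bar>)" by (simp add: abs_mult)
      also have "\<dots> \<le> \<bar>\<epsilon>\<bar> * (2 * B)" using Gb[of x] by (intro mult_left_mono) auto
      finally show ?thesis .
    qed
    have "\<bar>b \<bullet> (x - S x)\<bar> \<le> 2 * D"
      using Cauchy_Schwarz_ineq2[of b "x - S x"] nb D(2)[OF x(1)] D(2)[OF x(2)] norm_triangle_ineq4[of x "S x"] by simp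
    then have "2 * \<bar>\<psi> x\<bar> * \<bar>b \<bullet> (x - S x)\<bar> \<le> 2 * B * (2 * D)"
      using B by (intro mult_mono) auto
    then have 2: "\<bar>\<epsilon>\<bar> * (2 * \<bar>\<psi> x\<bar> * \<bar>b \<bullet> (x - S x)\<bar>) \<le> \<bar>\<epsilon>\<bar> * (4 * D * B)"
      by (intro mult_left_mono) (auto simp: ac_simps)
    have 3: "\<bar>\<epsilon>\<bar> * (\<bar>\<epsilon>\<bar> * (\<psi> x)\<^sup>2) \<le> \<bar>\<epsilon>\<bar> * (\<epsilon>0 * B\<^sup>2)"
      using e \<epsilon>0 B(2)[of x] by (intro mult_left_mono mult_mono) (auto simp: abs_le_square_iff[symmetric])
    have "\<bar>2 * (\<epsilon> * \<psi> x) * (b \<bullet> (x - S x)) + (\<epsilon> * \<psi> x)\<^sup>2\<bar> \<le> \<bar>\<epsilon>\<bar> * (2 * \<bar>\<psi> x\<bar> * \<bar>b \<bullet> (x - S x)\<bar>) + \<bar>\<epsilon>\<bar> * (\<bar>\<epsilon>\<bar> * (\<psi> x)\<^sup>2)"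
      by (rule order_trans[OF abs_triangle_ineq]) (simp add: abs_mult power_mult_distrib power2_eq_square ac_simps)
    also have "\<dots> \<le> \<bar>\<epsilon>\<bar> * (4 * D * B + \<epsilon>0 * B\<^sup>2)" using add_mono[OF 2 3] by (simp only: distrib_left)
    finally have 4: "\<bar>(2 * (\<epsilon> * \<psi> x) * (b \<bullet> (x - S x)) + (\<epsilon> * \<psi> x)\<^sup>2) / (2 * h)\<bar> \<le> \<bar>\<epsilon>\<bar> * ((4 * D * B + \<epsilon>0 * B\<^sup>2) / (2 * h))"
      using h by (simp add: abs_divide divide_right_mono)
    show ?thesis
      using 1 Vdiff[OF e x(1)] 4 unfolding Q_def C_def distrib_left by linarith
  qed
  have Qm: "(\<lambda>x. indicat_real \<Omega> x * Q \<epsilon> x) \<in> borel_measurable \<nu>" if e: "\<bar>\<epsilon>\<bar> \<le> \<epsilon>0" for \<epsilon>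
  proof -
    have [measurable]: "(\<lambda>x. x + (\<epsilon> * \<psi> x) *\<^sub>R b) \<in> borel \<rightarrow>\<^sub>M borel" by measurable
    have "(\<lambda>x. indicat_real \<Omega> (x + (\<epsilon> * \<psi> x) *\<^sub>R b) * V (x + (\<epsilon> * \<psi> x) *\<^sub>R b)) \<in> borel_measurable borel"
      by (rule measurable_compose[OF _ Vm]) measurable
    then have [measurable]: "(\<lambda>x. indicat_real \<Omega> x * V (x + (\<epsilon> * \<psi> x) *\<^sub>R b)) \<in> borel_measurable borel"
      by (simp add: indicator_def \<Omega>iff[OF e])
    have "(\<lambda>x. - (indicat_real \<Omega> x * ln (1 + \<epsilon> * (G x \<bullet> b))) + (indicat_real \<Omega> x * V (x + (\<epsilon> * \<psi> x) *\<^sub>R b) - indicat_real \<Omega> x * V x)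
       + indicat_real \<Omega> x * ((2 * (\<epsilon> * \<psi> x) * (b \<bullet> (x - S x)) + (\<epsilon> * \<psi> x)\<^sup>2) / (2 * h))) \<in> borel_measurable \<nu>"
      by measurable
    then show ?thesis by (simp add: Q_def algebra_simps)
  qed
  have Qint: "set_integrable \<nu> \<Omega> (Q \<epsilon>)" if e: "\<bar>\<epsilon>\<bar> \<le> \<epsilon>0" for \<epsilon>
    unfolding set_integrable_def real_scaleR_def
  proof (rule \<nu>.integrable_const_bound[OF _ Qm[OF e]])
    show "AE x in \<nu>. norm (indicat_real \<Omega> x * Q \<epsilon> x) \<le> \<bar>\<epsilon>\<bar> * C"
      using AES by eventually_elim (use Qbound[OF e] in auto)
  qed
  have pos: "0 \<le> (LINT x:\<Omega>|\<nu>. Q \<epsilon> x)" if e: "\<bar>\<epsilon>\<bar> \<le> \<epsilon>0" for \<epsilon>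
  proof -
    interpret shear: directional_shear b "\<lambda>x. \<epsilon> * \<psi> x" "\<lambda>x. \<epsilon> *\<^sub>R G x" K
    proof
      show "GDERIV (\<lambda>x. \<epsilon> * \<psi> x) x :> \<epsilon> *\<^sub>R G x" for x
        using has_derivative_mult_right[OF \<psi>[of x, unfolded gderiv_def], of \<epsilon>] by (simp add: gderiv_def)
      show "norm (\<epsilon> *\<^sub>R G x) \<le> 1 / 2" for x
      proof -
        have "\<bar>\<epsilon>\<bar> * norm (G x) \<le> \<epsilon>0 * B" by (rule mult_mono) (use e B \<epsilon>0 in auto)
        then show ?thesis using \<epsilon>0(2) by simp
      qed
    qed (use b K supp in \<open>auto intro!: continuous_intros G\<close>)
    let ?\<Phi> = "shear.\<Phi>"
    have \<Phi>: "?\<Phi> x = x + (\<epsilon> * \<psi> x) *\<^sub>R b" for x by (simp add: shear.\<Phi>_def)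
    have J: "shear.J x = 1 + \<epsilon> * (G x \<bullet> b)" for x by (simp add: shear.J_def)
    have \<Phi>m: "?\<Phi> \<in> \<nu> \<rightarrow>\<^sub>M borel" using shear.Phi_measurable by (simp add: measurable_cong_sets[OF s refl])
    have Smn: "S \<in> \<nu> \<rightarrow>\<^sub>M borel" using Sm by (simp add: measurable_cong_sets[OF s refl])
    have \<Phi>\<Omega>: "?\<Phi> x \<in> \<Omega> \<longleftrightarrow> x \<in> \<Omega>" for x unfolding \<Phi> by (rule \<Omega>iff[OF e])
    have ent_fin: "entropy_fun \<Omega> \<nu> < \<infinity>" using fin unfolding energy_def by (cases "entropy_fun \<Omega> \<nu>") auto
    define \<sigma> where "\<sigma> = distr \<nu> borel ?\<Phi>"
    have \<sigma>: "\<sigma> \<in> prob_on \<Omega>"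
    proof (rule prob_onI)
      show "prob_space \<sigma>" unfolding \<sigma>_def by (rule \<nu>.prob_space_distr[OF \<Phi>m])
      show "AE x in \<sigma>. x \<in> \<Omega>"
        unfolding \<sigma>_def using prob_on_AE[OF \<nu> O] O by (simp add: AE_distr_iff[OF \<Phi>m] \<Phi>\<Omega>)
    qed (simp_all add: \<sigma>_def O)
    obtain en where en: "entropy_fun \<Omega> \<nu> = ereal en"
      using ent_fin entropy_fun_lower_bound[OF \<Omega>, of \<nu>] by (cases "entropy_fun \<Omega> \<nu>") auto
    have en\<sigma>: "entropy_fun \<Omega> \<sigma> = ereal (en - (LINT x:\<Omega>|\<nu>. ln (shear.J x)))"
      unfolding \<sigma>_def using shear.entropy_fun_distr_Phi[OF \<Omega> K\<Omega> _ \<nu> ent_fin] K\<Omega> \<Phi>\<Omega> by (auto simp: en)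
    have V\<sigma>: "(LINT x:\<Omega>|\<sigma>. V x) = (LINT x:\<Omega>|\<nu>. V (?\<Phi> x))"
      unfolding \<sigma>_def set_lebesgue_integral_def real_scaleR_def
      using integral_distr[OF \<Phi>m Vm] by (simp add: indicator_def \<Phi>\<Omega>)
    have W\<sigma>: "(W2 \<Omega> \<sigma> \<mu>)\<^sup>2 \<le> (LINT x:\<Omega>|\<nu>. (norm (?\<Phi> x - S x))\<^sup>2)"
    proof -
      have "(W2 \<Omega> \<sigma> \<mu>)\<^sup>2 \<le> (LINT x|\<nu>. (norm (?\<Phi> x - S x))\<^sup>2)"
        by (rule W2_le_random[OF cl prob_onD(1)[OF \<nu>] \<Phi>m Smn _ Sd \<sigma> \<mu>]) (simp add: \<sigma>_def)
      also have "\<dots> = (LINT x:\<Omega>|\<nu>. (norm (?\<Phi> x - S x))\<^sup>2)"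
        by (rule set_integral_prob_on[OF \<nu> O, symmetric]) (use shear.Phi_measurable in measurable)
      finally show ?thesis .
    qed
    have min: "en + (LINT x:\<Omega>|\<nu>. V x) + (LINT x:\<Omega>|\<nu>. (norm (x - S x))\<^sup>2) / (2 * h)
      \<le> en - (LINT x:\<Omega>|\<nu>. ln (shear.J x)) + (LINT x:\<Omega>|\<nu>. V (?\<Phi> x)) + (LINT x:\<Omega>|\<nu>. (norm (?\<Phi> x - S x))\<^sup>2) / (2 * h)"
    proof -
      have "en + (LINT x:\<Omega>|\<nu>. V x) + (W2 \<Omega> \<nu> \<mu>)\<^sup>2 / (2 * h)
        \<le> en - (LINT x:\<Omega>|\<nu>. ln (shear.J x)) + (LINT x:\<Omega>|\<nu>. V (?\<Phi> x)) + (W2 \<Omega> \<sigma> \<mu>)\<^sup>2 / (2 * h)"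
        using jko_step_minimal[OF step \<sigma>] by (simp add: energy_def en en\<sigma> V\<sigma>)
      also have "\<dots> \<le> en - (LINT x:\<Omega>|\<nu>. ln (shear.J x)) + (LINT x:\<Omega>|\<nu>. V (?\<Phi> x)) + (LINT x:\<Omega>|\<nu>. (norm (?\<Phi> x - S x))\<^sup>2) / (2 * h)"
        using W\<sigma> h by (intro add_left_mono divide_right_mono) auto
      finally show ?thesis by (simp add: Sopt)
    qed
    have i1: "set_integrable \<nu> \<Omega> (\<lambda>x. ln (shear.J x))"
    proof (rule set_integrable_bounded[OF _ s O])
      show "\<bar>ln (shear.J x)\<bar> \<le> 1" for x
        using abs_ln_one_plus_le[OF small[OF e, of x]] small[OF e, of x] unfolding J by linarith
      show "(\<lambda>x. indicat_real \<Omega> x * ln (shear.J x)) \<in> borel_measurable borel" unfolding J by measurable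
    qed unfold_locales
    have i2: "set_integrable \<nu> \<Omega> (\<lambda>x. V (?\<Phi> x))"
    proof (rule set_integrable_bounded[OF _ s O])
      show "\<bar>V (?\<Phi> x)\<bar> \<le> BW" if "x \<in> \<Omega>" for x using BW(2)[of "?\<Phi> x"] \<Phi>\<Omega> that by simp
      show "(\<lambda>x. indicat_real \<Omega> x * V (?\<Phi> x)) \<in> borel_measurable borel"
        using measurable_compose[OF shear.Phi_measurable Vm] by (simp add: indicator_def \<Phi>\<Omega>)
    qed unfold_locales
    have i3: "set_integrable \<nu> \<Omega> V"
      by (rule set_integrable_continuous_compact[OF _ s \<Omega> Vc]) unfold_locales
    have sq: "set_integrable \<nu> \<Omega> (\<lambda>x. (norm (F x - S x))\<^sup>2)" if [measurable]: "F \<in> borel_measurable borel" and F: "\<And>x. x \<in> \<Omega> \<Longrightarrow> F x \<in> \<Omega>" for F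
      unfolding set_integrable_def
    proof (rule \<nu>.integrable_const_bound)
      show "AE x in \<nu>. norm (indicat_real \<Omega> x *\<^sub>R (norm (F x - S x))\<^sup>2) \<le> (2 * D)\<^sup>2"
        using AES
      proof eventually_elim
        case (elim x)
        then have "norm (F x - S x) \<le> 2 * D"
          using D(2)[OF F, of x] D(2)[of "S x"] norm_triangle_ineq4[of "F x" "S x"] by auto
        then show ?case using power_mono[of "norm (F x - S x)" "2 * D" 2] elim by simp
      qed
    qed measurable
    have i4: "set_integrable \<nu> \<Omega> (\<lambda>x. (norm (x - S x))\<^sup>2)" by (rule sq) auto
    have i5: "set_integrable \<nu> \<Omega> (\<lambda>x. (norm (?\<Phi> x - S x))\<^sup>2)"
      by (rule sq[OF shear.Phi_measurable]) (simp add: \<Phi>\<Omega>)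
    have Qeq: "Q \<epsilon> x = (- ln (shear.J x) + (V (?\<Phi> x) - V x)) + ((norm (?\<Phi> x - S x))\<^sup>2 - (norm (x - S x))\<^sup>2) / (2 * h)" for x
    proof -
      have *: "?\<Phi> x - S x = (x - S x) + (\<epsilon> * \<psi> x) *\<^sub>R b" by (simp add: \<Phi>)
      have "(norm (?\<Phi> x - S x))\<^sup>2 = (norm (x - S x))\<^sup>2 + 2 * (\<epsilon> * \<psi> x) * (b \<bullet> (x - S x)) + (\<epsilon> * \<psi> x)\<^sup>2"
        unfolding * by (rule norm_add_scaleR_Basis[OF b])
      then show ?thesis unfolding Q_def J \<Phi> by simp
    qed
    have "(LINT x:\<Omega>|\<nu>. Q \<epsilon> x) = (- (LINT x:\<Omega>|\<nu>. ln (shear.J x)) + ((LINT x:\<Omega>|\<nu>. V (?\<Phi> x)) - (LINT x:\<Omega>|\<nu>. V x)))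
      + ((LINT x:\<Omega>|\<nu>. (norm (?\<Phi> x - S x))\<^sup>2) - (LINT x:\<Omega>|\<nu>. (norm (x - S x))\<^sup>2)) / (2 * h)"
      unfolding Qeq using i1 i2 i3 i4 i5
      by (simp add: set_integral_add set_integral_diff set_integral_uminus set_integrable_def set_lebesgue_integral_def
        distrib_left right_diff_distrib add_divide_distrib diff_divide_distrib)
    then show ?thesis using min by (simp add: diff_divide_distrib)
  qed
  have deriv: "((\<lambda>\<epsilon>. Q \<epsilon> x) has_real_derivative q x) (at 0)" if x: "x \<in> \<Omega>" for x
  proof -
    have 1: "((\<lambda>\<epsilon>. V (x + (\<epsilon> * \<psi> x) *\<^sub>R b)) has_real_derivative \<psi> x * (gradV x \<bullet> b)) (at 0)"
    proof (cases "x \<in> K")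
      case True
      have "(V has_derivative (\<lambda>k. k \<bullet> gradV x)) (at (x + (0 * \<psi> x) *\<^sub>R b))"
        using Vd[of x] True K(2) by (auto simp: gderiv_def)
      moreover have "((\<lambda>\<epsilon>. x + (\<epsilon> * \<psi> x) *\<^sub>R b) has_derivative (\<lambda>\<epsilon>. (\<epsilon> * \<psi> x) *\<^sub>R b)) (at 0)"
        by (auto intro!: derivative_eq_intros)
      ultimately have "((\<lambda>\<epsilon>. V (x + (\<epsilon> * \<psi> x) *\<^sub>R b)) has_derivative (\<lambda>\<epsilon>. ((\<epsilon> * \<psi> x) *\<^sub>R b) \<bullet> gradV x)) (at 0)"
        using has_derivative_compose by blast
      moreover have "(\<lambda>\<epsilon>. ((\<epsilon> * \<psi> x) *\<^sub>R b) \<bullet> gradV x) = (*) (\<psi> x * (gradV x \<bullet> b))"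
        by (auto simp: inner_commute fun_eq_iff)
      ultimately show ?thesis by (simp add: has_field_derivative_def)
    qed (simp add: supp)
    show ?thesis
      unfolding Q_def q_def using h
      by (auto intro!: derivative_eq_intros 1 simp: field_simps)
  qed
  have lim: "(\<lambda>n. (LINT x:\<Omega>|\<nu>. Q (e n) x) / e n) \<longlonglongrightarrow> (LINT x:\<Omega>|\<nu>. q x)"
    if e: "e \<longlonglongrightarrow> 0" "\<And>n. \<bar>e n\<bar> \<le> \<epsilon>0" "\<And>n. e n \<noteq> 0" for e :: "nat \<Rightarrow> real"
  proof -
    have "(\<lambda>n. LINT x|\<nu>. indicat_real \<Omega> x * (Q (e n) x / e n)) \<longlonglongrightarrow> (LINT x|\<nu>. indicat_real \<Omega> x * q x)"
    proof (rule integral_dominated_convergence[where w = "\<lambda>_. C"])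
      have "(\<lambda>x. indicat_real \<Omega> x * q x) = (\<lambda>x. indicat_real \<Omega> x * (\<psi> x * (b \<bullet> (x - S x)) / h - G x \<bullet> b)
         + \<psi> x * ((indicat_real \<Omega> x *\<^sub>R gradV x) \<bullet> b))"
        by (auto simp: q_def fun_eq_iff indicator_def)
      also have "\<dots> \<in> borel_measurable \<nu>" by measurable
      finally show "(\<lambda>x. indicat_real \<Omega> x * q x) \<in> borel_measurable \<nu>" .
      show "(\<lambda>x. indicat_real \<Omega> x * (Q (e n) x / e n)) \<in> borel_measurable \<nu>" for n
        using borel_measurable_divide[OF Qm[OF e(2)[of n]] borel_measurable_const[of "e n"]] by simp
      show "AE x in \<nu>. (\<lambda>n. indicat_real \<Omega> x * (Q (e n) x / e n)) \<longlonglongrightarrow> indicat_real \<Omega> x * q x"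
      proof (intro AE_I2)
        fix x
        show "(\<lambda>n. indicat_real \<Omega> x * (Q (e n) x / e n)) \<longlonglongrightarrow> indicat_real \<Omega> x * q x"
        proof (cases "x \<in> \<Omega>")
          case True
          have "((\<lambda>\<epsilon>. (Q (0 + \<epsilon>) x - Q 0 x) / \<epsilon>) \<longlongrightarrow> q x) (at 0)"
            using DERIV_D[OF deriv[OF True]] .
          moreover have "filterlim e (at 0) sequentially"
            using e by (auto simp: filterlim_at)
          ultimately have "(\<lambda>n. (Q (0 + e n) x - Q 0 x) / e n) \<longlonglongrightarrow> q x"
            by (rule filterlim_compose)
          moreover have "Q 0 x = 0" by (simp add: Q_def)
          ultimately show ?thesis using True by simp
        qed auto
      qed
      show "AE x in \<nu>. norm (indicat_real \<Omega> x * (Q (e n) x / e n)) \<le> C" for n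
        using AES
      proof eventually_elim
        case (elim x)
        then have "\<bar>Q (e n) x\<bar> \<le> \<bar>e n\<bar> * C" using Qbound[OF e(2)] by blast
        then show ?case using e(3)[of n] elim by (simp add: abs_mult abs_divide field_simps)
      qed
    qed simp
    then show ?thesis by (simp add: set_lebesgue_integral_def)
  qed
  have c: "(\<lambda>n. \<epsilon>0 / real (Suc n)) \<longlonglongrightarrow> 0"
    using tendsto_mult[OF tendsto_const[of \<epsilon>0] LIMSEQ_inverse_real_of_nat] by (simp add: divide_inverse)
  have b1: "\<bar>\<epsilon>0 / real (Suc n)\<bar> \<le> \<epsilon>0" for n using \<epsilon>0 by (simp add: field_simps)
  have "0 \<le> (LINT x:\<Omega>|\<nu>. q x)"
    by (rule LIMSEQ_le_const[OF lim[OF c b1]]) (use \<epsilon>0 pos[OF b1] in auto)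
  moreover have "(LINT x:\<Omega>|\<nu>. q x) \<le> 0"
  proof (rule LIMSEQ_le_const2[OF lim[of "\<lambda>n. - (\<epsilon>0 / real (Suc n))"]])
    show "(\<lambda>n. - (\<epsilon>0 / real (Suc n))) \<longlonglongrightarrow> 0" using tendsto_minus[OF c] by simp
    show "\<exists>N. \<forall>n\<ge>N. (LINT x:\<Omega>|\<nu>. Q (- (\<epsilon>0 / real (Suc n))) x) / - (\<epsilon>0 / real (Suc n)) \<le> 0"
      using \<epsilon>0 pos[of "- (\<epsilon>0 / real (Suc n))" for n] b1 by (auto intro!: divide_nonneg_nonpos)
  qed (use b1 \<epsilon>0 in auto)
  ultimately show ?thesis unfolding q_def by simp
qed

text \<open>The components \<open>\<xi> \<bullet> e\<close> with respect to the axes \<open>e\<close> are admissible in the directional statement, and both sides are linear in \<open>\<xi>\<close>.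
  The gradient of a component is expressed by the adjoint of the derivative of \<open>\<xi>\<close>.\<close>

lemma jko_euler_lagrange:
  fixes \<Omega> :: "'a::euclidean_space set" and \<xi> :: "'a \<Rightarrow> 'a" and D :: "'a \<Rightarrow> 'a \<Rightarrow>\<^sub>L 'a"
  assumes \<Omega>: "compact \<Omega>" and V: "C1_closure \<Omega> V gradV" and h: "h > 0"
    and step: "jko_step \<Omega> V h \<mu> \<nu>" and \<mu>: "\<mu> \<in> prob_on \<Omega>" and \<nu>: "\<nu> \<in> prob_on \<Omega>"
    and fin: "energy \<Omega> V \<nu> < \<infinity>" and S: "optimal_map \<Omega> \<nu> \<mu> S"
    and \<xi>: "\<And>x. (\<xi> has_derivative blinfun_apply (D x)) (at x)" and Dc: "continuous_on UNIV D"
    and K: "compact K" "K \<subseteq> interior \<Omega>" and supp: "\<And>x. x \<notin> K \<Longrightarrow> \<xi> x = 0"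
  shows "(LINT x:\<Omega>|\<nu>. \<xi> x \<bullet> ((x - S x) /\<^sub>R h))
    = (LINT x:\<Omega>|\<nu>. (\<Sum>b\<in>Basis. blinfun_apply (D x) b \<bullet> b)) - (LINT x:\<Omega>|\<nu>. \<xi> x \<bullet> gradV x)"
proof -
  have cl: "closed \<Omega>" and O[measurable]: "\<Omega> \<in> sets borel"
    using \<Omega> by (auto intro: compact_imp_closed borel_compact)
  interpret \<nu>: prob_space \<nu> using prob_onD[OF \<nu>] by simp
  note s = prob_onD(2)[OF \<nu>]
  note [measurable_cong] = s
  have gVc: "continuous_on \<Omega> gradV" using V by (simp add: C1_closure_def)
  have \<xi>c: "continuous_on UNIV \<xi>"
    using \<xi> by (auto intro!: continuous_at_imp_continuous_on has_derivative_continuous)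
  have [measurable]: "\<xi> \<in> borel_measurable borel" by (intro borel_measurable_continuous_onI \<xi>c)
  have [measurable]: "S \<in> borel_measurable borel" using S by (simp add: optimal_map_def)
  have Dbc: "continuous_on X (\<lambda>x. blinfun_apply (D x) b)" for b X
    using continuous_on_subset[OF Dc] by (intro continuous_intros) auto
  have \<xi>cX: "continuous_on X \<xi>" for X using continuous_on_subset[OF \<xi>c] by simp
  obtain B where B: "B > 0" "\<And>x. x \<in> \<Omega> \<Longrightarrow> norm (\<xi> x) \<le> B"
    using continuous_bounded_on_compact[OF \<Omega> \<xi>cX] by blast
  obtain M where M: "M > 0" "\<And>x. x \<in> \<Omega> \<Longrightarrow> norm x \<le> M"
    using continuous_bounded_on_compact[OF \<Omega> continuous_on_id[of \<Omega>]] by blast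
  have int_v: "set_integrable \<nu> \<Omega> (\<lambda>x. (\<xi> x \<bullet> e) * (e \<bullet> (x - S x)) / h)" if e: "e \<in> Basis" for e
    unfolding set_integrable_def
  proof (rule \<nu>.integrable_const_bound)
    show "AE x in \<nu>. norm (indicat_real \<Omega> x *\<^sub>R ((\<xi> x \<bullet> e) * (e \<bullet> (x - S x)) / h)) \<le> B * (2 * M) / h"
      using optimal_map_AE[OF cl S \<nu> \<mu>]
    proof eventually_elim
      case (elim x)
      have "\<bar>\<xi> x \<bullet> e\<bar> \<le> B" using B(2)[of x] elim Basis_le_norm[OF e, of "\<xi> x"] by linarith
      moreover have "\<bar>e \<bullet> (x - S x)\<bar> \<le> 2 * M"
        using M(2)[of x] M(2)[of "S x"] elim Basis_le_norm[OF e, of "x - S x"] norm_triangle_ineq4[of x "S x"]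
        by (auto simp: inner_commute)
      ultimately have "\<bar>\<xi> x \<bullet> e\<bar> * \<bar>e \<bullet> (x - S x)\<bar> \<le> B * (2 * M)" using B by (intro mult_mono) auto
      then show ?case using h elim by (simp add: abs_mult divide_right_mono)
    qed
  qed measurable
  have int_d: "set_integrable \<nu> \<Omega> (\<lambda>x. blinfun_apply (D x) e \<bullet> e)"
    and int_V: "set_integrable \<nu> \<Omega> (\<lambda>x. (\<xi> x \<bullet> e) * (gradV x \<bullet> e))" for e
    by (rule set_integrable_continuous_compact[OF \<nu>.finite_measure_axioms s \<Omega>]; intro continuous_intros Dbc \<xi>cX gVc)+
  have dir: "(LINT x:\<Omega>|\<nu>. (\<xi> x \<bullet> e) * (e \<bullet> (x - S x)) / h - blinfun_apply (D x) e \<bullet> e + (\<xi> x \<bullet> e) * (gradV x \<bullet> e)) = 0"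
    if e: "e \<in> Basis" for e
  proof -
    \<comment> \<open>The adjoint of the derivative applied to \<open>e\<close>, that is, the gradient of the component \<open>\<xi> \<bullet> e\<close>.\<close>
    define G where "G x = (\<Sum>c\<in>Basis. (blinfun_apply (D x) c \<bullet> e) *\<^sub>R c)" for x
    have Gin: "k \<bullet> G x = blinfun_apply (D x) k \<bullet> e" for x k
    proof -
      have "blinfun_apply (D x) k = (\<Sum>c\<in>Basis. (k \<bullet> c) *\<^sub>R blinfun_apply (D x) c)"
        by (subst euclidean_representation[of k, symmetric]) (simp add: blinfun.sum_right blinfun.scaleR_right)
      then show ?thesis by (simp add: G_def inner_sum_right inner_sum_left mult.commute)
    qed
    have "(LINT x:\<Omega>|\<nu>. (\<xi> x \<bullet> e) * (e \<bullet> (x - S x)) / h - G x \<bullet> e + (\<xi> x \<bullet> e) * (gradV x \<bullet> e)) = 0"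
    proof (rule jko_first_variation_direction[OF \<Omega> V h step \<mu> \<nu> fin S e _ _ K])
      show "GDERIV (\<lambda>x. \<xi> x \<bullet> e) x :> G x" for x
        unfolding gderiv_def Gin by (rule has_derivative_inner_left[OF \<xi>])
      show "continuous_on UNIV G" unfolding G_def by (intro continuous_intros Dbc)
    qed (simp add: supp)
    then show ?thesis using Gin[of e] by (simp add: inner_commute)
  qed
  have "0 = (\<Sum>e\<in>Basis. (LINT x:\<Omega>|\<nu>. (\<xi> x \<bullet> e) * (e \<bullet> (x - S x)) / h - blinfun_apply (D x) e \<bullet> e + (\<xi> x \<bullet> e) * (gradV x \<bullet> e)))"
    using dir by simp
  also have "\<dots> = (\<Sum>e\<in>Basis. (LINT x:\<Omega>|\<nu>. (\<xi> x \<bullet> e) * (e \<bullet> (x - S x)) / h) - (LINT x:\<Omega>|\<nu>. blinfun_apply (D x) e \<bullet> e)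
     + (LINT x:\<Omega>|\<nu>. (\<xi> x \<bullet> e) * (gradV x \<bullet> e)))"
    by (rule sum.cong[OF refl])
      (simp add: set_integral_add set_integral_diff int_v int_d int_V)
  also have "\<dots> = (LINT x:\<Omega>|\<nu>. (\<Sum>e\<in>Basis. (\<xi> x \<bullet> e) * (e \<bullet> (x - S x)) / h)) - (LINT x:\<Omega>|\<nu>. (\<Sum>e\<in>Basis. blinfun_apply (D x) e \<bullet> e))
     + (LINT x:\<Omega>|\<nu>. (\<Sum>e\<in>Basis. (\<xi> x \<bullet> e) * (gradV x \<bullet> e)))"
    using int_v int_d int_V unfolding set_lebesgue_integral_def set_integrable_def real_scaleR_def sum_distrib_left
    by (subst (1 2 3) Bochner_Integration.integral_sum) (auto simp: sum.distrib sum_subtractf)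
  also have "(\<lambda>x. \<Sum>e\<in>Basis. (\<xi> x \<bullet> e) * (e \<bullet> (x - S x)) / h) = (\<lambda>x. \<xi> x \<bullet> ((x - S x) /\<^sub>R h))"
  proof
    fix x
    show "(\<Sum>e\<in>Basis. (\<xi> x \<bullet> e) * (e \<bullet> (x - S x)) / h) = \<xi> x \<bullet> ((x - S x) /\<^sub>R h)"
      by (subst euclidean_inner[of "\<xi> x"]) (auto simp: inner_commute sum_distrib_left divide_inverse ac_simps intro!: sum.cong)
  qed
  also have "(\<lambda>x. \<Sum>e\<in>Basis. (\<xi> x \<bullet> e) * (gradV x \<bullet> e)) = (\<lambda>x. \<xi> x \<bullet> gradV x)"
    by (simp add: euclidean_inner[symmetric])
  finally show ?thesis by linarith
qed

section \<open>Extension of test functions by zero\<close>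

text \<open>Test functions are prescribed on a set \<open>X \<inter> O'\<close> that is relatively open in \<open>X\<close>. Extension by zero is harmless because
  near every point either the function itself or the constant \<open>0\<close> is seen.\<close>

lemma zero_extension_continuous:
  fixes g :: "'b::metric_space \<Rightarrow> 'c::real_normed_vector"
  assumes O: "open O'" and K: "compact K" and g: "continuous_on (X \<inter> O') g"
    and z: "\<And>x. x \<in> X \<inter> O' - K \<Longrightarrow> g x = 0" and KO: "K \<subseteq> O'"
  shows "continuous_on X (\<lambda>x. if x \<in> X \<inter> O' then g x else 0)"
  unfolding continuous_on_def
proof
  fix x assume x: "x \<in> X"
  let ?f = "\<lambda>x. if x \<in> X \<inter> O' then g x else 0"
  show "(?f \<longlongrightarrow> ?f x) (at x within X)"
  proof (cases "x \<in> O'")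
    case True
    have "(g \<longlongrightarrow> g x) (at x within X \<inter> O')" using g x True by (simp add: continuous_on_def)
    then have "(?f \<longlongrightarrow> g x) (at x within X \<inter> O')"
      by (rule Lim_transform_eventually) (auto simp: eventually_at_filter intro!: always_eventually)
    moreover have "at x within X \<inter> O' = at x within X"
      by (rule at_within_nhd[OF True O]) auto
    ultimately show ?thesis using x True by simp
  next
    case False
    then have "x \<in> - K" "open (- K)" using KO compact_imp_closed[OF K] by auto
    then have "eventually (\<lambda>y. y \<in> - K) (at x within X)" by (rule eventually_at_in_open'[THEN filter_leD[OF at_le[OF subset_UNIV]], rotated])
    then have "eventually (\<lambda>y. 0 = ?f y) (at x within X)" by eventually_elim (use z in auto)
    then show ?thesis using False by (auto intro: Lim_transform_eventually[OF tendsto_const])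
  qed
qed

lemma zero_extension_has_derivative:
  fixes f :: "'b::real_normed_vector \<Rightarrow> 'c::real_normed_vector" and D :: "'b \<Rightarrow> 'b \<Rightarrow> 'c"
  assumes A: "open A" and K: "compact K" "K \<subseteq> A" and d: "\<And>z. z \<in> A \<Longrightarrow> (f has_derivative D z) (at z)"
    and z: "\<And>x. x \<in> A - K \<Longrightarrow> f x = 0"
  shows "((\<lambda>x. if x \<in> A then f x else 0) has_derivative (if z \<in> A then D z else (\<lambda>_. 0))) (at z)"
    and "z \<in> A - K \<Longrightarrow> D z = (\<lambda>_. 0)"
proof -
  have oK: "open (- K)" using compact_imp_closed[OF K(1)] by auto
  have zero: "((\<lambda>x. if x \<in> A then f x else 0) has_derivative (\<lambda>_. 0)) (at z)" if "z \<notin> K" for z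
    by (rule has_derivative_transform_within_open[OF has_derivative_const oK]) (use that z in auto)
  have inA: "((\<lambda>x. if x \<in> A then f x else 0) has_derivative D z) (at z)" if "z \<in> A" for z
    by (rule has_derivative_transform_within_open[OF d[OF that] A that]) auto
  show "((\<lambda>x. if x \<in> A then f x else 0) has_derivative (if z \<in> A then D z else (\<lambda>_. 0))) (at z)"
    using zero[of z] inA[of z] K by auto
  show "z \<in> A - K \<Longrightarrow> D z = (\<lambda>_. 0)"
    using has_derivative_unique[OF inA zero] by auto
qed

lemma C1_field_zero_extension:
  fixes f :: "'b::euclidean_space \<Rightarrow> 'c::euclidean_space"
  assumes A: "open A" and f: "C1_field A f D" and K: "compact K" "K \<subseteq> A" "\<forall>z\<in>A - K. f z = 0"
  defines "f0 \<equiv> \<lambda>z. if z \<in> A then f z else 0" and "D0 \<equiv> \<lambda>z. if z \<in> A then D z else 0"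
  shows "(f0 has_derivative blinfun_apply (D0 z)) (at z)" "continuous_on UNIV D0"
    "z \<notin> K \<Longrightarrow> f0 z = 0" "z \<notin> K \<Longrightarrow> D0 z = 0"
proof -
  obtain W where W: "open W" "A \<subseteq> W" "continuous_on W D" "\<And>z. z \<in> W \<Longrightarrow> (f has_derivative blinfun_apply (D z)) (at z)"
    using f by (auto simp: C1_field_def)
  have d: "(f has_derivative blinfun_apply (D z)) (at z)" if "z \<in> A" for z using W that by blast
  note ze = zero_extension_has_derivative[OF A K(1,2) d bspec[OF K(3)]]
  have D0: "D z = 0" if "z \<in> A - K" for z
    using ze(2)[OF _ _ that] by (auto intro!: blinfun_eqI)
  have "blinfun_apply (D0 z) = (if z \<in> A then blinfun_apply (D z) else (\<lambda>_. 0))" by (auto simp: D0_def fun_eq_iff)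
  then show "(f0 has_derivative blinfun_apply (D0 z)) (at z)" using ze(1)[of z] by (simp add: f0_def)
  show "continuous_on UNIV D0"
    using zero_extension_continuous[OF A K(1) _ _ K(2), of UNIV D] continuous_on_subset[OF W(3,2)] D0
    by (simp add: D0_def)
  show "z \<notin> K \<Longrightarrow> f0 z = 0" "z \<notin> K \<Longrightarrow> D0 z = 0" using K D0 by (auto simp: f0_def D0_def)
qed

lemma C1_scalar_zero_extension:
  fixes \<phi> :: "'b::euclidean_space \<Rightarrow> real"
  assumes A: "open A" and f: "C1_scalar A \<phi> G" and K: "compact K" "K \<subseteq> A" "\<forall>z\<in>A - K. \<phi> z = 0"
  defines "\<phi>0 \<equiv> \<lambda>z. if z \<in> A then \<phi> z else 0" and "G0 \<equiv> \<lambda>z. if z \<in> A then G z else 0"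
  shows "GDERIV \<phi>0 z :> G0 z" "continuous_on UNIV G0"
    "z \<notin> K \<Longrightarrow> \<phi>0 z = 0" "z \<notin> K \<Longrightarrow> G0 z = 0"
proof -
  obtain W where W: "open W" "A \<subseteq> W" "continuous_on W G" "\<And>z. z \<in> W \<Longrightarrow> GDERIV \<phi> z :> G z"
    using f by (auto simp: C1_scalar_def)
  have d: "(\<phi> has_derivative (\<lambda>k. k \<bullet> G z)) (at z)" if "z \<in> A" for z using W that unfolding gderiv_def by blast
  note ze = zero_extension_has_derivative[OF A K(1,2) d bspec[OF K(3)]]
  have G0: "G z = 0" if "z \<in> A - K" for z
  proof -
    have "G z \<bullet> G z = 0" using fun_cong[OF ze(2)[OF _ _ that], of "G z"] by simp
    then show ?thesis by simp
  qed
  have "(\<lambda>k. k \<bullet> G0 z) = (if z \<in> A then (\<lambda>k. k \<bullet> G z) else (\<lambda>_. 0))" by (auto simp: G0_def fun_eq_iff)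
  then show "GDERIV \<phi>0 z :> G0 z" using ze(1)[of z] by (simp add: \<phi>0_def gderiv_def)
  show "continuous_on UNIV G0"
    using zero_extension_continuous[OF A K(1) _ _ K(2), of UNIV G] continuous_on_subset[OF W(3,2)] G0
    by (simp add: G0_def)
  show "z \<notin> K \<Longrightarrow> \<phi>0 z = 0" "z \<notin> K \<Longrightarrow> G0 z = 0" using K G0 by (auto simp: \<phi>0_def G0_def)
qed

text \<open>On a set that is not open, the vanishing of \<open>\<phi>\<close> says nothing about \<open>G\<close> at boundary points directly. It does
  so in the interior, which is dense, and \<open>G\<close> is continuous across the boundary.\<close>

lemma C1_scalar_gradient_vanishes:
  fixes \<phi> :: "'b::euclidean_space \<Rightarrow> real"
  assumes f: "C1_scalar A \<phi> G" and K: "compact K" "\<And>z. z \<in> A - K \<Longrightarrow> \<phi> z = 0"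
    and dense: "A \<subseteq> closure (interior A)" and z: "z \<in> A - K"
  shows "G z = 0"
proof (rule ccontr)
  assume nz: "G z \<noteq> 0"
  obtain W where W: "open W" "A \<subseteq> W" "continuous_on W G" "\<And>z. z \<in> W \<Longrightarrow> GDERIV \<phi> z :> G z"
    using f by (auto simp: C1_scalar_def)
  have oK: "open (- K)" using compact_imp_closed[OF K(1)] by auto
  have "open (W \<inter> G -` (- {0}))"
    by (rule continuous_open_preimage[OF W(3,1)]) auto
  then have "open (W \<inter> G -` (- {0}) \<inter> - K)" using oK by (rule open_Int)
  moreover have "z \<in> W \<inter> G -` (- {0}) \<inter> - K" using z W(2) nz by auto
  moreover have "z \<in> closure (interior A)" using z dense by auto
  ultimately obtain y where y: "y \<in> interior A" "y \<in> W" "G y \<noteq> 0" "y \<notin> K"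
    using open_Int_closure_eq_empty[of "W \<inter> G -` (- {0}) \<inter> - K" "interior A"] by blast
  have "G y = 0"
  proof (rule GDERIV_locally_zero[OF W(4)[OF y(2)]])
    show "open (interior A \<inter> - K)" using oK by (intro open_Int) auto
    show "\<phi> x = 0" if "x \<in> interior A \<inter> - K" for x using K(2)[of x] that interior_subset[of A] by auto
  qed (use y in auto)
  with y show False by simp
qed

text \<open>The set \<open>X\<close> need not be convex, so that the segment between two of its points may leave it. Close
  points, one of which lies in \<open>K\<close>, are joined inside a small ball around that point, on which \<open>\<phi>\<close> is \<open>C\<^sup>1\<close>; this
  uses the uniform continuity of \<open>G\<close> on the neighbourhood \<open>K'\<close> of \<open>K\<close>. For distant points every term is dominated
  by the square of the distance.\<close>

lemma C1_scalar_zero_extension_taylor: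
  fixes \<phi> :: "'b::euclidean_space \<Rightarrow> real"
  assumes f: "C1_scalar (X \<inter> O') \<phi> G" and O: "open O'"
    and K: "compact K" "K \<subseteq> X \<inter> O'" "\<And>z. z \<in> X \<inter> O' - K \<Longrightarrow> \<phi> z = 0" "\<And>z. z \<in> X \<inter> O' - K \<Longrightarrow> G z = 0"
    and \<eta>: "\<eta> > 0"
  defines "\<phi>0 \<equiv> \<lambda>z. if z \<in> X \<inter> O' then \<phi> z else 0" and "G0 \<equiv> \<lambda>z. if z \<in> X \<inter> O' then G z else 0"
  obtains C where "C \<ge> 0"
    "\<And>z z'. z \<in> X \<Longrightarrow> z' \<in> X \<Longrightarrow> \<bar>\<phi>0 z' - \<phi>0 z - (z' - z) \<bullet> G0 z\<bar> \<le> \<eta> * norm (z' - z) + C * (norm (z' - z))\<^sup>2"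
proof -
  obtain W where W: "open W" "X \<inter> O' \<subseteq> W" "continuous_on W G" "\<And>z. z \<in> W \<Longrightarrow> GDERIV \<phi> z :> G z"
    using f by (auto simp: C1_scalar_def)
  have oWO: "open (W \<inter> O')" using W(1) O by blast
  have KWO: "K \<subseteq> W \<inter> O'" using K W by blast
  obtain r where r: "r > 0" "(\<Union>x\<in>K. cball x r) \<subseteq> W \<inter> O'"
    using compact_subset_open_imp_cball_epsilon_subset[OF K(1) oWO KWO] by blast
  \<comment> \<open>The closed \<open>r\<close>-neighbourhood of \<open>K\<close>, written as a sum of compact sets.\<close>
  define K' where "K' = (\<Union>x\<in>K. \<Union>y\<in>cball 0 r. {x + y})"
  have K'c: "compact K'" unfolding K'_def by (rule compact_sums'[OF K(1) compact_cball])
  have ball_K': "cball x r \<subseteq> K'" if "x \<in> K" for x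
  proof
    fix y assume "y \<in> cball x r"
    then have "y - x \<in> cball 0 r" "y = x + (y - x)" by (auto simp: dist_norm norm_minus_commute)
    then show "y \<in> K'" using that unfolding K'_def by blast
  qed
  have K'W: "K' \<subseteq> W \<inter> O'"
  proof
    fix z assume "z \<in> K'"
    then obtain x y where "x \<in> K" "norm y \<le> r" "z = x + y" by (auto simp: K'_def)
    then have "z \<in> cball x r" by (simp add: dist_norm)
    then show "z \<in> W \<inter> O'" using r(2) \<open>x \<in> K\<close> by blast
  qed
  have Gc: "continuous_on K' G" using continuous_on_subset[OF W(3)] K'W by blast
  obtain d where d: "d > 0" "\<And>x y. x \<in> K' \<Longrightarrow> y \<in> K' \<Longrightarrow> dist y x < d \<Longrightarrow> dist (G y) (G x) < \<eta>"
    using compact_uniformly_continuous[OF Gc K'c] \<eta> by (metis uniformly_continuous_onE)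
  define \<delta> where "\<delta> = min d r"
  have \<delta>: "\<delta> > 0" "\<delta> \<le> d" "\<delta> \<le> r" using d r by (auto simp: \<delta>_def)
  have \<phi>c: "continuous_on K \<phi>"
  proof (intro continuous_at_imp_continuous_on ballI)
    fix x assume "x \<in> K"
    then have "(\<phi> has_derivative (\<lambda>k. k \<bullet> G x)) (at x)" using W(4)[of x] KWO by (auto simp: gderiv_def)
    then show "isCont \<phi> x" by (rule has_derivative_continuous)
  qed
  have GKc: "continuous_on K G" using continuous_on_subset[OF W(3)] KWO by blast
  obtain B1 where B1: "B1 > 0" "\<And>x. x \<in> K \<Longrightarrow> norm (\<phi> x) \<le> B1"
    using continuous_bounded_on_compact[OF K(1) \<phi>c] by blast
  obtain B2 where B2: "B2 > 0" "\<And>x. x \<in> K \<Longrightarrow> norm (G x) \<le> B2"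
    using continuous_bounded_on_compact[OF K(1) GKc] by blast
  have b1: "\<bar>\<phi>0 z\<bar> \<le> B1" for z using B1 K(3)[of z] by (cases "z \<in> K") (auto simp: \<phi>0_def)
  have b2: "norm (G0 z) \<le> B2" for z using B2 K(4)[of z] by (cases "z \<in> K") (auto simp: G0_def)
  show ?thesis
  proof (rule that[of "2 * B1 / \<delta>\<^sup>2 + B2 / \<delta>"])
    show "0 \<le> 2 * B1 / \<delta>\<^sup>2 + B2 / \<delta>" using B1 B2 \<delta> by simp
    then have Cnn: "0 \<le> (2 * B1 / \<delta>\<^sup>2 + B2 / \<delta>) * (norm (z' - z))\<^sup>2" for z' z :: 'b by simp
    fix z z' assume zX: "z \<in> X" "z' \<in> X"
    show "\<bar>\<phi>0 z' - \<phi>0 z - (z' - z) \<bullet> G0 z\<bar> \<le> \<eta> * norm (z' - z) + (2 * B1 / \<delta>\<^sup>2 + B2 / \<delta>) * (norm (z' - z))\<^sup>2"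
    proof (cases "norm (z' - z) < \<delta>")
      case near: True
      have key: "\<bar>\<phi>0 z' - \<phi>0 z - (z' - z) \<bullet> G0 z\<bar> \<le> \<eta> * norm (z' - z)"
        if p: "p \<in> K" "z \<in> cball p r" "z' \<in> cball p r" for p
      proof -
        have cb: "cball p r \<subseteq> W \<inter> O'" using r(2) p(1) by blast
        then have zz: "z \<in> X \<inter> O'" "z' \<in> X \<inter> O'" using p zX by auto
        let ?S = "closed_segment z z'"
        have sub: "?S \<subseteq> cball p r" using p by (intro closed_segment_subset) auto
        have "norm (\<phi> z' - \<phi> z - (z' - z) \<bullet> G z) \<le> norm (z' - z) * \<eta>"
        proof (rule differentiable_bound_linearization[where S = ?S and f' = "\<lambda>y k. k \<bullet> G y"])
          show "z + t *\<^sub>R (z' - z) \<in> ?S" if "t \<in> {0..1}" for t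
            using that by (auto simp: closed_segment_def algebra_simps intro!: exI[of _ t])
          show "(\<phi> has_derivative (\<lambda>k. k \<bullet> G x)) (at x within ?S)" if "x \<in> ?S" for x
          proof -
            have "x \<in> W" using sub cb that by blast
            then show ?thesis using W(4)[of x] by (simp add: gderiv_def has_derivative_at_withinI)
          qed
          show "onorm ((\<lambda>k. k \<bullet> G x) - (\<lambda>k. k \<bullet> G z)) \<le> \<eta>" if "x \<in> ?S" for x
          proof (rule onorm_le)
            fix k :: 'b
            have "dist x z < d" using segment_bound(1)[OF that] near \<delta>(2)
              by (simp add: dist_norm norm_minus_commute)
            moreover have "x \<in> K'" "z \<in> K'" using sub that ball_K'[OF p(1)] p(2) by blast+
            ultimately have "norm (G x - G z) \<le> \<eta>" using d(2) by (force simp: dist_norm)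
            then have "norm k * norm (G x - G z) \<le> norm k * \<eta>" by (intro mult_left_mono) auto
            then have "norm (k \<bullet> (G x - G z)) \<le> \<eta> * norm k"
              using Cauchy_Schwarz_ineq2[of k "G x - G z"] by (simp add: mult.commute)
            then show "norm (((\<lambda>k. k \<bullet> G x) - (\<lambda>k. k \<bullet> G z)) k) \<le> \<eta> * norm k" by (simp add: inner_diff_right)
          qed
        qed auto
        then show ?thesis using zz by (simp add: \<phi>0_def G0_def mult.commute)
      qed
      have "\<bar>\<phi>0 z' - \<phi>0 z - (z' - z) \<bullet> G0 z\<bar> \<le> \<eta> * norm (z' - z)"
      proof (cases "z \<in> K \<or> z' \<in> K")
        case True
        then show ?thesis using key[of z] key[of z'] near \<delta>(3) r(1) by (auto simp: dist_norm norm_minus_commute)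
      next
        case False
        then have "\<phi>0 z = 0" "\<phi>0 z' = 0" "G0 z = 0" using K(3,4) by (auto simp: \<phi>0_def G0_def)
        then show ?thesis using \<eta> by simp
      qed
      then show ?thesis using Cnn[of z' z] by linarith
    next
      case False
      let ?n = "norm (z' - z)"
      have n: "\<delta> \<le> ?n" using False by simp
      have "\<bar>\<phi>0 z' - \<phi>0 z - (z' - z) \<bullet> G0 z\<bar> \<le> 2 * B1 + B2 * ?n"
      proof -
        have "\<bar>(z' - z) \<bullet> G0 z\<bar> \<le> ?n * B2"
          using Cauchy_Schwarz_ineq2[of "z' - z" "G0 z"] mult_left_mono[OF b2[of z], of ?n] by simp
        then show ?thesis using b1[of z] b1[of z'] by (simp add: mult.commute)
      qed
      moreover have "2 * B1 \<le> 2 * B1 / \<delta>\<^sup>2 * ?n\<^sup>2"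
      proof -
        have "\<delta>\<^sup>2 \<le> ?n\<^sup>2" using n \<delta>(1) by (intro power_mono) auto
        then show ?thesis using B1(1) \<delta>(1) by (simp add: field_simps)
      qed
      moreover have "B2 * ?n \<le> B2 / \<delta> * ?n\<^sup>2"
      proof -
        have "\<delta> * ?n \<le> ?n\<^sup>2" using n by (simp add: power2_eq_square mult_right_mono)
        then have "B2 * (\<delta> * ?n) \<le> B2 * ?n\<^sup>2" using B2(1) by (intro mult_left_mono) auto
        then show ?thesis using \<delta>(1) by (simp add: field_simps)
      qed
      moreover have "0 \<le> \<eta> * ?n" using \<eta> by simp
      ultimately show ?thesis by (simp add: distrib_right)
    qed
  qed
qed

section \<open>Consistency of a transport step and integrals of step functions\<close>

text \<open>Integrating the Taylor estimate along the transport rays: \<open>f x - f (S x)\<close> integrates to the difference of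
  the two measures, and the linear error is split by \<open>n \<le> h / 2 + n\<^sup>2 / (2 h)\<close> so that only the transport cost remains.\<close>

lemma transport_taylor_error:
  fixes \<Omega> :: "'a::euclidean_space set"
  assumes \<Omega>: "compact \<Omega>" and S: "optimal_map \<Omega> \<nu> \<mu> S" and \<mu>: "\<mu> \<in> prob_on \<Omega>" and \<nu>: "\<nu> \<in> prob_on \<Omega>"
    and f: "continuous_on \<Omega> f" and g: "continuous_on \<Omega> g" and h: "h > 0" and C: "C \<ge> 0" and \<eta>: "\<eta> \<ge> 0"
    and taylor: "\<And>x y. x \<in> \<Omega> \<Longrightarrow> y \<in> \<Omega> \<Longrightarrow> \<bar>f y - f x - (y - x) \<bullet> g x\<bar> \<le> \<eta> * norm (y - x) + C * (norm (y - x))\<^sup>2"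
  shows "\<bar>(LINT x:\<Omega>|\<nu>. g x \<bullet> ((x - S x) /\<^sub>R h)) - ((LINT x:\<Omega>|\<nu>. f x) - (LINT x:\<Omega>|\<mu>. f x)) / h\<bar>
    \<le> \<eta> / 2 + (\<eta> / (2 * h\<^sup>2) + C / h) * (W2 \<Omega> \<nu> \<mu>)\<^sup>2"
proof -
  have cl: "closed \<Omega>" and O[measurable]: "\<Omega> \<in> sets borel"
    using \<Omega> by (auto intro: compact_imp_closed borel_compact)
  interpret \<nu>: prob_space \<nu> using prob_onD[OF \<nu>] by simp
  note s = prob_onD(2)[OF \<nu>]
  note [measurable_cong] = s
  have Sm[measurable]: "S \<in> borel_measurable borel" and Sd: "distr \<nu> borel S = \<mu>"
    and Sopt: "(LINT x:\<Omega>|\<nu>. (norm (x - S x))\<^sup>2) = (W2 \<Omega> \<nu> \<mu>)\<^sup>2"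
    using S by (auto simp: optimal_map_def)
  note AES = optimal_map_AE[OF cl S \<nu> \<mu>]
  have fm[measurable]: "(\<lambda>x. indicat_real \<Omega> x * f x) \<in> borel_measurable borel"
    by (rule continuous_on_indicator_measurable[OF O f])
  have gm[measurable]: "(\<lambda>x. indicat_real \<Omega> x *\<^sub>R g x) \<in> borel_measurable borel"
    by (rule borel_measurable_continuous_on_indicator[OF O g])
  obtain Bf where Bf: "Bf > 0" "\<And>x. x \<in> \<Omega> \<Longrightarrow> norm (f x) \<le> Bf"
    using continuous_bounded_on_compact[OF \<Omega> f] by blast
  obtain Bg where Bg: "Bg > 0" "\<And>x. x \<in> \<Omega> \<Longrightarrow> norm (g x) \<le> Bg"
    using continuous_bounded_on_compact[OF \<Omega> g] by blast
  obtain M where M: "M > 0" "\<And>x. x \<in> \<Omega> \<Longrightarrow> norm x \<le> M"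
    using continuous_bounded_on_compact[OF \<Omega> continuous_on_id[of \<Omega>]] by blast
  have dist_M: "norm (x - y) \<le> 2 * M" if "x \<in> \<Omega>" "y \<in> \<Omega>" for x y
    using M(2)[OF that(1)] M(2)[OF that(2)] norm_triangle_ineq4[of x y] by linarith
  let ?F = "\<lambda>x. indicat_real \<Omega> x * f x" and ?G = "\<lambda>x. indicat_real \<Omega> x *\<^sub>R g x"
  have iF: "integrable \<nu> ?F"
  proof (rule \<nu>.integrable_const_bound[of _ Bf])
    show "AE x in \<nu>. norm (?F x) \<le> Bf" using Bf by (auto simp: indicator_def)
  qed measurable
  have iFS: "integrable \<nu> (\<lambda>x. ?F (S x))"
  proof (rule \<nu>.integrable_const_bound[of _ Bf])
    show "AE x in \<nu>. norm (?F (S x)) \<le> Bf" using Bf by (auto simp: indicator_def)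
    show "(\<lambda>x. ?F (S x)) \<in> borel_measurable \<nu>" using measurable_compose[OF Sm fm] by (simp add: measurable_cong_sets[OF s refl])
  qed
  have iG: "integrable \<nu> (\<lambda>x. ?G x \<bullet> (x - S x))"
  proof (rule \<nu>.integrable_const_bound)
    show "AE x in \<nu>. norm (?G x \<bullet> (x - S x)) \<le> Bg * (2 * M)"
      using AES
    proof eventually_elim
      case (elim x)
      have "\<bar>?G x \<bullet> (x - S x)\<bar> \<le> norm (?G x) * norm (x - S x)" by (rule Cauchy_Schwarz_ineq2)
      also have "\<dots> \<le> Bg * (2 * M)" using elim Bg dist_M by (intro mult_mono) auto
      finally show ?case by simp
    qed
  qed measurable
  have iN: "integrable \<nu> (\<lambda>x. (norm (x - S x))\<^sup>2)"
  proof (rule \<nu>.integrable_const_bound)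
    show "AE x in \<nu>. norm ((norm (x - S x))\<^sup>2) \<le> (2 * M)\<^sup>2"
      using AES
    proof eventually_elim
      case (elim x)
      then show ?case using power_mono[OF dist_M[of x "S x"], of 2] by simp
    qed
  qed measurable
  have eN: "(LINT x|\<nu>. (norm (x - S x))\<^sup>2) = (W2 \<Omega> \<nu> \<mu>)\<^sup>2"
    unfolding Sopt[symmetric] by (rule set_integral_prob_on[OF \<nu> O, symmetric]) measurable
  have e1: "(LINT x:\<Omega>|\<nu>. g x \<bullet> ((x - S x) /\<^sub>R h)) = (LINT x|\<nu>. ?G x \<bullet> (x - S x)) / h"
    unfolding set_lebesgue_integral_def by (simp add: divide_inverse mult.commute[of "inverse h"] mult.assoc[symmetric])
  have e2: "(LINT x:\<Omega>|\<nu>. f x) = (LINT x|\<nu>. ?F x)" by (simp add: set_lebesgue_integral_def)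
  have e3: "(LINT x:\<Omega>|\<mu>. f x) = (LINT x|\<nu>. ?F (S x))"
    unfolding Sd[symmetric] set_lebesgue_integral_def real_scaleR_def
    by (rule integral_distr) (auto simp: measurable_cong_sets[OF s refl])
  have pt: "AE x in \<nu>. \<bar>?G x \<bullet> (x - S x) - (?F x - ?F (S x))\<bar> \<le> \<eta> * h / 2 + (\<eta> / (2 * h) + C) * (norm (x - S x))\<^sup>2"
    using AES
  proof eventually_elim
    case (elim x)
    let ?n = "norm (S x - x)"
    have "?G x \<bullet> (x - S x) - (?F x - ?F (S x)) = f (S x) - f x - (S x - x) \<bullet> g x"
      using elim by (simp add: inner_diff_left inner_diff_right inner_commute)
    then have "\<bar>?G x \<bullet> (x - S x) - (?F x - ?F (S x))\<bar> \<le> \<eta> * ?n + C * ?n\<^sup>2"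
      using taylor[of x "S x"] elim by simp
    moreover have "?n \<le> h / 2 + ?n\<^sup>2 / (2 * h)"
    proof -
      have "0 \<le> (?n - h)\<^sup>2 / (2 * h)" using h by simp
      also have "\<dots> = h / 2 + ?n\<^sup>2 / (2 * h) - ?n" using h by (simp add: field_simps power2_eq_square)
      finally show ?thesis by simp
    qed
    then have "\<eta> * ?n \<le> \<eta> * (h / 2 + ?n\<^sup>2 / (2 * h))" using \<eta> by (rule mult_left_mono)
    ultimately show ?case by (simp add: norm_minus_commute algebra_simps)
  qed
  have "\<bar>(LINT x|\<nu>. ?G x \<bullet> (x - S x)) - ((LINT x|\<nu>. ?F x) - (LINT x|\<nu>. ?F (S x)))\<bar>
     = \<bar>LINT x|\<nu>. ?G x \<bullet> (x - S x) - (?F x - ?F (S x))\<bar>"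
    using iG iF iFS by simp
  also have "\<dots> \<le> (LINT x|\<nu>. \<bar>?G x \<bullet> (x - S x) - (?F x - ?F (S x))\<bar>)"
    using integral_abs_bound[of \<nu>] by simp
  also have "\<dots> \<le> (LINT x|\<nu>. \<eta> * h / 2 + (\<eta> / (2 * h) + C) * (norm (x - S x))\<^sup>2)"
    by (rule integral_mono_AE) (use iG iF iFS iN pt in auto)
  also have "\<dots> = \<eta> * h / 2 + (\<eta> / (2 * h) + C) * (W2 \<Omega> \<nu> \<mu>)\<^sup>2"
    using iN by (simp add: \<nu>.prob_space eN)
  finally have main: "\<bar>(LINT x|\<nu>. ?G x \<bullet> (x - S x)) - ((LINT x|\<nu>. ?F x) - (LINT x|\<nu>. ?F (S x)))\<bar>
     \<le> \<eta> * h / 2 + (\<eta> / (2 * h) + C) * (W2 \<Omega> \<nu> \<mu>)\<^sup>2" .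
  have "\<bar>(LINT x:\<Omega>|\<nu>. g x \<bullet> ((x - S x) /\<^sub>R h)) - ((LINT x:\<Omega>|\<nu>. f x) - (LINT x:\<Omega>|\<mu>. f x)) / h\<bar>
     = \<bar>(LINT x|\<nu>. ?G x \<bullet> (x - S x)) - ((LINT x|\<nu>. ?F x) - (LINT x|\<nu>. ?F (S x)))\<bar> / h"
    unfolding e1 e2 e3 using h by (simp add: diff_divide_distrib[symmetric] abs_divide)
  also have "\<dots> \<le> (\<eta> * h / 2 + (\<eta> / (2 * h) + C) * (W2 \<Omega> \<nu> \<mu>)\<^sup>2) / h"
    using main h by (intro divide_right_mono) auto
  also have "\<dots> = \<eta> / 2 + (\<eta> / (2 * h\<^sup>2) + C / h) * (W2 \<Omega> \<nu> \<mu>)\<^sup>2"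
    using h by (simp add: field_simps power2_eq_square)
  finally show ?thesis .
qed

lemma nat_ceiling_divide_measurable[measurable]: "(\<lambda>t::real. nat \<lceil>t / h\<rceil>) \<in> borel \<rightarrow>\<^sub>M count_space UNIV"
  by measurable

text \<open>For \<open>t > 0\<close> the natural number \<open>nat \<lceil>t / h\<rceil> - 1\<close> is the index of the cell \<open>(k h, (k + 1) h]\<close> that contains \<open>t\<close>.\<close>

lemma grid_cell_iff:
  fixes t h :: real
  assumes "h > 0" "t > 0"
  shows "nat \<lceil>t / h\<rceil> - 1 = k \<longleftrightarrow> t \<in> {real k * h<..real (Suc k) * h}"
proof -
  have "1 \<le> \<lceil>t / h\<rceil>" using assms by (simp add: le_ceiling_iff)
  then have "nat \<lceil>t / h\<rceil> - 1 = k \<longleftrightarrow> \<lceil>t / h\<rceil> = int k + 1" by linarith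
  also have "\<dots> \<longleftrightarrow> real k < t / h \<and> t / h \<le> real k + 1" by (simp add: ceiling_eq_iff)
  also have "\<dots> \<longleftrightarrow> t \<in> {real k * h<..real (Suc k) * h}" using assms by (simp add: field_simps)
  finally show ?thesis .
qed

lemma step_function_integral:
  fixes a :: "nat \<Rightarrow> real"
  assumes h: "h > 0" and ij: "i \<le> j"
  shows "set_integrable lborel {real i * h<..real j * h} (\<lambda>t. a (nat \<lceil>t / h\<rceil> - 1))"
    and "(LINT t:{real i * h<..real j * h}|lborel. a (nat \<lceil>t / h\<rceil> - 1)) = h * (\<Sum>k=i..<j. a k)"
proof -
  let ?b = "\<lambda>t. \<Sum>k=i..<j. a k * indicat_real {real k * h<..real (Suc k) * h} t"
  have eq: "indicat_real {real i * h<..real j * h} t * a (nat \<lceil>t / h\<rceil> - 1) = ?b t" for t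
  proof (cases "t \<in> {real i * h<..real j * h}")
    case True
    define l where "l = nat \<lceil>t / h\<rceil> - 1"
    have "0 \<le> real i * h" using h by simp
    then have t: "t > 0" using True by (simp del: of_nat_0_le_iff)
    have l: "t \<in> {real k * h<..real (Suc k) * h} \<longleftrightarrow> k = l" for k
      using grid_cell_iff[OF h t, of k] by (auto simp: l_def)
    have "real l * h < t" "t \<le> real (Suc l) * h" using l[of l] by auto
    then have "real i * h < real (Suc l) * h" "real l * h < real j * h" using True by auto
    then have "l \<in> {i..<j}" using h by (simp del: of_nat_Suc)
    then have "(\<Sum>k=i..<j. if k = l then a l else 0) = a l" by simp
    moreover have "?b t = (\<Sum>k=i..<j. if k = l then a l else 0)"
      by (rule sum.cong[OF refl]) (use l in \<open>simp add: indicator_def\<close>)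
    ultimately show ?thesis using True by (simp add: l_def)
  next
    case False
    have "indicat_real {real k * h<..real (Suc k) * h} t = 0" if "k \<in> {i..<j}" for k
    proof -
      have "real i * h \<le> real k * h" "real (Suc k) * h \<le> real j * h"
        using that h by (auto intro!: mult_right_mono simp del: of_nat_Suc)
      then show ?thesis using False by auto
    qed
    then show ?thesis using False by simp
  qed
  have fin: "emeasure lborel {real k * h<..real (Suc k) * h} < \<infinity>" for k
    using h by (simp add: mult_right_mono del: of_nat_Suc)
  have i: "integrable lborel (\<lambda>t. a k * indicat_real {real k * h<..real (Suc k) * h} t)" for k
    by (intro integrable_mult_right integrable_real_indicator fin) simp
  then have ib: "integrable lborel ?b" by (intro Bochner_Integration.integrable_sum)
  then show "set_integrable lborel {real i * h<..real j * h} (\<lambda>t. a (nat \<lceil>t / h\<rceil> - 1))"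
    unfolding set_integrable_def real_scaleR_def eq .
  have "(LINT t|lborel. a k * indicat_real {real k * h<..real (Suc k) * h} t) = a k * h" for k
    using h by (simp add: field_simps)
  then have "(LINT t|lborel. ?b t) = (\<Sum>k=i..<j. a k * h)"
    using i by (simp only: Bochner_Integration.integral_sum)
  then show "(LINT t:{real i * h<..real j * h}|lborel. a (nat \<lceil>t / h\<rceil> - 1)) = h * (\<Sum>k=i..<j. a k)"
    unfolding set_lebesgue_integral_def real_scaleR_def eq by (simp add: sum_distrib_left mult.commute)
qed

lemma step_function_integral_le:
  fixes a :: "nat \<Rightarrow> real"
  assumes h: "h > 0" and T: "T > 0" and a: "\<And>k. a k \<ge> 0"
  shows "set_integrable lborel {0<..<T} (\<lambda>t. a (nat \<lceil>t / h\<rceil> - 1))"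
    and "(LINT t:{0<..<T}|lborel. a (nat \<lceil>t / h\<rceil> - 1)) \<le> h * (\<Sum>k<nat \<lceil>T / h\<rceil>. a k)"
proof -
  let ?N = "nat \<lceil>T / h\<rceil>"
  have "T / h \<le> real ?N" by (rule of_nat_ceiling)
  then have sub: "{0<..<T} \<subseteq> {real 0 * h<..real ?N * h}" using h by (auto simp: field_simps)
  note big = step_function_integral[OF h, of 0 ?N a]
  show int: "set_integrable lborel {0<..<T} (\<lambda>t. a (nat \<lceil>t / h\<rceil> - 1))"
    by (rule set_integrable_subset[OF big(1) _ sub]) auto
  have "(LINT t:{0<..<T}|lborel. a (nat \<lceil>t / h\<rceil> - 1)) \<le> (LINT t:{real 0 * h<..real ?N * h}|lborel. a (nat \<lceil>t / h\<rceil> - 1))"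
    unfolding set_lebesgue_integral_def
    using int big(1) sub a unfolding set_integrable_def by (intro integral_mono) (auto simp: indicator_def)
  also have "\<dots> = h * (\<Sum>k<?N. a k)" using big(2) by (simp add: lessThan_atLeast0)
  finally show "(LINT t:{0<..<T}|lborel. a (nat \<lceil>t / h\<rceil> - 1)) \<le> h * (\<Sum>k<?N. a k)" .
qed

lemma set_integral_Icc_eq_Ioo:
  fixes F :: "real \<Rightarrow> real"
  assumes [measurable]: "F \<in> borel_measurable borel"
  shows "(LINT t:{a..b}|lborel. F t) = (LINT t:{a<..<b}|lborel. F t)"
  unfolding set_lebesgue_integral_def
proof (rule integral_cong_AE)
  show "AE t in lborel. indicat_real {a..b} t *\<^sub>R F t = indicat_real {a<..<b} t *\<^sub>R F t"
    using AE_lborel_singleton[of a] AE_lborel_singleton[of b] by eventually_elim (auto simp: indicator_def)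
qed measurable

lemma slice_integral_measurable:
  fixes g :: "real \<times> 'a::euclidean_space \<Rightarrow> real"
  assumes "closed \<Omega>" "M \<in> prob_on \<Omega>" "continuous_on (UNIV \<times> \<Omega>) g"
  shows "(\<lambda>t. LINT x:\<Omega>|M. g (t, x)) \<in> borel_measurable borel"
proof -
  interpret prob_space M using prob_onD[OF assms(2)] by simp
  have "(\<lambda>z. indicat_real (UNIV \<times> \<Omega>) z * g z) \<in> borel_measurable borel"
    by (rule continuous_on_indicator_measurable[OF _ assms(3)]) (auto intro!: borel_closed closed_Times assms)
  also have "(borel :: (real \<times> 'a) measure) = borel \<Otimes>\<^sub>M borel" by (simp add: borel_prod)
  finally have "(\<lambda>z. indicat_real (UNIV \<times> \<Omega>) z * g z) \<in> borel_measurable (borel \<Otimes>\<^sub>M M)"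
    by (simp add: measurable_cong_sets[OF sets_pair_measure_cong[OF refl prob_onD(2)[OF assms(2)]] refl])
  then have "(\<lambda>t. LINT x|M. indicat_real (UNIV \<times> \<Omega>) (t, x) * g (t, x)) \<in> borel_measurable borel"
    by (intro borel_measurable_lebesgue_integral) (simp add: split_beta')
  then show ?thesis by (simp add: set_lebesgue_integral_def indicator_times)
qed

lemma slice_continuous:
  assumes "continuous_on (UNIV \<times> \<Omega>) g"
  shows "continuous_on \<Omega> (\<lambda>x. g (t, x))"
  by (rule continuous_on_compose2[OF assms]) (auto intro!: continuous_intros)

section \<open>Limits of the discrete curves\<close>

locale jko_limit =
  fixes \<Omega> :: "'a::euclidean_space set"
    and V :: "'a \<Rightarrow> real" and gradV :: "'a \<Rightarrow> 'a"
    and T :: real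
    and \<rho>0 :: "'a measure"
    and R :: "real \<Rightarrow> nat \<Rightarrow> 'a measure"
    and S :: "real \<Rightarrow> nat \<Rightarrow> 'a \<Rightarrow> 'a"
    and \<tau> :: "nat \<Rightarrow> real"
    and \<rho> :: "real \<Rightarrow> 'a measure"
    and E :: "(real \<times> 'a, 'a) vmeasure"
  assumes domain: "compact_domain \<Omega>"
    and potential: "C1_closure \<Omega> V gradV"
    and final_time: "T > 0"
    and initial: "\<rho>0 \<in> prob_on \<Omega>" "energy \<Omega> V \<rho>0 < \<infinity>"
    and scheme: "\<And>h. h > 0 \<Longrightarrow> jko_scheme \<Omega> V h \<rho>0 (R h)"
    and maps: "\<And>h k. h > 0 \<Longrightarrow> optimal_map \<Omega> (R h (Suc k)) (R h k) (S h k)"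
    and steps: "\<And>j. \<tau> j > 0" "\<tau> \<longlonglongrightarrow> 0"
    and limit_curve: "\<And>t. t \<in> {0..T} \<Longrightarrow> \<rho> t \<in> prob_on \<Omega>"
    and curve_convergence:
      "uniform_limit {0..T} (\<lambda>j t. W2 \<Omega> (interp_curve (\<tau> j) (R (\<tau> j)) t) (\<rho> t)) (\<lambda>t. 0) sequentially"
    and limit_momentum: "vector_measure_on ({0..T} \<times> \<Omega>) E"
    and momentum_convergence:
      "\<And>f. continuous_on ({0..T} \<times> \<Omega>) f \<Longrightarrow>
         (\<lambda>j. discrete_momentum_integral \<Omega> T (\<tau> j) (R (\<tau> j)) (S (\<tau> j)) f)
           \<longlonglongrightarrow> vintegral ({0..T} \<times> \<Omega>) E f"
begin

lemma compact_domain_facts: "compact \<Omega>" "closed \<Omega>" "\<Omega> \<in> sets borel" "\<Omega> \<subseteq> closure (interior \<Omega>)"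
proof -
  obtain U where U: "open U" "bounded U" "\<Omega> = closure U" using domain by (auto simp: compact_domain_def)
  then show c: "compact \<Omega>" by (simp add: compact_closure)
  then show "closed \<Omega>" "\<Omega> \<in> sets borel" by (auto intro: compact_imp_closed borel_compact)
  have "U \<subseteq> interior \<Omega>" using interior_maximal[OF closure_subset U(1)] U(3) by simp
  then show "\<Omega> \<subseteq> closure (interior \<Omega>)" using U(3) closure_mono by blast
qed

lemma R_prob: "h > 0 \<Longrightarrow> R h k \<in> prob_on \<Omega>"
  using jko_scheme_prob_on[OF scheme initial(1)] .

lemma interp_prob: "h > 0 \<Longrightarrow> interp_curve h (R h) t \<in> prob_on \<Omega>"
  unfolding interp_curve_def by (rule R_prob)

lemma V_continuous: "continuous_on \<Omega> V" and gradV_continuous: "continuous_on \<Omega> gradV"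
  using potential by (auto simp: C1_closure_def)

lemma total_cost_bound:
  obtains C where "C \<ge> 0" "\<And>h N. h > 0 \<Longrightarrow> (\<Sum>k<N. (W2 \<Omega> (R h (Suc k)) (R h k))\<^sup>2) \<le> h * C"
proof -
  obtain C where C: "C \<ge> 0" "\<And>h R N. h > 0 \<Longrightarrow> jko_scheme \<Omega> V h \<rho>0 R \<Longrightarrow>
    (\<Sum>k<N. (W2 \<Omega> (R (Suc k)) (R k))\<^sup>2) \<le> h * C"
    using jko_total_cost_bound[OF compact_domain_facts(1) V_continuous initial] by blast
  show ?thesis by (rule that[OF C(1)]) (rule C(2)[OF _ scheme])
qed

lemma curve_pointwise: "t \<in> {0..T} \<Longrightarrow> (\<lambda>j. W2 \<Omega> (interp_curve (\<tau> j) (R (\<tau> j)) t) (\<rho> t)) \<longlonglongrightarrow> 0"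
  using tendsto_uniform_limitI[OF curve_convergence] by simp

text \<open>All discrete curves start at \<open>\<rho>0\<close>, and at distance \<open>0\<close> two measures have the same integrals of continuous functions.\<close>

lemma initial_value: "\<rho> 0 = \<rho>0"
proof (rule prob_on_eqI_continuous[OF compact_domain_facts(1)])
  have 0: "0 \<in> {0..T}" using final_time by simp
  show "\<rho> 0 \<in> prob_on \<Omega>" by (rule limit_curve[OF 0])
  show "\<rho>0 \<in> prob_on \<Omega>" by (rule initial)
  fix g :: "'a \<Rightarrow> real" assume g: "continuous_on UNIV g"
  have eq: "interp_curve (\<tau> j) (R (\<tau> j)) 0 = \<rho>0" for j
    using scheme[OF steps(1)[of j]] by (simp add: interp_curve_def jko_scheme_def)
  have "(\<lambda>j. LINT x:\<Omega>|interp_curve (\<tau> j) (R (\<tau> j)) 0. g x) \<longlonglongrightarrow> (LINT x:\<Omega>|\<rho> 0. g x)"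
    by (rule W2_tendsto_imp_integral_tendsto[OF compact_domain_facts(1) _ _ limit_curve[OF 0] curve_pointwise[OF 0]])
      (use g continuous_on_subset interp_prob steps in blast)+
  then show "(LINT x:\<Omega>|\<rho> 0. g x) = (LINT x:\<Omega>|\<rho>0. g x)"
    unfolding eq using LIMSEQ_unique tendsto_const by blast
qed

lemma interp_integral_measurable:
  fixes g :: "real \<times> 'a \<Rightarrow> real"
  assumes "h > 0" "continuous_on (UNIV \<times> \<Omega>) g"
  shows "(\<lambda>t. LINT x:\<Omega>|interp_curve h (R h) t. g (t, x)) \<in> borel_measurable borel"
  unfolding interp_curve_def
  by (rule measurable_compose_countable[OF slice_integral_measurable[OF compact_domain_facts(2) R_prob[OF assms(1)] assms(2)]
    nat_ceiling_divide_measurable])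

lemma interp_integral_tendsto:
  fixes g :: "'a \<Rightarrow> real"
  assumes "t \<in> {0..T}" "continuous_on \<Omega> g"
  shows "(\<lambda>j. LINT x:\<Omega>|interp_curve (\<tau> j) (R (\<tau> j)) t. g x) \<longlonglongrightarrow> (LINT x:\<Omega>|\<rho> t. g x)"
  by (rule W2_tendsto_imp_integral_tendsto[OF compact_domain_facts(1) assms(2) interp_prob[OF steps(1)]
    limit_curve[OF assms(1)] curve_pointwise[OF assms(1)]])

text \<open>Measurability in time is inherited from the piecewise constant discrete curves.\<close>

lemma limit_integral_measurable:
  fixes g :: "real \<times> 'a \<Rightarrow> real"
  assumes "continuous_on (UNIV \<times> \<Omega>) g"
  shows "(\<lambda>t. indicat_real {0<..<T} t * (LINT x:\<Omega>|\<rho> t. g (t, x))) \<in> borel_measurable borel"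
proof (rule borel_measurable_LIMSEQ_real)
  show "(\<lambda>t. indicat_real {0<..<T} t * (LINT x:\<Omega>|interp_curve (\<tau> j) (R (\<tau> j)) t. g (t, x))) \<in> borel_measurable borel" for j
    using interp_integral_measurable[OF steps(1) assms, of j] by measurable
  show "(\<lambda>j. indicat_real {0<..<T} t * (LINT x:\<Omega>|interp_curve (\<tau> j) (R (\<tau> j)) t. g (t, x)))
     \<longlonglongrightarrow> indicat_real {0<..<T} t * (LINT x:\<Omega>|\<rho> t. g (t, x))" for t
    using interp_integral_tendsto[of t "\<lambda>x. g (t, x)"] slice_continuous[OF assms]
    by (cases "t \<in> {0<..<T}") (auto intro!: tendsto_mult_left)
qed

lemma limit_integral_integrable:
  fixes g :: "real \<times> 'a \<Rightarrow> real"
  assumes g: "continuous_on (UNIV \<times> \<Omega>) g" and B: "\<And>t x. x \<in> \<Omega> \<Longrightarrow> \<bar>g (t, x)\<bar> \<le> B" "B \<ge> 0"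
  shows "set_integrable lborel {0<..<T} (\<lambda>t. LINT x:\<Omega>|\<rho> t. g (t, x))"
  unfolding set_integrable_def real_scaleR_def
proof (rule Bochner_Integration.integrable_bound)
  show "integrable lborel (\<lambda>t. B * indicat_real {0<..<T} t)"
    by (intro integrable_mult_right integrable_real_indicator) (use final_time in auto)
  show "AE t in lborel. norm (indicat_real {0<..<T} t * (LINT x:\<Omega>|\<rho> t. g (t, x))) \<le> norm (B * indicat_real {0<..<T} t)"
    using set_integral_abs_le_bound[OF limit_curve, of _ "\<lambda>x. g (_, x)" B] B
    by (intro AE_I2) (auto simp: indicator_def)
qed (use limit_integral_measurable[OF g] in simp)

lemma interp_integral_integrable:
  fixes g :: "real \<times> 'a \<Rightarrow> real"
  assumes h: "h > 0" and g: "continuous_on (UNIV \<times> \<Omega>) g" and B: "\<And>t x. x \<in> \<Omega> \<Longrightarrow> \<bar>g (t, x)\<bar> \<le> B" "B \<ge> 0"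
  shows "set_integrable lborel {0<..<T} (\<lambda>t. LINT x:\<Omega>|interp_curve h (R h) t. g (t, x))"
  unfolding set_integrable_def real_scaleR_def
proof (rule Bochner_Integration.integrable_bound)
  show "integrable lborel (\<lambda>t. B * indicat_real {0<..<T} t)"
    by (intro integrable_mult_right integrable_real_indicator) (use final_time in auto)
  show "AE t in lborel. norm (indicat_real {0<..<T} t * (LINT x:\<Omega>|interp_curve h (R h) t. g (t, x))) \<le> norm (B * indicat_real {0<..<T} t)"
    using set_integral_abs_le_bound[OF interp_prob[OF h], of "\<lambda>x. g (_, x)" B] B
    by (intro AE_I2) (auto simp: indicator_def)
qed (use interp_integral_measurable[OF h g] in measurable)

text \<open>For each time the space integrals converge by weak convergence; the time integrals follow by domination.\<close>

lemma interp_integral_converges: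
  fixes g :: "real \<times> 'a \<Rightarrow> real"
  assumes g: "continuous_on (UNIV \<times> \<Omega>) g" and B: "\<And>t x. x \<in> \<Omega> \<Longrightarrow> \<bar>g (t, x)\<bar> \<le> B" "B \<ge> 0"
  shows "(\<lambda>j. LINT t:{0<..<T}|lborel. LINT x:\<Omega>|interp_curve (\<tau> j) (R (\<tau> j)) t. g (t, x))
    \<longlonglongrightarrow> (LINT t:{0<..<T}|lborel. LINT x:\<Omega>|\<rho> t. g (t, x))"
  unfolding set_lebesgue_integral_def[of lborel] real_scaleR_def
proof (rule integral_dominated_convergence[where w = "\<lambda>t. B * indicat_real {0<..<T} t"])
  show "integrable lborel (\<lambda>t. B * indicat_real {0<..<T} t)"
    by (intro integrable_mult_right integrable_real_indicator) (use final_time in auto)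
  show "AE t in lborel. norm (indicat_real {0<..<T} t * (LINT x:\<Omega>|interp_curve (\<tau> j) (R (\<tau> j)) t. g (t, x))) \<le> B * indicat_real {0<..<T} t" for j
    using set_integral_abs_le_bound[OF interp_prob[OF steps(1)], of "\<lambda>x. g (_, x)" B] B
    by (intro AE_I2) (auto simp: indicator_def)
  show "AE t in lborel. (\<lambda>j. indicat_real {0<..<T} t * (LINT x:\<Omega>|interp_curve (\<tau> j) (R (\<tau> j)) t. g (t, x)))
     \<longlonglongrightarrow> indicat_real {0<..<T} t * (LINT x:\<Omega>|\<rho> t. g (t, x))"
  proof (intro AE_I2)
    fix t show "(\<lambda>j. indicat_real {0<..<T} t * (LINT x:\<Omega>|interp_curve (\<tau> j) (R (\<tau> j)) t. g (t, x)))
     \<longlonglongrightarrow> indicat_real {0<..<T} t * (LINT x:\<Omega>|\<rho> t. g (t, x))"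
      using interp_integral_tendsto[of t "\<lambda>x. g (t, x)"] slice_continuous[OF g]
      by (cases "t \<in> {0<..<T}") (auto intro!: tendsto_mult_left)
  qed
  show "(\<lambda>t. indicat_real {0<..<T} t * (LINT x:\<Omega>|interp_curve (\<tau> j) (R (\<tau> j)) t. g (t, x))) \<in> borel_measurable lborel" for j
    using interp_integral_measurable[OF steps(1) g, of j] by measurable
  show "(\<lambda>t. indicat_real {0<..<T} t * (LINT x:\<Omega>|\<rho> t. g (t, x))) \<in> borel_measurable lborel"
    using limit_integral_measurable[OF g] by simp
qed

lemma compactly_supported_bounded:
  fixes g :: "real \<times> 'a \<Rightarrow> real"
  assumes "compact K" "K \<subseteq> UNIV \<times> \<Omega>" "continuous_on (UNIV \<times> \<Omega>) g" "\<And>z. z \<notin> K \<Longrightarrow> g z = 0"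
  obtains B where "B \<ge> 0" "\<And>z. \<bar>g z\<bar> \<le> B"
proof -
  obtain B where "B > 0" "\<And>z. z \<in> K \<Longrightarrow> norm (g z) \<le> B"
    using continuous_bounded_on_compact[OF assms(1) continuous_on_subset[OF assms(3,2)]] by blast
  then show ?thesis using that[of B] assms(4) by (metis abs_zero less_imp_le real_norm_def)
qed

text \<open>The Euler-Lagrange equation of the step that is active at time \<open>t\<close>. The spatial derivative of \<open>f\<close> is its total
  derivative composed with the inclusion \<open>v \<mapsto> (0, v)\<close>.\<close>

lemma discrete_flux_law:
  fixes f :: "real \<times> 'a \<Rightarrow> 'a"
  assumes h: "h > 0" and t: "t > 0"
    and f: "\<And>z. (f has_derivative blinfun_apply (D z)) (at z)" "continuous_on UNIV D"
    and K: "compact K" "K \<subseteq> UNIV \<times> interior \<Omega>" "\<And>z. z \<notin> K \<Longrightarrow> f z = 0"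
  shows "(LINT x:\<Omega>|interp_curve h (R h) t. f (t, x) \<bullet> interp_velocity h (S h) t x) =
    (LINT x:\<Omega>|interp_curve h (R h) t. space_div D (t, x)) - (LINT x:\<Omega>|interp_curve h (R h) t. f (t, x) \<bullet> gradV x)"
proof -
  define k where "k = nat \<lceil>t / h\<rceil> - 1"
  have "1 \<le> \<lceil>t / h\<rceil>" using t h by (simp add: le_ceiling_iff)
  then have k: "nat \<lceil>t / h\<rceil> = Suc k" unfolding k_def by linarith
  define e :: "'a \<Rightarrow>\<^sub>L (real \<times> 'a)" where "e = Blinfun (\<lambda>v. (0, v))"
  have e: "blinfun_apply e v = (0, v)" for v
    unfolding e_def by (subst bounded_linear_Blinfun_apply) (auto intro!: bounded_linear_Pair bounded_linear_zero bounded_linear_ident)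
  have step: "jko_step \<Omega> V h (R h k) (R h (Suc k))" using scheme[OF h] by (simp add: jko_scheme_def)
  have fin: "energy \<Omega> V (R h (Suc k)) < \<infinity>"
    by (rule jko_scheme_energy_finite[OF compact_domain_facts(1) scheme[OF h] initial])
  have "(LINT x:\<Omega>|R h (Suc k). f (t, x) \<bullet> ((x - S h k x) /\<^sub>R h)) =
     (LINT x:\<Omega>|R h (Suc k). (\<Sum>b\<in>Basis. blinfun_apply (D (t, x) o\<^sub>L e) b \<bullet> b)) - (LINT x:\<Omega>|R h (Suc k). f (t, x) \<bullet> gradV x)"
  proof (rule jko_euler_lagrange[OF compact_domain_facts(1) potential h step R_prob[OF h] R_prob[OF h] fin maps[OF h]])
    show "((\<lambda>x. f (t, x)) has_derivative blinfun_apply (D (t, x) o\<^sub>L e)) (at x)" for x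
    proof -
      have "((\<lambda>x. (t, x)) has_derivative (\<lambda>v. (0, v))) (at x)" by (auto intro!: derivative_eq_intros)
      moreover have "blinfun_apply (D (t, x) o\<^sub>L e) = (\<lambda>v. blinfun_apply (D (t, x)) (0, v))"
        by (simp add: fun_eq_iff e)
      ultimately show ?thesis using has_derivative_compose[OF _ f(1)] by simp
    qed
    show "continuous_on UNIV (\<lambda>x. D (t, x) o\<^sub>L e)"
      by (intro continuous_intros continuous_on_compose2[OF f(2)]) auto
    show "compact (snd ` K)" by (intro compact_continuous_image K continuous_intros)
    show "snd ` K \<subseteq> interior \<Omega>" using K(2) by auto
    show "f (t, x) = 0" if "x \<notin> snd ` K" for x using that K(3)[of "(t, x)"] by force
  qed
  then show ?thesis by (simp add: interp_curve_def interp_velocity_def k space_div_def e k_def[symmetric])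
qed

text \<open>The discrete flux law is an exact identity whose right-hand side involves only continuous functions of
  space-time integrated against the curve, so it passes to the limit as it stands.\<close>

lemma flux_law_holds: "flux_law \<Omega> gradV T \<rho> E"
  unfolding flux_law_def
proof (intro allI impI)
  fix f :: "real \<times> 'a \<Rightarrow> 'a" and D
  let ?A = "{0<..<T} \<times> interior \<Omega>"
  assume "C1_field ?A f D \<and> compactly_supported_in ?A f"
  then obtain K where fD: "C1_field ?A f D" and K: "compact K" "K \<subseteq> ?A" "\<forall>z\<in>?A - K. f z = 0"
    by (auto simp: compactly_supported_in_def)
  have oA: "open ?A" by (intro open_Times) auto
  define f0 where "f0 = (\<lambda>z. if z \<in> ?A then f z else 0)"
  define D0 where "D0 = (\<lambda>z. if z \<in> ?A then D z else 0)"
  have f0d: "(f0 has_derivative blinfun_apply (D0 z)) (at z)" for z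
    unfolding f0_def D0_def by (rule C1_field_zero_extension(1)[OF oA fD K])
  have D0c': "continuous_on UNIV D0"
    unfolding D0_def by (rule C1_field_zero_extension(2)[OF oA fD K])
  have f0z: "f0 z = 0" and D0z: "D0 z = 0" if "z \<notin> K" for z
    unfolding f0_def D0_def by (rule C1_field_zero_extension(3,4)[OF oA fD K that])+
  have K': "K \<subseteq> UNIV \<times> interior \<Omega>" "K \<subseteq> UNIV \<times> \<Omega>" using K(2) interior_subset by auto
  have f0c: "continuous_on X f0" for X
    using f0d by (auto intro!: continuous_at_imp_continuous_on has_derivative_continuous)
  define g1 where "g1 = space_div D0"
  define g2 where "g2 z = f0 z \<bullet> gradV (snd z)" for z
  have D0c: "continuous_on X D0" for X using continuous_on_subset[OF D0c'] by simp
  have g1c: "continuous_on (UNIV \<times> \<Omega>) g1"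
    unfolding g1_def space_div_def by (intro continuous_intros D0c)
  have g2c: "continuous_on (UNIV \<times> \<Omega>) g2"
    unfolding g2_def by (intro continuous_intros f0c continuous_on_compose2[OF gradV_continuous]) auto
  have g1z: "g1 z = 0" and g2z: "g2 z = 0" if "z \<notin> K" for z
    using f0z[OF that] D0z[OF that] by (simp_all add: g1_def g2_def space_div_def)
  obtain B1 where B1: "B1 \<ge> 0" "\<And>z. \<bar>g1 z\<bar> \<le> B1"
    using compactly_supported_bounded[OF K(1) K'(2) g1c g1z] by blast
  obtain B2 where B2: "B2 \<ge> 0" "\<And>z. \<bar>g2 z\<bar> \<le> B2"
    using compactly_supported_bounded[OF K(1) K'(2) g2c g2z] by blast
  have discrete: "discrete_momentum_integral \<Omega> T h (R h) (S h) f0 =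
     (LINT t:{0<..<T}|lborel. LINT x:\<Omega>|interp_curve h (R h) t. g1 (t, x))
     - (LINT t:{0<..<T}|lborel. LINT x:\<Omega>|interp_curve h (R h) t. g2 (t, x))" if h: "h > 0" for h
  proof -
    have pt: "(LINT x:\<Omega>|interp_curve h (R h) t. f0 (t, x) \<bullet> interp_velocity h (S h) t x) =
       (LINT x:\<Omega>|interp_curve h (R h) t. g1 (t, x)) - (LINT x:\<Omega>|interp_curve h (R h) t. g2 (t, x))" for t
    proof (cases "t > 0")
      case True
      then show ?thesis
        using discrete_flux_law[OF h True f0d D0c' K(1) K'(1) f0z] by (simp add: g1_def g2_def)
    next
      case False
      then have "(t, x) \<notin> K" for x using K(2) by auto
      then show ?thesis using f0z g1z g2z by simp
    qed
    note m = interp_integral_measurable[OF h g1c] interp_integral_measurable[OF h g2c]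
    have "discrete_momentum_integral \<Omega> T h (R h) (S h) f0 = (LINT t:{0..T}|lborel.
       (LINT x:\<Omega>|interp_curve h (R h) t. g1 (t, x)) - (LINT x:\<Omega>|interp_curve h (R h) t. g2 (t, x)))"
      unfolding discrete_momentum_integral_def pt ..
    also have "\<dots> = (LINT t:{0<..<T}|lborel.
       (LINT x:\<Omega>|interp_curve h (R h) t. g1 (t, x)) - (LINT x:\<Omega>|interp_curve h (R h) t. g2 (t, x)))"
      by (rule set_integral_Icc_eq_Ioo) (rule borel_measurable_diff[OF m])
    finally show ?thesis
      using interp_integral_integrable[OF h g1c B1(2,1)] interp_integral_integrable[OF h g2c B2(2,1)] by simp
  qed
  have "(\<lambda>j. discrete_momentum_integral \<Omega> T (\<tau> j) (R (\<tau> j)) (S (\<tau> j)) f0) \<longlonglongrightarrow>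
     (LINT t:{0<..<T}|lborel. LINT x:\<Omega>|\<rho> t. g1 (t, x)) - (LINT t:{0<..<T}|lborel. LINT x:\<Omega>|\<rho> t. g2 (t, x))"
    unfolding discrete[OF steps(1)]
    by (intro tendsto_diff interp_integral_converges[OF g1c B1(2,1)] interp_integral_converges[OF g2c B2(2,1)])
  from LIMSEQ_unique[OF momentum_convergence[OF f0c] this]
  have lim: "vintegral ({0..T} \<times> \<Omega>) E f0 =
     (LINT t:{0<..<T}|lborel. LINT x:\<Omega>|\<rho> t. g1 (t, x)) - (LINT t:{0<..<T}|lborel. LINT x:\<Omega>|\<rho> t. g2 (t, x))" .
  have "vintegral ?A E f = vintegral ({0..T} \<times> \<Omega>) E f0"
    unfolding vintegral_def set_lebesgue_integral_def
    using interior_subset[of \<Omega>] by (intro Bochner_Integration.integral_cong refl) (auto simp: indicator_def f0_def)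
  moreover have "(LINT t:{0<..<T}|lborel. LINT x:interior \<Omega>|\<rho> t. space_div D (t, x)) = (LINT t:{0<..<T}|lborel. LINT x:\<Omega>|\<rho> t. g1 (t, x))"
    unfolding set_lebesgue_integral_def
    using interior_subset[of \<Omega>] by (intro Bochner_Integration.integral_cong refl)
      (auto simp: indicator_def g1_def D0_def space_div_def intro!: Bochner_Integration.integral_cong)
  moreover have "(LINT t:{0<..<T}|lborel. LINT x:interior \<Omega>|\<rho> t. f (t, x) \<bullet> gradV x) = (LINT t:{0<..<T}|lborel. LINT x:\<Omega>|\<rho> t. g2 (t, x))"
    unfolding set_lebesgue_integral_def
    using interior_subset[of \<Omega>] by (intro Bochner_Integration.integral_cong refl)
      (auto simp: indicator_def g2_def f0_def intro!: Bochner_Integration.integral_cong)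
  ultimately show "vintegral ?A E f = (LINT t:{0<..<T}|lborel. LINT x:interior \<Omega>|\<rho> t. space_div D (t, x))
     - (LINT t:{0<..<T}|lborel. LINT x:interior \<Omega>|\<rho> t. f (t, x) \<bullet> gradV x)"
    using lim by simp
qed

end

section \<open>The continuity equation and the Fokker-Planck equation\<close>

context jko_limit
begin

text \<open>The a priori estimate in time-integrated form: divided by \<open>h\<^sup>2\<close>, the left-hand side is the squared \<open>L\<^sup>2\<close> norm of the discrete velocity.\<close>

lemma interp_cost_integral:
  obtains C where "C \<ge> 0" "\<And>h. h > 0 \<Longrightarrow>
     set_integrable lborel {0<..<T} (\<lambda>t. (W2 \<Omega> (R h (Suc (nat \<lceil>t / h\<rceil> - 1))) (R h (nat \<lceil>t / h\<rceil> - 1)))\<^sup>2)"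
    "\<And>h. h > 0 \<Longrightarrow>
     (LINT t:{0<..<T}|lborel. (W2 \<Omega> (R h (Suc (nat \<lceil>t / h\<rceil> - 1))) (R h (nat \<lceil>t / h\<rceil> - 1)))\<^sup>2) \<le> h\<^sup>2 * C"
proof -
  obtain C where C: "C \<ge> 0" "\<And>h N. h > 0 \<Longrightarrow> (\<Sum>k<N. (W2 \<Omega> (R h (Suc k)) (R h k))\<^sup>2) \<le> h * C"
    using total_cost_bound by blast
  show ?thesis
  proof (rule that[OF C(1)])
    fix h :: real assume h: "h > 0"
    let ?a = "\<lambda>k. (W2 \<Omega> (R h (Suc k)) (R h k))\<^sup>2"
    show "set_integrable lborel {0<..<T} (\<lambda>t. ?a (nat \<lceil>t / h\<rceil> - 1))"
      by (rule step_function_integral_le(1)[OF h final_time]) simp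
    have "(LINT t:{0<..<T}|lborel. ?a (nat \<lceil>t / h\<rceil> - 1)) \<le> h * (\<Sum>k<nat \<lceil>T / h\<rceil>. ?a k)"
      by (rule step_function_integral_le(2)[OF h final_time]) simp
    also have "\<dots> \<le> h * (h * C)" using C(2)[OF h] h by (intro mult_left_mono) auto
    finally show "(LINT t:{0<..<T}|lborel. ?a (nat \<lceil>t / h\<rceil> - 1)) \<le> h\<^sup>2 * C"
      by (simp add: power2_eq_square)
  qed
qed

text \<open>A time step backwards along the curve is a time step forwards on the test function. No boundary terms
  arise because the test function vanishes up to time \<open>r \<ge> h\<close> and from time \<open>T\<close> on.\<close>

lemma time_shift:
  fixes \<phi> :: "real \<times> 'a \<Rightarrow> real"
  assumes h: "h > 0" "h \<le> r" and supp: "\<And>t x. \<not> (r < t \<and> t < T) \<Longrightarrow> \<phi> (t, x) = 0"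
  shows "(LINT t:{0<..<T}|lborel. LINT x:\<Omega>|R h (nat \<lceil>t / h\<rceil> - 1). \<phi> (t, x))
    = (LINT t:{0<..<T}|lborel. LINT x:\<Omega>|interp_curve h (R h) t. \<phi> (t + h, x))"
proof -
  let ?F = "\<lambda>t. indicat_real {0<..<T} t * (LINT x:\<Omega>|R h (nat \<lceil>t / h\<rceil> - 1). \<phi> (t, x))"
  have "?F (h + s) = indicat_real {0<..<T} s * (LINT x:\<Omega>|interp_curve h (R h) s. \<phi> (s + h, x))" for s
  proof (cases "r < s + h \<and> s + h < T")
    case True
    then have s: "0 < s" "s < T" using h by auto
    have "(h + s) / h = s / h + 1" using h by (simp add: field_simps)
    moreover have "0 < \<lceil>s / h\<rceil>" using s h by simp
    ultimately have "nat \<lceil>(h + s) / h\<rceil> - 1 = nat \<lceil>s / h\<rceil>" by simp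
    then show ?thesis using s True h by (simp add: interp_curve_def add.commute)
  next
    case False
    then have "\<phi> (h + s, x) = 0" for x using supp[of "h + s" x] by (simp add: add.commute)
    then show ?thesis by (simp add: add.commute set_lebesgue_integral_def)
  qed
  moreover have "(LINT t|lborel. ?F t) = (LINT s|lborel. ?F (h + s))"
    using lborel_integral_real_affine[of 1 ?F h] by simp
  ultimately show ?thesis by (simp add: set_lebesgue_integral_def[of lborel])
qed

text \<open>Write \<open>m1\<close> and \<open>m0\<close> for the integrals of \<open>\<phi>\<close> against the current and the previous measure, \<open>ms\<close> for
  that of \<open>\<phi>\<close> shifted by \<open>h\<close>, and \<open>v\<close>, \<open>p\<close> for the integrals of the spatial and temporal derivatives. The
  spatial Taylor estimate compares \<open>v\<close> with \<open>(m1 - m0) / h\<close>, the temporal one \<open>p\<close> with \<open>- (m1 - ms) / h\<close>, and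
  the time integrals of \<open>m0\<close> and \<open>ms\<close> agree. The last error is of order \<open>\<eta> + h\<close> thanks to the bound on the total cost.\<close>

lemma discrete_continuity_error:
  fixes \<phi> :: "real \<times> 'a \<Rightarrow> real" and G :: "real \<times> 'a \<Rightarrow> real \<times> 'a"
  assumes h: "h > 0" "h \<le> r" and \<phi>: "continuous_on (UNIV \<times> \<Omega>) \<phi>" and G: "continuous_on (UNIV \<times> \<Omega>) G"
    and K: "compact K" "K \<subseteq> {r<..<T} \<times> \<Omega>" "\<And>z. z \<notin> K \<Longrightarrow> \<phi> z = 0" "\<And>z. z \<notin> K \<Longrightarrow> G z = 0"
    and C: "C \<ge> 0" and \<eta>: "\<eta> \<ge> 0"
    and taylor: "\<And>z z'. z \<in> UNIV \<times> \<Omega> \<Longrightarrow> z' \<in> UNIV \<times> \<Omega> \<Longrightarrow>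
       \<bar>\<phi> z' - \<phi> z - (z' - z) \<bullet> G z\<bar> \<le> \<eta> * norm (z' - z) + C * (norm (z' - z))\<^sup>2"
    and C0: "C0 \<ge> 0"
      "set_integrable lborel {0<..<T} (\<lambda>t. (W2 \<Omega> (R h (Suc (nat \<lceil>t / h\<rceil> - 1))) (R h (nat \<lceil>t / h\<rceil> - 1)))\<^sup>2)"
      "(LINT t:{0<..<T}|lborel. (W2 \<Omega> (R h (Suc (nat \<lceil>t / h\<rceil> - 1))) (R h (nat \<lceil>t / h\<rceil> - 1)))\<^sup>2) \<le> h\<^sup>2 * C0"
  shows "\<bar>discrete_momentum_integral \<Omega> T h (R h) (S h) (\<lambda>z. snd (G z))
      + (LINT t:{0<..<T}|lborel. LINT x:\<Omega>|interp_curve h (R h) t. fst (G (t, x)))\<bar>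
    \<le> \<eta> * (3 * T / 2 + C0 / 2) + h * (C * C0 + C * T)"
proof -
  let ?I = "{0<..<T}"
  let ?k = "\<lambda>t. nat \<lceil>t / h\<rceil> - 1"
  define w where "w t = (W2 \<Omega> (R h (Suc (?k t))) (R h (?k t)))\<^sup>2" for t
  define v where "v t = (LINT x:\<Omega>|interp_curve h (R h) t. snd (G (t, x)) \<bullet> interp_velocity h (S h) t x)" for t
  define m1 where "m1 t = (LINT x:\<Omega>|interp_curve h (R h) t. \<phi> (t, x))" for t
  define m0 where "m0 t = (LINT x:\<Omega>|R h (?k t). \<phi> (t, x))" for t
  define ms where "ms t = (LINT x:\<Omega>|interp_curve h (R h) t. \<phi> (t + h, x))" for t
  define p where "p t = (LINT x:\<Omega>|interp_curve h (R h) t. fst (G (t, x)))" for t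
  have K\<Omega>: "K \<subseteq> UNIV \<times> \<Omega>" using K(2) by auto
  have supp: "(t, x) \<notin> K" if "\<not> (r < t \<and> t < T)" for t x using K(2) that by auto
  have idx: "nat \<lceil>t / h\<rceil> = Suc (?k t)" if "t > 0" for t
  proof -
    have "1 \<le> \<lceil>t / h\<rceil>" using that h by (simp add: le_ceiling_iff)
    then show ?thesis by linarith
  qed
  have \<phi>s: "continuous_on (UNIV \<times> \<Omega>) (\<lambda>z. \<phi> (fst z + h, snd z))"
    by (intro continuous_on_compose2[OF \<phi>] continuous_intros) auto
  have G1: "continuous_on (UNIV \<times> \<Omega>) (\<lambda>z. fst (G z))" and G2: "continuous_on (UNIV \<times> \<Omega>) (\<lambda>z. snd (G z))"
    by (intro continuous_intros G)+
  obtain B where B: "B \<ge> 0" "\<And>z. \<bar>\<phi> z\<bar> \<le> B"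
    using compactly_supported_bounded[OF K(1) K\<Omega> \<phi> K(3)] by blast
  obtain BG where BG: "BG \<ge> 0" "\<And>z. \<bar>fst (G z)\<bar> \<le> BG"
    using compactly_supported_bounded[OF K(1) K\<Omega> G1] K(4) by auto
  have im1: "set_integrable lborel ?I m1"
    unfolding m1_def using interp_integral_integrable[OF h(1) \<phi> B(2,1)] .
  have ims: "set_integrable lborel ?I ms"
    unfolding ms_def using interp_integral_integrable[OF h(1) \<phi>s B(2,1)] by simp
  have ip: "set_integrable lborel ?I p"
    unfolding p_def using interp_integral_integrable[OF h(1) G1 BG(2,1)] .
  have im0: "set_integrable lborel ?I m0"
    unfolding set_integrable_def real_scaleR_def
  proof (rule Bochner_Integration.integrable_bound)
    show "integrable lborel (\<lambda>t. B * indicat_real ?I t)"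
      by (intro integrable_mult_right integrable_real_indicator) (use final_time in auto)
    show "AE t in lborel. norm (indicat_real ?I t * m0 t) \<le> norm (B * indicat_real ?I t)"
      unfolding m0_def using set_integral_abs_le_bound[OF R_prob[OF h(1)], of "\<lambda>x. \<phi> (_, x)" B] B
      by (intro AE_I2) (auto simp: indicator_def)
    have "m0 \<in> borel_measurable borel"
      unfolding m0_def
      by (rule measurable_compose_countable[OF slice_integral_measurable[OF compact_domain_facts(2) R_prob[OF h(1)] \<phi>]]) measurable
    then show "(\<lambda>t. indicat_real ?I t * m0 t) \<in> borel_measurable lborel" by measurable
  qed
  have vm: "v \<in> borel_measurable borel"
  proof -
    have F: "(\<lambda>t. LINT x:\<Omega>|R h k. snd (G (t, x)) \<bullet> ((x - S h (k - 1) x) /\<^sub>R h)) \<in> borel_measurable borel" for k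
    proof -
      have k: "S h (k - 1) \<in> borel_measurable borel"
        using maps[OF h(1)] by (simp add: optimal_map_def)
      interpret prob_space "R h k" using prob_onD[OF R_prob[OF h(1)]] by simp
      have "(\<lambda>z. indicat_real (UNIV \<times> \<Omega>) z *\<^sub>R snd (G z)) \<in> borel_measurable borel"
        by (rule borel_measurable_continuous_on_indicator[OF _ G2]) (auto intro!: borel_closed closed_Times compact_domain_facts)
      then have [measurable]: "(\<lambda>z. indicat_real (UNIV \<times> \<Omega>) z *\<^sub>R snd (G z)) \<in> borel_measurable (borel \<Otimes>\<^sub>M borel)"
        by (simp add: borel_prod)
      note [measurable] = k
      have "(\<lambda>z. (indicat_real (UNIV \<times> \<Omega>) z *\<^sub>R snd (G z)) \<bullet> ((snd z - S h (k - 1) (snd z)) /\<^sub>R h)) \<in> borel_measurable (borel \<Otimes>\<^sub>M borel)"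
        by measurable
      then have "(\<lambda>z. (indicat_real (UNIV \<times> \<Omega>) z *\<^sub>R snd (G z)) \<bullet> ((snd z - S h (k - 1) (snd z)) /\<^sub>R h)) \<in> borel_measurable (borel \<Otimes>\<^sub>M R h k)"
        by (simp add: measurable_cong_sets[OF sets_pair_measure_cong[OF refl prob_onD(2)[OF R_prob[OF h(1)]]] refl])
      then have "(\<lambda>t. LINT x|R h k. (indicat_real (UNIV \<times> \<Omega>) (t, x) *\<^sub>R snd (G (t, x))) \<bullet> ((x - S h (k - 1) x) /\<^sub>R h)) \<in> borel_measurable borel"
        by (intro borel_measurable_lebesgue_integral) (simp add: split_beta')
      then show ?thesis by (simp add: set_lebesgue_integral_def indicator_times)
    qed
    show ?thesis
      unfolding v_def interp_curve_def interp_velocity_def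
      by (rule measurable_compose_countable[OF F nat_ceiling_divide_measurable])
  qed
  have err1: "\<bar>v t - (m1 t - m0 t) / h\<bar> \<le> \<eta> / 2 + (\<eta> / (2 * h\<^sup>2) + C / h) * w t" if t: "t > 0" for t
  proof -
    have sl: "continuous_on \<Omega> (\<lambda>x. \<phi> (t, x))" "continuous_on \<Omega> (\<lambda>x. snd (G (t, x)))"
      using slice_continuous[OF \<phi>] slice_continuous[OF G2] by auto
    define k where "k = nat \<lceil>t / h\<rceil> - 1"
    have k: "nat \<lceil>t / h\<rceil> = Suc k" using idx[OF t] by (simp only: k_def)
    have "\<bar>(LINT x:\<Omega>|R h (Suc k). snd (G (t, x)) \<bullet> ((x - S h k x) /\<^sub>R h)) -
        ((LINT x:\<Omega>|R h (Suc k). \<phi> (t, x)) - (LINT x:\<Omega>|R h k. \<phi> (t, x))) / h\<bar>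
      \<le> \<eta> / 2 + (\<eta> / (2 * h\<^sup>2) + C / h) * (W2 \<Omega> (R h (Suc k)) (R h k))\<^sup>2"
    proof (rule transport_taylor_error[OF compact_domain_facts(1) maps[OF h(1)] R_prob[OF h(1)] R_prob[OF h(1)] sl h(1) C \<eta>])
      fix x y assume "x \<in> \<Omega>" "y \<in> \<Omega>"
      then show "\<bar>\<phi> (t, y) - \<phi> (t, x) - (y - x) \<bullet> snd (G (t, x))\<bar> \<le> \<eta> * norm (y - x) + C * (norm (y - x))\<^sup>2"
        using taylor[of "(t, x)" "(t, y)"] by (simp add: inner_prod_def norm_Pair)
    qed
    then show ?thesis
      by (simp add: v_def m1_def m0_def w_def interp_curve_def interp_velocity_def k)
  qed
  have err2: "\<bar>(m1 t - ms t) / h + p t\<bar> \<le> \<eta> + C * h" for t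
  proof -
    let ?M = "interp_curve h (R h) t"
    interpret M: prob_space ?M using prob_onD(1)[OF interp_prob[OF h(1)]] .
    note s = prob_onD(2)[OF interp_prob[OF h(1), of t]]
    have i: "set_integrable ?M \<Omega> (\<lambda>x. \<phi> (t, x))" "set_integrable ?M \<Omega> (\<lambda>x. \<phi> (t + h, x))" "set_integrable ?M \<Omega> (\<lambda>x. fst (G (t, x)))"
      using slice_continuous[OF \<phi>] slice_continuous[OF G1]
      by (auto intro!: set_integrable_continuous_compact[OF M.finite_measure_axioms s compact_domain_facts(1)])
    have "(m1 t - ms t) / h + p t = (LINT x:\<Omega>|?M. (\<phi> (t, x) - \<phi> (t + h, x)) / h + fst (G (t, x)))"
      unfolding m1_def ms_def p_def using i by simp
    moreover have "\<bar>LINT x:\<Omega>|?M. (\<phi> (t, x) - \<phi> (t + h, x)) / h + fst (G (t, x))\<bar> \<le> \<eta> + C * h"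
    proof (rule set_integral_abs_le_bound[OF interp_prob[OF h(1)]])
      fix x assume "x \<in> \<Omega>"
      then have "\<bar>\<phi> (t + h, x) - \<phi> (t, x) - h * fst (G (t, x))\<bar> \<le> \<eta> * h + C * h\<^sup>2"
        using taylor[of "(t, x)" "(t + h, x)"] h by (simp add: inner_prod_def norm_Pair)
      moreover have "(\<phi> (t, x) - \<phi> (t + h, x)) / h + fst (G (t, x)) = - ((\<phi> (t + h, x) - \<phi> (t, x) - h * fst (G (t, x))) / h)"
        using h by (simp add: field_simps)
      ultimately have "\<bar>(\<phi> (t, x) - \<phi> (t + h, x)) / h + fst (G (t, x))\<bar> \<le> (\<eta> * h + C * h\<^sup>2) / h"
        using h by (simp add: abs_divide divide_right_mono)
      then show "\<bar>(\<phi> (t, x) - \<phi> (t + h, x)) / h + fst (G (t, x))\<bar> \<le> \<eta> + C * h"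
        using h by (simp add: add_divide_distrib power2_eq_square)
    qed (use \<eta> C h in simp)
    ultimately show ?thesis by simp
  qed
  have shift: "(LINT t:?I|lborel. m0 t) = (LINT t:?I|lborel. ms t)"
    unfolding m0_def ms_def by (rule time_shift[OF h]) (use supp K(3) in blast)
  have iw: "set_integrable lborel ?I w" and Iw: "(LINT t:?I|lborel. w t) \<le> h\<^sup>2 * C0"
    unfolding w_def using C0 by auto
  have ic: "set_integrable lborel ?I (\<lambda>_. c)" for c :: real
    unfolding set_integrable_def real_scaleR_def
    by (intro integrable_mult_left integrable_real_indicator) (use final_time in auto)
  have Ic: "(LINT t:?I|lborel. c) = T * c" for c :: real
    using final_time by (simp add: set_lebesgue_integral_def)
  have iv: "set_integrable lborel ?I v"
  proof -
    have "integrable lborel (\<lambda>t. indicat_real ?I t * v t)"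
    proof (rule Bochner_Integration.integrable_bound)
      show "integrable lborel (\<lambda>t. indicat_real ?I t * (\<bar>(m1 t - m0 t) / h\<bar> + (\<eta> / 2 + (\<eta> / (2 * h\<^sup>2) + C / h) * w t)))"
      proof -
        have "set_integrable lborel ?I (\<lambda>t. \<bar>(m1 t - m0 t) / h\<bar> + (\<eta> / 2 + (\<eta> / (2 * h\<^sup>2) + C / h) * w t))"
          using im1 im0 ic iw by (intro set_integral_add(1) set_integrable_abs set_integral_diff(1) set_integrable_divide set_integrable_mult_right)
        then show ?thesis by (simp add: set_integrable_def)
      qed
      show "AE t in lborel. norm (indicat_real ?I t * v t) \<le>
        norm (indicat_real ?I t * (\<bar>(m1 t - m0 t) / h\<bar> + (\<eta> / 2 + (\<eta> / (2 * h\<^sup>2) + C / h) * w t)))"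
      proof (intro AE_I2)
        fix t show "norm (indicat_real ?I t * v t) \<le>
          norm (indicat_real ?I t * (\<bar>(m1 t - m0 t) / h\<bar> + (\<eta> / 2 + (\<eta> / (2 * h\<^sup>2) + C / h) * w t)))"
        proof (cases "t \<in> ?I")
          case True
          then have "\<bar>v t\<bar> \<le> \<bar>(m1 t - m0 t) / h\<bar> + (\<eta> / 2 + (\<eta> / (2 * h\<^sup>2) + C / h) * w t)"
          proof -
            have "\<bar>x\<bar> \<le> \<bar>q\<bar> + r'" if "\<bar>x - q\<bar> \<le> r'" for x q r' :: real using that by linarith
            moreover have "0 < t" using True by simp
            ultimately show ?thesis using err1 by blast
          qed
          then have "\<bar>v t\<bar> \<le> \<bar>\<bar>(m1 t - m0 t) / h\<bar> + (\<eta> / 2 + (\<eta> / (2 * h\<^sup>2) + C / h) * w t)\<bar>"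
            by (rule order_trans[OF _ abs_ge_self])
          then show ?thesis using True by (simp only: indicator_simps mult_1_left real_norm_def)
        qed simp
      qed
    qed (use vm in measurable)
    then show ?thesis by (simp add: set_integrable_def)
  qed
  have Z: "(LINT t:?I|lborel. v t) + (LINT t:?I|lborel. p t)
     = (LINT t:?I|lborel. v t - (m1 t - m0 t) / h) + (LINT t:?I|lborel. (m1 t - ms t) / h + p t)"
    using iv ip im1 im0 ims shift by (simp add: diff_divide_distrib)
  have abs_bound: "\<bar>LINT t:?I|lborel. f t\<bar> \<le> (LINT t:?I|lborel. g t)"
    if "set_integrable lborel ?I f" "set_integrable lborel ?I g" "\<And>t. t \<in> ?I \<Longrightarrow> \<bar>f t\<bar> \<le> g t" for f g :: "real \<Rightarrow> real"
  proof -
    have "\<bar>LINT t:?I|lborel. f t\<bar> \<le> (LINT t:?I|lborel. \<bar>f t\<bar>)"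
      using integral_abs_bound[of lborel "\<lambda>t. indicat_real ?I t * f t"] by (simp add: set_lebesgue_integral_def abs_mult)
    also have "\<dots> \<le> (LINT t:?I|lborel. g t)"
      using that by (intro set_integral_mono set_integrable_abs) auto
    finally show ?thesis .
  qed
  have "\<bar>LINT t:?I|lborel. v t - (m1 t - m0 t) / h\<bar> \<le> (LINT t:?I|lborel. \<eta> / 2 + (\<eta> / (2 * h\<^sup>2) + C / h) * w t)"
    by (rule abs_bound) (use iv im1 im0 ic iw err1 in \<open>auto intro!: set_integral_add(1) set_integral_diff(1) set_integrable_divide set_integrable_mult_right\<close>)
  also have "\<dots> = T * (\<eta> / 2) + (\<eta> / (2 * h\<^sup>2) + C / h) * (LINT t:?I|lborel. w t)"
    using ic iw by (simp add: Ic)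
  also have "\<dots> \<le> T * (\<eta> / 2) + (\<eta> / (2 * h\<^sup>2) + C / h) * (h\<^sup>2 * C0)"
    using Iw C \<eta> h by (intro add_left_mono mult_left_mono) auto
  also have "\<dots> = \<eta> * (T / 2 + C0 / 2) + h * (C * C0)"
    using h by (simp add: field_simps power2_eq_square)
  finally have 1: "\<bar>LINT t:?I|lborel. v t - (m1 t - m0 t) / h\<bar> \<le> \<eta> * (T / 2 + C0 / 2) + h * (C * C0)" .
  have 2: "\<bar>LINT t:?I|lborel. (m1 t - ms t) / h + p t\<bar> \<le> T * (\<eta> + C * h)"
  proof -
    have "\<bar>LINT t:?I|lborel. (m1 t - ms t) / h + p t\<bar> \<le> (LINT t:?I|lborel. \<eta> + C * h)"
      by (rule abs_bound) (use im1 ims ip ic err2 in \<open>auto intro!: set_integral_add(1) set_integral_diff(1) set_integrable_divide\<close>)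
    then show ?thesis by (simp add: Ic)
  qed
  have DM: "discrete_momentum_integral \<Omega> T h (R h) (S h) (\<lambda>z. snd (G z)) = (LINT t:?I|lborel. v t)"
    unfolding discrete_momentum_integral_def v_def[symmetric] by (rule set_integral_Icc_eq_Ioo[OF vm])
  show ?thesis
    unfolding DM p_def[symmetric] using 1 2 Z by (simp add: algebra_simps)
qed

text \<open>In \<open>discrete_continuity_error\<close> the constant \<open>C\<close> depends on \<open>\<eta>\<close>. Therefore \<open>\<eta>\<close> is chosen first, in terms of the
  required accuracy, and the time step afterwards.\<close>

lemma continuity_eq_holds: "continuity_eq_noflux \<Omega> T \<rho> E"
  unfolding continuity_eq_noflux_def
proof (intro allI impI)
  fix \<phi> :: "real \<times> 'a \<Rightarrow> real" and G
  let ?A = "{0<..<T} \<times> \<Omega>" and ?X = "(UNIV :: real set) \<times> \<Omega>" and ?O = "{0<..<T} \<times> (UNIV :: 'a set)"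
  assume "C1_scalar ?A \<phi> G \<and> compactly_supported_in ?A \<phi>"
  then obtain K where \<phi>G: "C1_scalar ?A \<phi> G" and K: "compact K" "K \<subseteq> ?A" "\<And>z. z \<in> ?A - K \<Longrightarrow> \<phi> z = 0"
    by (auto simp: compactly_supported_in_def)
  have XO: "?X \<inter> ?O = ?A" by auto
  have oO: "open ?O" by (intro open_Times) auto
  have KX: "K \<subseteq> ?X" and KO: "K \<subseteq> ?O" using K(2) by auto
  have dense: "?A \<subseteq> closure (interior ?A)"
    using compact_domain_facts(4) closure_subset by (auto simp: interior_Times closure_Times)
  have Gz: "G z = 0" if "z \<in> ?A - K" for z
    by (rule C1_scalar_gradient_vanishes[OF \<phi>G K(1) K(3) dense that])
  define \<phi>0 where "\<phi>0 = (\<lambda>z. if z \<in> ?A then \<phi> z else 0)"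
  define G0 where "G0 = (\<lambda>z. if z \<in> ?A then G z else 0)"
  obtain W where W: "open W" "?A \<subseteq> W" "continuous_on W G" "\<And>z. z \<in> W \<Longrightarrow> GDERIV \<phi> z :> G z"
    using \<phi>G by (auto simp: C1_scalar_def)
  have \<phi>c: "continuous_on ?A \<phi>"
  proof (intro continuous_at_imp_continuous_on ballI)
    fix z assume "z \<in> ?A"
    then have "(\<phi> has_derivative (\<lambda>k. k \<bullet> G z)) (at z)" using W(4)[of z] W(2) by (auto simp: gderiv_def)
    then show "isCont \<phi> z" by (rule has_derivative_continuous)
  qed
  have \<phi>0c: "continuous_on ?X \<phi>0"
    using zero_extension_continuous[OF oO K(1) _ _ KO, of ?X \<phi>] \<phi>c K(3) unfolding XO \<phi>0_def by blast
  have G0c: "continuous_on ?X G0"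
    using zero_extension_continuous[OF oO K(1) _ _ KO, of ?X G] continuous_on_subset[OF W(3,2)] Gz
    unfolding XO G0_def by blast
  have \<phi>0z: "\<phi>0 z = 0" and G0z: "G0 z = 0" if "z \<notin> K" for z
    using that K(3) Gz by (auto simp: \<phi>0_def G0_def)
  have fstK: "compact (fst ` K)" "fst ` K \<subseteq> {0<..<T}"
    using K(1,2) by (auto intro!: compact_continuous_image continuous_intros)
  obtain r where r: "r > 0" "(\<Union>x\<in>fst ` K. cball x r) \<subseteq> {0<..<T}"
    by (rule compact_subset_open_imp_cball_epsilon_subset[OF fstK(1) open_greaterThanLessThan fstK(2)])
  have K_r: "K \<subseteq> {r<..<T} \<times> \<Omega>"
  proof
    fix z assume z: "z \<in> K"
    then have "cball (fst z) r \<subseteq> {0<..<T}" using r(2) by blast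
    moreover have "fst z - r \<in> cball (fst z) r" using r(1) by (simp add: dist_norm)
    ultimately have "fst z - r \<in> {0<..<T}" by blast
    then show "z \<in> {r<..<T} \<times> \<Omega>" using z K(2) by (cases z) auto
  qed
  have G1c: "continuous_on ?X (\<lambda>z. fst (G0 z))" by (intro continuous_intros G0c)
  obtain B where B: "B \<ge> 0" "\<And>z. \<bar>fst (G0 z)\<bar> \<le> B"
    using compactly_supported_bounded[OF K(1) KX G1c] G0z by auto
  define P where "P j = (LINT t:{0<..<T}|lborel. LINT x:\<Omega>|interp_curve (\<tau> j) (R (\<tau> j)) t. fst (G0 (t, x)))" for j
  define Q where "Q j = discrete_momentum_integral \<Omega> T (\<tau> j) (R (\<tau> j)) (S (\<tau> j)) (\<lambda>z. snd (G0 z))" for j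
  have P: "P \<longlonglongrightarrow> (LINT t:{0<..<T}|lborel. LINT x:\<Omega>|\<rho> t. fst (G0 (t, x)))"
    unfolding P_def by (rule interp_integral_converges[OF G1c B(2,1)])
  have "continuous_on ({0..T} \<times> \<Omega>) (\<lambda>z. snd (G0 z))"
    by (intro continuous_intros continuous_on_subset[OF G0c]) auto
  then have Q: "Q \<longlonglongrightarrow> vintegral ({0..T} \<times> \<Omega>) E (\<lambda>z. snd (G0 z))"
    unfolding Q_def by (rule momentum_convergence)
  obtain C0 where C0: "C0 \<ge> 0" "\<And>h. h > 0 \<Longrightarrow>
     set_integrable lborel {0<..<T} (\<lambda>t. (W2 \<Omega> (R h (Suc (nat \<lceil>t / h\<rceil> - 1))) (R h (nat \<lceil>t / h\<rceil> - 1)))\<^sup>2)"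
    "\<And>h. h > 0 \<Longrightarrow>
     (LINT t:{0<..<T}|lborel. (W2 \<Omega> (R h (Suc (nat \<lceil>t / h\<rceil> - 1))) (R h (nat \<lceil>t / h\<rceil> - 1)))\<^sup>2) \<le> h\<^sup>2 * C0"
    using interp_cost_integral by blast
  define A where "A = 3 * T / 2 + C0 / 2"
  have A: "A > 0" using final_time C0(1) by (simp add: A_def)
  have "(\<lambda>j. Q j + P j) \<longlonglongrightarrow> 0"
  proof (rule tendstoI)
    fix e :: real assume e: "e > 0"
    define \<eta> where "\<eta> = e / (2 * A)"
    have \<eta>: "\<eta> > 0" using e A by (simp add: \<eta>_def)
    obtain C where C: "C \<ge> 0" "\<And>z z'. z \<in> ?X \<Longrightarrow> z' \<in> ?X \<Longrightarrow>
       \<bar>\<phi>0 z' - \<phi>0 z - (z' - z) \<bullet> G0 z\<bar> \<le> \<eta> * norm (z' - z) + C * (norm (z' - z))\<^sup>2"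
      using C1_scalar_zero_extension_taylor[of ?X ?O \<phi> G K \<eta>] \<phi>G oO K Gz \<eta> unfolding XO \<phi>0_def G0_def by blast
    have lim: "(\<lambda>j. \<eta> * A + \<tau> j * (C * C0 + C * T)) \<longlonglongrightarrow> \<eta> * A + 0 * (C * C0 + C * T)"
      by (intro tendsto_intros steps(2))
    have "\<eta> * A + 0 * (C * C0 + C * T) < e" using e A by (simp add: \<eta>_def)
    then have "eventually (\<lambda>j. \<eta> * A + \<tau> j * (C * C0 + C * T) < e) sequentially"
      by (rule order_tendstoD(2)[OF lim])
    moreover have "eventually (\<lambda>j. \<tau> j < r) sequentially" by (rule order_tendstoD(2)[OF steps(2) r(1)])
    ultimately show "eventually (\<lambda>j. dist (Q j + P j) 0 < e) sequentially"
    proof eventually_elim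
      case (elim j)
      have "\<bar>Q j + P j\<bar> \<le> \<eta> * A + \<tau> j * (C * C0 + C * T)"
        unfolding Q_def P_def A_def
        by (rule discrete_continuity_error[OF steps(1) less_imp_le[OF elim(2)] \<phi>0c G0c K(1) K_r \<phi>0z G0z C(1)
          less_imp_le[OF \<eta>] C(2) C0(1) C0(2)[OF steps(1)] C0(3)[OF steps(1)]])
      then show ?case using elim(1) by simp
    qed
  qed
  from LIMSEQ_unique[OF tendsto_add[OF Q P] this]
  have "vintegral ({0..T} \<times> \<Omega>) E (\<lambda>z. snd (G0 z)) + (LINT t:{0<..<T}|lborel. LINT x:\<Omega>|\<rho> t. fst (G0 (t, x))) = 0" .
  moreover have "vintegral ({0..T} \<times> \<Omega>) E (\<lambda>z. snd (G0 z)) = vintegral ?A E (\<lambda>z. snd (G z))"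
    unfolding vintegral_def set_lebesgue_integral_def
    by (intro Bochner_Integration.integral_cong refl) (auto simp: indicator_def G0_def)
  moreover have "(LINT t:{0<..<T}|lborel. LINT x:\<Omega>|\<rho> t. fst (G0 (t, x))) = (LINT t:{0<..<T}|lborel. LINT x:\<Omega>|\<rho> t. fst (G (t, x)))"
    unfolding set_lebesgue_integral_def
    by (intro Bochner_Integration.integral_cong refl)
      (auto simp: indicator_def G0_def intro!: Bochner_Integration.integral_cong)
  ultimately show "(LINT t:{0<..<T}|lborel. LINT x:\<Omega>|\<rho> t. fst (G (t, x))) + vintegral ?A E (\<lambda>z. snd (G z)) = 0"
    by simp
qed

text \<open>The continuity equation is tested with \<open>\<phi>\<close> and the flux law with \<open>\<nabla>\<phi>\<close>; the momentum \<open>E\<close> cancels.\<close>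

lemma fokker_planck_interior_holds: "fokker_planck_interior \<Omega> gradV T \<rho>"
  unfolding fokker_planck_interior_def
proof (intro allI impI)
  fix \<phi> :: "real \<times> 'a \<Rightarrow> real" and G D
  let ?A = "{0<..<T} \<times> interior \<Omega>" and ?I = "{0<..<T}"
  assume "C1_scalar ?A \<phi> G \<and> C1_field ?A (\<lambda>z. snd (G z)) D \<and> compactly_supported_in ?A \<phi>"
  then obtain K where \<phi>G: "C1_scalar ?A \<phi> G" and GD: "C1_field ?A (\<lambda>z. snd (G z)) D"
    and K: "compact K" "K \<subseteq> ?A" "\<forall>z\<in>?A - K. \<phi> z = 0"
    by (auto simp: compactly_supported_in_def)
  have oA: "open ?A" by (intro open_Times) auto
  have sub: "?A \<subseteq> ?I \<times> \<Omega>" using interior_subset by auto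
  \<comment> \<open>The continuity equation is tested with functions on \<open>{0<..<T} \<times> \<Omega>\<close>, so \<open>\<phi>\<close> is extended by zero up to the boundary.\<close>
  define \<phi>0 where "\<phi>0 = (\<lambda>z. if z \<in> ?A then \<phi> z else 0)"
  define G0 where "G0 = (\<lambda>z. if z \<in> ?A then G z else 0)"
  have \<phi>0d: "GDERIV \<phi>0 z :> G0 z" for z
    unfolding \<phi>0_def G0_def by (rule C1_scalar_zero_extension(1)[OF oA \<phi>G K])
  have G0c: "continuous_on UNIV G0"
    unfolding G0_def by (rule C1_scalar_zero_extension(2)[OF oA \<phi>G K])
  have \<phi>0z: "\<phi>0 z = 0" and G0z: "G0 z = 0" if "z \<notin> K" for z
    unfolding \<phi>0_def G0_def by (rule C1_scalar_zero_extension(3,4)[OF oA \<phi>G K that])+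
  have Gz: "\<forall>z\<in>?A - K. snd (G z) = 0"
  proof
    fix z assume z: "z \<in> ?A - K"
    then have "G0 z = 0" using G0z[of z] by blast
    moreover have "G0 z = G z" unfolding G0_def using z by simp
    ultimately show "snd (G z) = 0" by simp
  qed
  define D0 where "D0 = (\<lambda>z. if z \<in> ?A then D z else 0)"
  have D0c: "continuous_on UNIV D0"
    unfolding D0_def by (rule C1_field_zero_extension(2)[OF oA GD K(1,2) Gz])
  have D0z: "D0 z = 0" if "z \<notin> K" for z
    unfolding D0_def by (rule C1_field_zero_extension(4)[OF oA GD K(1,2) Gz that])
  have cX: "continuous_on X G0" "continuous_on X D0" for X
    using continuous_on_subset[OF G0c] continuous_on_subset[OF D0c] by auto
  define g1 where "g1 z = fst (G0 z)" for z
  define g2 where "g2 = space_div D0"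
  define g3 where "g3 z = snd (G0 z) \<bullet> gradV (snd z)" for z
  have g1c: "continuous_on (UNIV \<times> \<Omega>) g1" unfolding g1_def by (intro continuous_intros cX)
  have g2c: "continuous_on (UNIV \<times> \<Omega>) g2" unfolding g2_def space_div_def by (intro continuous_intros cX)
  have g3c: "continuous_on (UNIV \<times> \<Omega>) g3"
    unfolding g3_def by (intro continuous_intros cX continuous_on_compose2[OF gradV_continuous]) auto
  have gz: "g1 z = 0" "g2 z = 0" "g3 z = 0" if "z \<notin> K" for z
    using G0z[OF that] D0z[OF that] by (simp_all add: g1_def g2_def g3_def space_div_def)
  have KX: "K \<subseteq> UNIV \<times> \<Omega>" using K(2) sub by auto
  obtain B1 where B1: "B1 \<ge> 0" "\<And>z. \<bar>g1 z\<bar> \<le> B1"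
    using compactly_supported_bounded[OF K(1) KX g1c gz(1)] by blast
  obtain B2 where B2: "B2 \<ge> 0" "\<And>z. \<bar>g2 z\<bar> \<le> B2"
    using compactly_supported_bounded[OF K(1) KX g2c gz(2)] by blast
  obtain B3 where B3: "B3 \<ge> 0" "\<And>z. \<bar>g3 z\<bar> \<le> B3"
    using compactly_supported_bounded[OF K(1) KX g3c gz(3)] by blast
  have "C1_scalar (?I \<times> \<Omega>) \<phi>0 G0" unfolding C1_scalar_def using \<phi>0d G0c by (intro exI[of _ UNIV]) auto
  moreover have "compactly_supported_in (?I \<times> \<Omega>) \<phi>0"
    unfolding compactly_supported_in_def using K(1,2) sub \<phi>0z by blast
  ultimately have 1: "(LINT t:?I|lborel. LINT x:\<Omega>|\<rho> t. g1 (t, x)) + vintegral (?I \<times> \<Omega>) E (\<lambda>z. snd (G0 z)) = 0"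
    using continuity_eq_holds unfolding continuity_eq_noflux_def g1_def by blast
  have "compactly_supported_in ?A (\<lambda>z. snd (G z))"
    unfolding compactly_supported_in_def using K(1,2) Gz by blast
  with GD have 2: "vintegral ?A E (\<lambda>z. snd (G z)) =
     (LINT t:?I|lborel. LINT x:interior \<Omega>|\<rho> t. space_div D (t, x)) - (LINT t:?I|lborel. LINT x:interior \<Omega>|\<rho> t. snd (G (t, x)) \<bullet> gradV x)"
    using flux_law_holds unfolding flux_law_def by blast
  have 3: "vintegral (?I \<times> \<Omega>) E (\<lambda>z. snd (G0 z)) = vintegral ?A E (\<lambda>z. snd (G z))"
    unfolding vintegral_def set_lebesgue_integral_def
    using interior_subset[of \<Omega>] by (intro Bochner_Integration.integral_cong refl) (auto simp: indicator_def G0_def)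
  have 4: "(LINT t:?I|lborel. LINT x:interior \<Omega>|\<rho> t. space_div D (t, x)) = (LINT t:?I|lborel. LINT x:\<Omega>|\<rho> t. g2 (t, x))"
    unfolding set_lebesgue_integral_def
    using interior_subset[of \<Omega>] by (intro Bochner_Integration.integral_cong refl)
      (auto simp: indicator_def g2_def D0_def space_div_def intro!: Bochner_Integration.integral_cong)
  have 5: "(LINT t:?I|lborel. LINT x:interior \<Omega>|\<rho> t. snd (G (t, x)) \<bullet> gradV x) = (LINT t:?I|lborel. LINT x:\<Omega>|\<rho> t. g3 (t, x))"
    unfolding set_lebesgue_integral_def
    using interior_subset[of \<Omega>] by (intro Bochner_Integration.integral_cong refl)
      (auto simp: indicator_def g3_def G0_def intro!: Bochner_Integration.integral_cong)
  have 6: "(LINT x:interior \<Omega>|\<rho> t. fst (G (t, x)) + space_div D (t, x) - snd (G (t, x)) \<bullet> gradV x)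
     = (LINT x:\<Omega>|\<rho> t. g1 (t, x)) + (LINT x:\<Omega>|\<rho> t. g2 (t, x)) - (LINT x:\<Omega>|\<rho> t. g3 (t, x))" if t: "t \<in> ?I" for t
  proof -
    have \<rho>: "\<rho> t \<in> prob_on \<Omega>" using t by (intro limit_curve) auto
    interpret M: prob_space "\<rho> t" using prob_onD(1)[OF \<rho>] .
    have i: "set_integrable (\<rho> t) \<Omega> (\<lambda>x. g1 (t, x))" "set_integrable (\<rho> t) \<Omega> (\<lambda>x. g2 (t, x))" "set_integrable (\<rho> t) \<Omega> (\<lambda>x. g3 (t, x))"
      using slice_continuous[OF g1c] slice_continuous[OF g2c] slice_continuous[OF g3c]
      by (auto intro!: set_integrable_continuous_compact[OF M.finite_measure_axioms prob_onD(2)[OF \<rho>] compact_domain_facts(1)])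
    have "(LINT x:interior \<Omega>|\<rho> t. fst (G (t, x)) + space_div D (t, x) - snd (G (t, x)) \<bullet> gradV x)
      = (LINT x:\<Omega>|\<rho> t. g1 (t, x) + g2 (t, x) - g3 (t, x))"
      unfolding set_lebesgue_integral_def
      using interior_subset[of \<Omega>] t by (intro Bochner_Integration.integral_cong refl)
        (auto simp: indicator_def g1_def g2_def g3_def G0_def D0_def space_div_def)
    then show ?thesis using i by simp
  qed
  have "(LINT t:?I|lborel. LINT x:interior \<Omega>|\<rho> t. fst (G (t, x)) + space_div D (t, x) - snd (G (t, x)) \<bullet> gradV x)
    = (LINT t:?I|lborel. (LINT x:\<Omega>|\<rho> t. g1 (t, x)) + (LINT x:\<Omega>|\<rho> t. g2 (t, x)) - (LINT x:\<Omega>|\<rho> t. g3 (t, x)))"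
    unfolding set_lebesgue_integral_def[of lborel]
    using 6 by (intro Bochner_Integration.integral_cong refl) (auto simp: indicator_def)
  also have "\<dots> = (LINT t:?I|lborel. LINT x:\<Omega>|\<rho> t. g1 (t, x)) + (LINT t:?I|lborel. LINT x:\<Omega>|\<rho> t. g2 (t, x)) - (LINT t:?I|lborel. LINT x:\<Omega>|\<rho> t. g3 (t, x))"
    using limit_integral_integrable[OF g1c B1(2,1)] limit_integral_integrable[OF g2c B2(2,1)] limit_integral_integrable[OF g3c B3(2,1)]
    by simp
  also have "\<dots> = 0" using 1 2 3 4 5 by simp
  finally show "(LINT t:?I|lborel. LINT x:interior \<Omega>|\<rho> t. fst (G (t, x)) + space_div D (t, x) - snd (G (t, x)) \<bullet> gradV x) = 0" .
qed

end

section \<open>Curves of finite energy are absolutely continuous\<close>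

lemma triangle_inequality_chain:
  fixes D :: "'b \<Rightarrow> 'b \<Rightarrow> real" and u :: "nat \<Rightarrow> 'b"
  assumes diag: "D (u 0) (u 0) = 0"
    and tri: "\<And>k. k < n \<Longrightarrow> D (u 0) (u (Suc k)) \<le> D (u 0) (u k) + D (u k) (u (Suc k))"
  shows "D (u 0) (u n) \<le> (\<Sum>k<n. D (u k) (u (Suc k)))"
  using tri
proof (induction n)
  case (Suc n)
  have "D (u 0) (u n) \<le> (\<Sum>k<n. D (u k) (u (Suc k)))" by (rule Suc.IH) (use Suc.prems in auto)
  then show ?case using Suc.prems[of n] by simp
qed (simp add: diag)

text \<open>The variance identity behind the martingale argument: when an interval of length \<open>p \<delta>\<close>, carrying the
  difference quotient \<open>b / (p \<delta>)\<close>, is divided into \<open>p\<close> equal parts, the \<open>L\<^sup>2\<close> distance between the old and the new quotients is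
  controlled by the growth of the energy. The hypothesis on \<open>b\<close> is the triangle inequality.\<close>

lemma refinement_defect:
  fixes c :: "nat \<Rightarrow> real"
  assumes \<delta>: "\<delta> > 0" and p: "p > 0" and c: "b \<le> (\<Sum>q<p. c q)" and b: "b \<ge> 0"
  shows "\<delta> * (\<Sum>q<p. (c q / \<delta> - b / (real p * \<delta>))\<^sup>2) \<le> (\<Sum>q<p. (c q)\<^sup>2) / \<delta> - b\<^sup>2 / (real p * \<delta>)"
proof -
  have "\<delta> * (c q / \<delta> - b / (real p * \<delta>))\<^sup>2 = (c q)\<^sup>2 / \<delta> - 2 * b / (real p * \<delta>) * c q + b\<^sup>2 / (real p * \<delta>) / real p" for q
    using \<delta> p by (simp add: field_simps power2_eq_square)
  then have expand: "\<delta> * (\<Sum>q<p. (c q / \<delta> - b / (real p * \<delta>))\<^sup>2) =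
     (\<Sum>q<p. (c q)\<^sup>2) / \<delta> - 2 * b / (real p * \<delta>) * (\<Sum>q<p. c q) + b\<^sup>2 / (real p * \<delta>)"
    using p by (simp add: sum_distrib_left sum.distrib sum_subtractf sum_divide_distrib)
  have cross: "2 * b / (real p * \<delta>) * b \<le> 2 * b / (real p * \<delta>) * (\<Sum>q<p. c q)"
    using c b \<delta> p by (intro mult_left_mono) auto
  have square: "2 * b / (real p * \<delta>) * b = b\<^sup>2 / (real p * \<delta>) + b\<^sup>2 / (real p * \<delta>)"
    by (simp add: power2_eq_square ac_simps)
  have "L \<le> P - B" if "L = P - Q + B" "R \<le> Q" "R = B + B" for L P Q B R :: real
    using that by linarith
  from this[OF expand cross square] show ?thesis .
qed

text \<open>Let \<open>d n i\<close> be the distance travelled over the \<open>i\<close>-th dyadic interval of length \<open>\<delta> n\<close>, and \<open>a n\<close> the energy of the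
  level-\<open>n\<close> difference quotients. The energies increase with \<open>n\<close> and stay below \<open>C\<close>, and by
  \<open>refinement_defect\<close> the quotients of two levels differ in \<open>L\<^sup>2\<close> by at most the increase of energy between them.
  Along levels \<open>N k\<close> at which the remaining increase is at most \<open>1 / 4 ^ k\<close>, the successive differences are
  summable in \<open>L\<^sup>1\<close>. The sum \<open>g\<close> of the first quotient and of all absolute differences is integrable and
  dominates the quotients of all levels \<open>N k\<close>; hence it dominates the distance between grid points,
  and by the Hoelder bound \<open>short\<close> the distance between arbitrary times.\<close>

lemma finite_energy_curve_abs_continuous:
  fixes D :: "real \<Rightarrow> real \<Rightarrow> real"
  assumes T: "T > 0" and C: "C \<ge> 0"
    and nonneg: "\<And>s t. s \<in> {0..T} \<Longrightarrow> t \<in> {0..T} \<Longrightarrow> 0 \<le> D s t"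
    and diag: "\<And>s. s \<in> {0..T} \<Longrightarrow> D s s = 0"
    and tri: "\<And>s t u. s \<in> {0..T} \<Longrightarrow> t \<in> {0..T} \<Longrightarrow> u \<in> {0..T} \<Longrightarrow> D s u \<le> D s t + D t u"
    and energy: "\<And>s \<delta> N. 0 \<le> s \<Longrightarrow> 0 \<le> \<delta> \<Longrightarrow> s + real N * \<delta> \<le> T \<Longrightarrow>
       (\<Sum>i<N. (D (s + real i * \<delta>) (s + real (Suc i) * \<delta>))\<^sup>2) \<le> \<delta> * C"
  obtains g where "set_integrable lborel {0..T} g"
    "\<And>s t. 0 \<le> s \<Longrightarrow> s \<le> t \<Longrightarrow> t \<le> T \<Longrightarrow> D s t \<le> (LINT r:{s..t}|lborel. g r)"
proof -
  define \<delta> where "\<delta> n = T / 2 ^ n" for n :: nat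
  have \<delta>: "\<delta> n > 0" for n using T by (simp add: \<delta>_def)
  have \<delta>T: "2 ^ n * \<delta> n = T" for n by (simp add: \<delta>_def)
  have grid: "real i * \<delta> n \<in> {0..T}" if "i \<le> 2 ^ n" for i n
  proof -
    have "real i * \<delta> n \<le> 2 ^ n * \<delta> n" using that \<delta>[of n] by (intro mult_right_mono) (auto simp: of_nat_le_iff[symmetric] simp del: of_nat_le_iff)
    then show ?thesis using \<delta>[of n] \<delta>T by simp
  qed
  define d where "d n i = D (real i * \<delta> n) (real (Suc i) * \<delta> n)" for n i
  have d: "0 \<le> d n i" if "i < 2 ^ n" for n i
    unfolding d_def using that by (intro nonneg grid) auto
  define a where "a n = (\<Sum>i<2 ^ n. (d n i)\<^sup>2) / \<delta> n" for n
  have aC: "a n \<le> C" for n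
  proof -
    have "(\<Sum>i<2 ^ n. (d n i)\<^sup>2) \<le> \<delta> n * C"
      using energy[of 0 "\<delta> n" "2 ^ n"] \<delta>[of n] \<delta>T[of n] by (simp add: d_def)
    then show ?thesis using \<delta>[of n] by (simp add: a_def field_simps)
  qed
  have chain: "D (real i * \<delta> n) (real j * \<delta> n) \<le> (\<Sum>k=i..<j. d n k)" if "i \<le> j" "j \<le> 2 ^ n" for i j n
  proof -
    have "D (real (i + 0) * \<delta> n) (real (i + (j - i)) * \<delta> n) \<le> (\<Sum>k<j - i. D (real (i + k) * \<delta> n) (real (i + Suc k) * \<delta> n))"
      by (rule triangle_inequality_chain[where u = "\<lambda>k. real (i + k) * \<delta> n"]; intro diag tri grid; use that in simp)
    also have "\<dots> = (\<Sum>k=i..<j. d n k)"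
      using that(1) by (intro sum.reindex_bij_witness[of _ "\<lambda>k. k - i" "\<lambda>k. i + k"]) (auto simp: d_def)
    finally show ?thesis using that(1) by simp
  qed
  have \<delta>_refine: "\<delta> n = real (2 ^ (m - n)) * \<delta> m" if nm: "n \<le> m" for n m
  proof -
    have "(2::real) ^ m = 2 ^ n * 2 ^ (m - n)" using nm by (simp add: power_add[symmetric])
    then show ?thesis by (simp add: \<delta>_def)
  qed
  have defect: "\<delta> m * (\<Sum>l<2 ^ m. (d m l / \<delta> m - d n (l div 2 ^ (m - n)) / \<delta> n)\<^sup>2) \<le> a m - a n" if nm: "n \<le> m" for n m
  proof -
    define p :: nat where "p = 2 ^ (m - n)"
    have p: "p > 0" by (simp add: p_def)
    have pm: "2 ^ n * p = 2 ^ m" using nm by (simp add: p_def power_add[symmetric])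
    have \<delta>nm: "\<delta> n = real p * \<delta> m" unfolding p_def by (rule \<delta>_refine[OF nm])
    have group: "(\<Sum>l<2 ^ m. f l) = (\<Sum>i<2 ^ n. \<Sum>q<p. f (i * p + q))" for f :: "nat \<Rightarrow> real"
    proof -
      have "(\<Sum>l<2 ^ m. f l) = (\<Sum>i<2 ^ n. sum f {i * p..<i * p + p})"
        unfolding pm[symmetric] by (rule sum.nat_group[symmetric])
      also have "\<dots> = (\<Sum>i<2 ^ n. \<Sum>q<p. f (i * p + q))"
      proof (rule sum.cong[OF refl])
        fix i show "sum f {i * p..<i * p + p} = (\<Sum>q<p. f (i * p + q))"
          by (intro sum.reindex_bij_witness[of _ "\<lambda>q. i * p + q" "\<lambda>l. l - i * p"]) auto
      qed
      finally show ?thesis .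
    qed
    have "\<delta> m * (\<Sum>l<2 ^ m. (d m l / \<delta> m - d n (l div p) / \<delta> n)\<^sup>2)
       = (\<Sum>i<2 ^ n. \<delta> m * (\<Sum>q<p. (d m (i * p + q) / \<delta> m - d n i / (real p * \<delta> m))\<^sup>2))"
      unfolding group sum_distrib_left \<delta>nm using p by (intro sum.cong refl) (simp add: mult.commute)
    also have "\<dots> \<le> (\<Sum>i<2 ^ n. (\<Sum>q<p. (d m (i * p + q))\<^sup>2) / \<delta> m - (d n i)\<^sup>2 / (real p * \<delta> m))"
    proof (rule sum_mono)
      fix i :: nat assume "i \<in> {..<2 ^ n}"
      then have i: "i < 2 ^ n" by simp
      then have ip: "Suc i * p \<le> 2 ^ m" unfolding pm[symmetric] by (intro mult_right_mono) auto
      have "D (real (i * p) * \<delta> m) (real (Suc i * p) * \<delta> m) \<le> (\<Sum>k=i * p..<Suc i * p. d m k)"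
        by (rule chain[OF _ ip]) simp
      also have "(\<Sum>k=i * p..<Suc i * p. d m k) = (\<Sum>q<p. d m (i * p + q))"
        by (intro sum.reindex_bij_witness[of _ "\<lambda>q. i * p + q" "\<lambda>l. l - i * p"]) auto
      also have "D (real (i * p) * \<delta> m) (real (Suc i * p) * \<delta> m) = d n i"
        by (simp only: d_def \<delta>nm of_nat_mult mult.assoc)
      finally have "d n i \<le> (\<Sum>q<p. d m (i * p + q))" .
      then show "\<delta> m * (\<Sum>q<p. (d m (i * p + q) / \<delta> m - d n i / (real p * \<delta> m))\<^sup>2)
        \<le> (\<Sum>q<p. (d m (i * p + q))\<^sup>2) / \<delta> m - (d n i)\<^sup>2 / (real p * \<delta> m)"
        by (rule refinement_defect[OF \<delta> p _ d[OF i]])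
    qed
    also have "\<dots> = a m - a n"
      unfolding a_def group \<delta>nm by (simp add: sum_subtractf sum_divide_distrib)
    finally show ?thesis by (simp add: p_def)
  qed
  have a_mono: "a n \<le> a m" if "n \<le> m" for n m
  proof -
    have "0 \<le> \<delta> m * (\<Sum>l<2 ^ m. (d m l / \<delta> m - d n (l div 2 ^ (m - n)) / \<delta> n)\<^sup>2)"
      using \<delta>[of m] by (intro mult_nonneg_nonneg sum_nonneg) auto
    then show ?thesis using defect[OF that] by linarith
  qed
  obtain A where A: "a \<longlonglongrightarrow> A" "\<And>n. a n \<le> A"
    using incseq_convergent[of a C] a_mono aC by (auto simp: incseq_def)
  \<comment> \<open>The least good index is monotone in \<open>k\<close>, because an index that is good for \<open>Suc k\<close> is at least as good for \<open>k\<close>.\<close>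
  define good where "good k n \<longleftrightarrow> k \<le> n \<and> A - a n \<le> 1 / 4 ^ k" for k n :: nat
  have good_ex: "\<exists>n. good k n" for k
  proof -
    have "eventually (\<lambda>n. A - 1 / 4 ^ k < a n) sequentially" using order_tendstoD(1)[OF A(1)] by simp
    then obtain n where "\<And>m. m \<ge> n \<Longrightarrow> A - 1 / 4 ^ k < a m" by (auto simp: eventually_sequentially)
    from this[of "max n k"] show ?thesis by (intro exI[of _ "max n k"]) (auto simp: good_def)
  qed
  define N where "N k = (LEAST n. good k n)" for k
  have N: "k \<le> N k" "A - a (N k) \<le> 1 / 4 ^ k" for k
    using LeastI_ex[OF good_ex, of k] by (auto simp: N_def good_def)
  have N_mono: "N k \<le> N (Suc k)" for k
  proof -
    have "A - a (N (Suc k)) \<le> 1 / 4 ^ k"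
      using N(2)[of "Suc k"] by (rule order_trans) (simp add: field_simps)
    then have "good k (N (Suc k))" using N(1)[of "Suc k"] by (simp add: good_def)
    then show ?thesis unfolding N_def[of k] by (rule Least_le)
  qed
  define f where "f k t = d (N k) (nat \<lceil>t / \<delta> (N k)\<rceil> - 1) / \<delta> (N k)" for k t
  have fm[measurable]: "f k \<in> borel_measurable borel" for k
    unfolding f_def by (intro borel_measurable_divide measurable_compose[OF nat_ceiling_divide_measurable]) auto
  have f_nonneg: "0 \<le> f k t" if "t \<in> {0<..T}" for k t
  proof -
    have "t / \<delta> (N k) \<le> 2 ^ N k" using that \<delta>[of "N k"] \<delta>T[of "N k"] by (simp add: field_simps)
    then have "\<lceil>t / \<delta> (N k)\<rceil> \<le> 2 ^ N k" by (simp add: ceiling_le_iff)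
    then have "nat \<lceil>t / \<delta> (N k)\<rceil> \<le> nat (2 ^ N k)" by (rule nat_mono)
    then have "nat \<lceil>t / \<delta> (N k)\<rceil> \<le> 2 ^ N k" by (simp add: nat_power_eq)
    moreover have "1 \<le> \<lceil>t / \<delta> (N k)\<rceil>" using that \<delta>[of "N k"] by (simp add: le_ceiling_iff)
    ultimately have "nat \<lceil>t / \<delta> (N k)\<rceil> - 1 < 2 ^ N k" by linarith
    then show ?thesis using d \<delta>[of "N k"] by (simp add: f_def)
  qed
  have full: "{real 0 * \<delta> n<..real (2 ^ n) * \<delta> n} = {0<..T}" for n using \<delta>T by simp
  have diff: "set_integrable lborel {0<..T} (\<lambda>t. \<bar>f (Suc k) t - f k t\<bar>)"
     "(LINT t:{0<..T}|lborel. \<bar>f (Suc k) t - f k t\<bar>) \<le> (T + 1) * (1 / 2) ^ k" for k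
  proof -
    let ?m = "N (Suc k)" and ?n = "N k"
    \<comment> \<open>Both quotients are constant on the cells of the finer level; the coarse cell containing cell \<open>l\<close> is found by integer division.\<close>
    define c where "c l = d ?m l / \<delta> ?m - d ?n (l div 2 ^ (?m - ?n)) / \<delta> ?n" for l
    have eq: "f (Suc k) t - f k t = c (nat \<lceil>t / \<delta> ?m\<rceil> - 1)" if t: "t \<in> {0<..T}" for t
    proof -
      define l where "l = nat \<lceil>t / \<delta> ?m\<rceil> - 1"
      define p :: nat where "p = 2 ^ (?m - ?n)"
      have p: "p > 0" by (simp add: p_def)
      have \<delta>nm: "\<delta> ?n = real p * \<delta> ?m" unfolding p_def by (rule \<delta>_refine[OF N_mono])
      have t0: "t > 0" using t by simp
      have l: "real l * \<delta> ?m < t" "t \<le> real (Suc l) * \<delta> ?m"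
        using grid_cell_iff[OF \<delta>[of ?m] t0, of l] by (auto simp: l_def)
      have "l div p * p \<le> l" "Suc l \<le> Suc (l div p) * p"
        using p by (simp, metis Suc_leI dividend_less_div_times mult.commute mult_Suc add.commute)
      then have "real (l div p * p) \<le> real l" "real (Suc l) \<le> real (Suc (l div p) * p)"
        by (simp_all only: of_nat_le_iff)
      then have "real (l div p * p) * \<delta> ?m \<le> real l * \<delta> ?m" "real (Suc l) * \<delta> ?m \<le> real (Suc (l div p) * p) * \<delta> ?m"
        using \<delta>[of ?m] by (auto intro!: mult_right_mono simp del: of_nat_Suc of_nat_mult)
      then have "real (l div p * p) * \<delta> ?m < t \<and> t \<le> real (Suc (l div p) * p) * \<delta> ?m"
        using l by (meson le_less_trans order_trans)
      then have "t \<in> {real (l div p) * \<delta> ?n<..real (Suc (l div p)) * \<delta> ?n}"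
        by (simp only: \<delta>nm of_nat_mult mult.assoc greaterThanAtMost_iff)
      then have "nat \<lceil>t / \<delta> ?n\<rceil> - 1 = l div p" using grid_cell_iff[OF \<delta>[of ?n] t0] by blast
      then show ?thesis unfolding f_def c_def l_def[symmetric] p_def by simp
    qed
    note step = step_function_integral[OF \<delta>[of ?m], of 0 "2 ^ ?m" "\<lambda>l. \<bar>c l\<bar>", unfolded full, simplified]
    have cong: "set_integrable lborel {0<..T} (\<lambda>t. \<bar>f (Suc k) t - f k t\<bar>) \<longleftrightarrow> set_integrable lborel {0<..T} (\<lambda>t. \<bar>c (nat \<lceil>t / \<delta> ?m\<rceil> - 1)\<bar>)"
      by (rule set_integrable_cong) (use eq in auto)
    show "set_integrable lborel {0<..T} (\<lambda>t. \<bar>f (Suc k) t - f k t\<bar>)"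
      unfolding cong using step(1) by simp
    have "(LINT t:{0<..T}|lborel. \<bar>f (Suc k) t - f k t\<bar>) = (LINT t:{0<..T}|lborel. \<bar>c (nat \<lceil>t / \<delta> ?m\<rceil> - 1)\<bar>)"
      by (rule set_lebesgue_integral_cong) (use eq in auto)
    also have "\<dots> = \<delta> ?m * (\<Sum>l<2 ^ ?m. \<bar>c l\<bar>)" using step(2) by (simp add: lessThan_atLeast0)
    \<comment> \<open>The weights \<open>2 ^ k\<close> balance the volume term against the \<open>L\<^sup>2\<close> bound \<open>1 / 4 ^ k\<close>.\<close>
    also have "\<dots> \<le> \<delta> ?m * (\<Sum>l<2 ^ ?m. (1 / 2) ^ k + 2 ^ k * (c l)\<^sup>2)"
    proof (intro mult_left_mono sum_mono)
      fix l
      have "0 \<le> ((1 / 2) ^ k - \<bar>c l\<bar>)\<^sup>2 * 2 ^ k" by simp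
      also have "\<dots> = (1 / 2) ^ k - 2 * \<bar>c l\<bar> + 2 ^ k * (c l)\<^sup>2"
        by (simp add: power2_diff power_one_over field_simps power2_eq_square)
      finally show "\<bar>c l\<bar> \<le> (1 / 2) ^ k + 2 ^ k * (c l)\<^sup>2" by linarith
    qed (use \<delta>[of ?m] in simp)
    also have "\<dots> = 2 ^ ?m * \<delta> ?m * (1 / 2) ^ k + 2 ^ k * (\<delta> ?m * (\<Sum>l<2 ^ ?m. (c l)\<^sup>2))"
      by (simp add: sum.distrib sum_distrib_left algebra_simps)
    also have "\<dots> \<le> T * (1 / 2) ^ k + 2 ^ k * (1 / 4 ^ k)"
    proof -
      have "\<delta> ?m * (\<Sum>l<2 ^ ?m. (c l)\<^sup>2) \<le> a ?m - a ?n" using defect[OF N_mono[of k]] by (simp add: c_def)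
      also have "\<dots> \<le> 1 / 4 ^ k" using A(2)[of ?m] N(2)[of k] by linarith
      finally have "2 ^ k * (\<delta> ?m * (\<Sum>l<2 ^ ?m. (c l)\<^sup>2)) \<le> 2 ^ k * (1 / 4 ^ k)" by (intro mult_left_mono) auto
      then show ?thesis unfolding \<delta>T by simp
    qed
    also have "(2::real) ^ k * (1 / 4 ^ k) = (1 / 2) ^ k"
    proof -
      have "(4::real) ^ k = 2 ^ k * 2 ^ k" by (simp add: power_mult_distrib[symmetric])
      then show ?thesis by (simp add: power_one_over)
    qed
    finally show "(LINT t:{0<..T}|lborel. \<bar>f (Suc k) t - f k t\<bar>) \<le> (T + 1) * (1 / 2) ^ k"
      by (simp add: algebra_simps)
  qed
  have f_int: "set_integrable lborel {0<..T} (f k)" for k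
    using step_function_integral(1)[OF \<delta>[of "N k"], of 0 "2 ^ N k" "\<lambda>l. d (N k) l / \<delta> (N k)", unfolded full]
    by (simp add: f_def[abs_def])
  define H where "H t = (ennreal (f 0 t) + (\<Sum>k. ennreal \<bar>f (Suc k) t - f k t\<bar>)) * indicator {0<..T} t" for t
  have Hm[measurable]: "H \<in> borel_measurable lborel" unfolding H_def by measurable
  have nn_int: "(\<integral>\<^sup>+t. ennreal (u t) * indicator {0<..T} t \<partial>lborel) = ennreal (LINT t:{0<..T}|lborel. u t)"
    if "set_integrable lborel {0<..T} u" "\<And>t. t \<in> {0<..T} \<Longrightarrow> 0 \<le> u t" for u :: "real \<Rightarrow> real"
  proof -
    have "(\<integral>\<^sup>+t. ennreal (u t) * indicator {0<..T} t \<partial>lborel) = (\<integral>\<^sup>+t. ennreal (indicat_real {0<..T} t *\<^sub>R u t) \<partial>lborel)"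
      by (intro nn_integral_cong) (auto simp: indicator_def)
    also have "\<dots> = ennreal (LINT t|lborel. indicat_real {0<..T} t *\<^sub>R u t)"
      using that by (intro nn_integral_eq_integral) (auto simp: set_integrable_def indicator_def)
    finally show ?thesis by (simp add: set_lebesgue_integral_def)
  qed
  have H_fin: "(\<integral>\<^sup>+t. H t \<partial>lborel) < \<infinity>"
  proof -
    have 0: "(\<integral>\<^sup>+t. ennreal (f 0 t) * indicator {0<..T} t \<partial>lborel) = ennreal (LINT t:{0<..T}|lborel. f 0 t)"
      by (rule nn_int[OF f_int f_nonneg])
    have 1: "(\<integral>\<^sup>+t. ennreal \<bar>f (Suc k) t - f k t\<bar> * indicator {0<..T} t \<partial>lborel) \<le> ennreal ((T + 1) * (1 / 2) ^ k)" for k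
    proof -
      have "(\<integral>\<^sup>+t. ennreal \<bar>f (Suc k) t - f k t\<bar> * indicator {0<..T} t \<partial>lborel) = ennreal (LINT t:{0<..T}|lborel. \<bar>f (Suc k) t - f k t\<bar>)"
        by (rule nn_int[OF diff(1)]) simp
      then show ?thesis using diff(2)[of k] by (simp add: ennreal_leI)
    qed
    have "(\<integral>\<^sup>+t. H t \<partial>lborel) = (\<integral>\<^sup>+t. ennreal (f 0 t) * indicator {0<..T} t + (\<Sum>k. ennreal \<bar>f (Suc k) t - f k t\<bar> * indicator {0<..T} t) \<partial>lborel)"
      by (simp add: H_def distrib_right ennreal_suminf_multc)
    also have "\<dots> = (\<integral>\<^sup>+t. ennreal (f 0 t) * indicator {0<..T} t \<partial>lborel) + (\<Sum>k. \<integral>\<^sup>+t. ennreal \<bar>f (Suc k) t - f k t\<bar> * indicator {0<..T} t \<partial>lborel)"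
      by (subst nn_integral_add, simp, simp, subst nn_integral_suminf) auto
    also have "\<dots> \<le> ennreal (LINT t:{0<..T}|lborel. f 0 t) + (\<Sum>k. ennreal ((T + 1) * (1 / 2) ^ k))"
      unfolding 0 by (intro add_left_mono suminf_le 1) auto
    also have "(\<Sum>k. ennreal ((T + 1) * (1 / 2) ^ k)) = ennreal (\<Sum>k. (T + 1) * (1 / 2) ^ k)"
      using T by (intro suminf_ennreal2) (auto intro!: summable_mult summable_geometric)
    also have "ennreal (LINT t:{0<..T}|lborel. f 0 t) + \<dots> < \<infinity>" by simp
    finally show ?thesis .
  qed
  define g where "g t = enn2real (H t)" for t
  have g_nonneg: "0 \<le> g t" for t by (simp add: g_def)
  have gm[measurable]: "g \<in> borel_measurable lborel" unfolding g_def by measurable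
  have H_AE: "AE t in lborel. H t \<noteq> \<infinity>"
    by (rule nn_integral_PInf_AE) (use H_fin in auto)
  have g_int: "integrable lborel g"
  proof (rule integrableI_nonneg[OF gm])
    have "(\<integral>\<^sup>+t. ennreal (g t) \<partial>lborel) \<le> (\<integral>\<^sup>+t. H t \<partial>lborel)"
      by (intro nn_integral_mono) (simp add: g_def ennreal_enn2real_if)
    then show "(\<integral>\<^sup>+t. ennreal (g t) \<partial>lborel) < \<infinity>" using H_fin by (rule le_less_trans)
  qed (simp add: g_nonneg)
  have g_intS: "set_integrable lborel S g" if "S \<in> sets borel" for S
    using g_int that unfolding set_integrable_def by (intro integrable_mult_indicator) auto
  have fg: "AE t in lborel. t \<in> {0<..T} \<longrightarrow> f k t \<le> g t" for k
    using H_AE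
  proof eventually_elim
    case (elim t)
    show ?case
    proof
      assume t: "t \<in> {0<..T}"
      have "ennreal (f k t) \<le> ennreal (f 0 t) + (\<Sum>j<k. ennreal \<bar>f (Suc j) t - f j t\<bar>)"
      proof (induction k)
        case (Suc k)
        have "ennreal (f (Suc k) t) \<le> ennreal (f k t + \<bar>f (Suc k) t - f k t\<bar>)" by (intro ennreal_leI) linarith
        also have "\<dots> = ennreal (f k t) + ennreal \<bar>f (Suc k) t - f k t\<bar>" using f_nonneg[OF t] by simp
        also have "\<dots> \<le> ennreal (f 0 t) + (\<Sum>j<k. ennreal \<bar>f (Suc j) t - f j t\<bar>) + ennreal \<bar>f (Suc k) t - f k t\<bar>"
          by (intro add_right_mono Suc.IH)
        finally show ?case by (simp add: add.assoc)
      qed simp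
      also have "\<dots> \<le> ennreal (f 0 t) + (\<Sum>j. ennreal \<bar>f (Suc j) t - f j t\<bar>)"
        by (intro add_left_mono sum_le_suminf summableI) simp_all
      also have "\<dots> = H t" using t by (simp add: H_def)
      finally have "ennreal (f k t) \<le> ennreal (g t)" using elim by (simp add: g_def less_top)
      then show "f k t \<le> g t" using g_nonneg by simp
    qed
  qed
  have grid_bound: "D (real i * \<delta> (N k)) (real j * \<delta> (N k)) \<le> (LINT r:{real i * \<delta> (N k)..real j * \<delta> (N k)}|lborel. g r)"
    if ij: "i \<le> j" "j \<le> 2 ^ N k" for i j k
  proof -
    let ?n = "N k"
    note step = step_function_integral[OF \<delta>[of ?n] ij(1), of "\<lambda>l. d ?n l / \<delta> ?n", folded f_def]
    have sub: "{real i * \<delta> ?n<..real j * \<delta> ?n} \<subseteq> {0<..T}"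
    proof -
      have "0 \<le> real i * \<delta> ?n" "real j * \<delta> ?n \<le> T" using grid[OF ij(2)] \<delta>[of ?n] by auto
      then show ?thesis by (auto simp del: zero_le_mult_iff)
    qed
    have "D (real i * \<delta> ?n) (real j * \<delta> ?n) \<le> (\<Sum>l=i..<j. d ?n l)" by (rule chain[OF ij])
    also have "\<dots> = (LINT r:{real i * \<delta> ?n<..real j * \<delta> ?n}|lborel. f k r)"
      unfolding step(2) using \<delta>[of ?n] by (simp add: sum_divide_distrib[symmetric])
    also have "\<dots> \<le> (LINT r:{real i * \<delta> ?n..real j * \<delta> ?n}|lborel. g r)"
      unfolding set_lebesgue_integral_def
    proof (rule integral_mono_AE)
      show "AE r in lborel. indicat_real {real i * \<delta> ?n<..real j * \<delta> ?n} r *\<^sub>R f k r \<le> indicat_real {real i * \<delta> ?n..real j * \<delta> ?n} r *\<^sub>R g r"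
        using fg[of k] by eventually_elim (use sub g_nonneg in \<open>auto simp: indicator_def\<close>)
    qed (use step(1) g_intS in \<open>auto simp: set_integrable_def\<close>)
    finally show ?thesis .
  qed
  have short: "D s t \<le> sqrt (C * \<delta> n)" if "0 \<le> s" "s \<le> t" "t \<le> T" "t - s \<le> \<delta> n" for s t n
  proof (rule real_le_rsqrt)
    have "(D s t)\<^sup>2 \<le> (t - s) * C" using energy[of s "t - s" 1] that by simp
    also have "\<dots> \<le> C * \<delta> n" using that C mult_right_mono[of "t - s" "\<delta> n" C] by (simp add: mult.commute)
    finally show "(D s t)\<^sup>2 \<le> C * \<delta> n" .
  qed
  have main: "D s t \<le> (LINT r:{s..t}|lborel. g r) + 2 * sqrt (C * \<delta> (N k))" if st: "0 \<le> s" "s \<le> t" "t \<le> T" for s t k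
  proof -
    let ?n = "N k"
    have Inn: "0 \<le> (LINT r:{s..t}|lborel. g r)"
      unfolding set_lebesgue_integral_def by (intro integral_nonneg_AE) (simp add: g_nonneg)
    \<comment> \<open>The outermost grid points inside \<open>[s, t]\<close>; if there are none, the interval is shorter than one cell.\<close>
    define i where "i = nat \<lceil>s / \<delta> ?n\<rceil>"
    define j where "j = nat \<lfloor>t / \<delta> ?n\<rfloor>"
    have "0 \<le> s / \<delta> ?n" "0 \<le> t / \<delta> ?n" using st \<delta>[of ?n] by auto
    then have "real i = of_int \<lceil>s / \<delta> ?n\<rceil>" "real j = of_int \<lfloor>t / \<delta> ?n\<rfloor>" by (auto simp: i_def j_def)
    then have "s / \<delta> ?n \<le> real i" "real i \<le> s / \<delta> ?n + 1" "real j \<le> t / \<delta> ?n" "t / \<delta> ?n \<le> real j + 1" by linarith+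
    then have ij: "s \<le> real i * \<delta> ?n" "real i * \<delta> ?n \<le> s + \<delta> ?n" "real j * \<delta> ?n \<le> t" "t \<le> real j * \<delta> ?n + \<delta> ?n"
      using \<delta>[of ?n] by (simp_all add: field_simps)
    show ?thesis
    proof (cases "i \<le> j")
      case True
      have "real j * \<delta> ?n \<le> 2 ^ ?n * \<delta> ?n" using ij(3) st \<delta>T[of ?n] by linarith
      then have "real j \<le> real (2 ^ ?n)" using \<delta>[of ?n] by simp
      then have jn: "j \<le> 2 ^ ?n" by (simp only: of_nat_le_iff)
      have gr: "real i * \<delta> ?n \<in> {0..T}" "real j * \<delta> ?n \<in> {0..T}" using grid True jn by (meson le_trans)+
      have "D s t \<le> D s (real i * \<delta> ?n) + (D (real i * \<delta> ?n) (real j * \<delta> ?n) + D (real j * \<delta> ?n) t)"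
        using tri[of s "real i * \<delta> ?n" t] tri[of "real i * \<delta> ?n" "real j * \<delta> ?n" t] gr st by fastforce
      moreover have "D s (real i * \<delta> ?n) \<le> sqrt (C * \<delta> ?n)" by (rule short) (use st ij gr in auto)
      moreover have "D (real j * \<delta> ?n) t \<le> sqrt (C * \<delta> ?n)" by (rule short) (use st ij gr in auto)
      moreover have "D (real i * \<delta> ?n) (real j * \<delta> ?n) \<le> (LINT r:{real i * \<delta> ?n..real j * \<delta> ?n}|lborel. g r)"
        by (rule grid_bound[OF True jn])
      moreover have "(LINT r:{real i * \<delta> ?n..real j * \<delta> ?n}|lborel. g r) \<le> (LINT r:{s..t}|lborel. g r)"
        unfolding set_lebesgue_integral_def
      proof (rule integral_mono)
        show "indicat_real {real i * \<delta> ?n..real j * \<delta> ?n} r *\<^sub>R g r \<le> indicat_real {s..t} r *\<^sub>R g r" for r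
          using ij g_nonneg[of r] by (auto simp: indicator_def)
      qed (rule g_intS[unfolded set_integrable_def], simp)+
      ultimately show ?thesis by linarith
    next
      case False
      then have "real (j + 1) \<le> real i" by (simp only: of_nat_le_iff)
      then have "(real j + 1) * \<delta> ?n \<le> real i * \<delta> ?n" using \<delta>[of ?n] by (intro mult_right_mono) auto
      then have "t \<le> s + \<delta> ?n" using ij by (simp add: distrib_right)
      then have "D s t \<le> sqrt (C * \<delta> ?n)" by (intro short) (use st in auto)
      moreover have "0 \<le> sqrt (C * \<delta> ?n)" using C \<delta>[of ?n] by simp
      ultimately show ?thesis using Inn by linarith
    qed
  qed
  show ?thesis
  proof (rule that[of g])
    show "set_integrable lborel {0..T} g" by (rule g_intS) simp
    fix s t assume st: "0 \<le> s" "s \<le> t" "t \<le> T"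
    have "\<delta> \<longlonglongrightarrow> 0"
      unfolding \<delta>_def using LIMSEQ_divide_realpow_zero[of 2 T] by simp
    moreover have "filterlim N at_top sequentially"
      by (rule filterlim_at_top_mono[OF filterlim_ident]) (simp add: N)
    ultimately have "(\<lambda>k. \<delta> (N k)) \<longlonglongrightarrow> 0" by (rule filterlim_compose)
    then have "(\<lambda>k. (LINT r:{s..t}|lborel. g r) + 2 * sqrt (C * \<delta> (N k))) \<longlonglongrightarrow> (LINT r:{s..t}|lborel. g r) + 2 * sqrt (C * 0)"
      by (intro tendsto_intros)
    then show "D s t \<le> (LINT r:{s..t}|lborel. g r)"
      using main[OF st] by (intro LIMSEQ_le_const[where X = "\<lambda>k. (LINT r:{s..t}|lborel. g r) + 2 * sqrt (C * \<delta> (N k))"]) auto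
  qed
qed

section \<open>Absolute continuity of the limit curve\<close>

context jko_limit
begin

text \<open>The triangle inequality over the intermediate steps, squared by the Cauchy-Schwarz inequality. The number of grid
  points between \<open>s\<close> and \<open>t\<close> exceeds \<open>(t - s) / h\<close> by at most \<open>1\<close>, which disappears in the limit.\<close>

lemma interp_distance_squared:
  assumes h: "h > 0" and st: "0 \<le> s" "s \<le> t"
  shows "(W2 \<Omega> (interp_curve h (R h) s) (interp_curve h (R h) t))\<^sup>2
    \<le> ((t - s) / h + 1) * (\<Sum>m=nat \<lceil>s / h\<rceil>..<nat \<lceil>t / h\<rceil>. (W2 \<Omega> (R h (Suc m)) (R h m))\<^sup>2)"
proof -
  let ?k = "nat \<lceil>s / h\<rceil>" and ?l = "nat \<lceil>t / h\<rceil>"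
  have "s / h \<le> t / h" using st h by (intro divide_right_mono) auto
  then have kl: "?k \<le> ?l" by (intro nat_mono ceiling_mono)
  have "0 \<le> s / h" using st h by simp
  then have ceil: "real ?k = of_int \<lceil>s / h\<rceil>" "real ?l = of_int \<lceil>t / h\<rceil>" using \<open>s / h \<le> t / h\<close> by auto
  have "real_of_int \<lceil>t / h\<rceil> - real_of_int \<lceil>s / h\<rceil> \<le> t / h - s / h + 1" by linarith
  then have len: "real (?l - ?k) \<le> (t - s) / h + 1"
    unfolding of_nat_diff[OF kl] ceil diff_divide_distrib .
  have "W2 \<Omega> (R h (?k + 0)) (R h (?k + (?l - ?k))) \<le> (\<Sum>i<?l - ?k. W2 \<Omega> (R h (?k + i)) (R h (?k + Suc i)))"
    by (rule triangle_inequality_chain[where u = "\<lambda>i. R h (?k + i)"])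
      (intro W2_self[OF compact_domain_facts(2)] W2_triangle[OF compact_domain_facts(1)] R_prob[OF h])+
  also have "\<dots> = (\<Sum>m=?k..<?l. W2 \<Omega> (R h m) (R h (Suc m)))"
    using sum.atLeastLessThan_shift_0[of "\<lambda>m. W2 \<Omega> (R h m) (R h (Suc m))" ?k ?l]
    by (simp add: comp_def lessThan_atLeast0)
  also have "\<dots> = (\<Sum>m=?k..<?l. W2 \<Omega> (R h (Suc m)) (R h m))"
    by (intro sum.cong refl W2_commute[OF compact_domain_facts(2)] R_prob[OF h])
  finally have "W2 \<Omega> (R h ?k) (R h ?l) \<le> (\<Sum>m=?k..<?l. W2 \<Omega> (R h (Suc m)) (R h m))" using kl by simp
  then have "(W2 \<Omega> (R h ?k) (R h ?l))\<^sup>2 \<le> (\<Sum>m=?k..<?l. W2 \<Omega> (R h (Suc m)) (R h m))\<^sup>2"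
    by (intro power_mono W2_nonneg[OF compact_domain_facts(2)] R_prob[OF h])
  also have "\<dots> \<le> (\<Sum>m=?k..<?l. (W2 \<Omega> (R h (Suc m)) (R h m))\<^sup>2) * real (?l - ?k)"
    using sum_squared_le_sum_of_squares[of "\<lambda>m. W2 \<Omega> (R h (Suc m)) (R h m)" "{?k..<?l}"] by simp
  also have "\<dots> \<le> (\<Sum>m=?k..<?l. (W2 \<Omega> (R h (Suc m)) (R h m))\<^sup>2) * ((t - s) / h + 1)"
    by (intro mult_left_mono len sum_nonneg) simp
  finally show ?thesis by (simp add: interp_curve_def mult.commute)
qed

lemma interp_distance_tendsto:
  assumes "s \<in> {0..T}" "t \<in> {0..T}"
  shows "(\<lambda>j. W2 \<Omega> (interp_curve (\<tau> j) (R (\<tau> j)) s) (interp_curve (\<tau> j) (R (\<tau> j)) t)) \<longlonglongrightarrow> W2 \<Omega> (\<rho> s) (\<rho> t)"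
proof -
  let ?\<rho> = "\<lambda>j. interp_curve (\<tau> j) (R (\<tau> j))"
  note P = interp_prob[OF steps(1)] limit_curve[OF assms(1)] limit_curve[OF assms(2)]
  note tri = W2_triangle[OF compact_domain_facts(1)] and sym = W2_commute[OF compact_domain_facts(2)]
  have "(\<lambda>j. W2 \<Omega> (?\<rho> j s) (?\<rho> j t) - W2 \<Omega> (\<rho> s) (\<rho> t)) \<longlonglongrightarrow> 0"
  proof (rule Lim_null_comparison)
    show "\<forall>\<^sub>F j in sequentially. norm (W2 \<Omega> (?\<rho> j s) (?\<rho> j t) - W2 \<Omega> (\<rho> s) (\<rho> t)) \<le> W2 \<Omega> (?\<rho> j s) (\<rho> s) + W2 \<Omega> (?\<rho> j t) (\<rho> t)"
    proof (intro always_eventually allI)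
      fix j
      have "W2 \<Omega> (?\<rho> j s) (?\<rho> j t) \<le> W2 \<Omega> (?\<rho> j s) (\<rho> s) + (W2 \<Omega> (\<rho> s) (\<rho> t) + W2 \<Omega> (\<rho> t) (?\<rho> j t))"
        using tri[OF P(1)[of j s] P(2) P(1)[of j t]] tri[OF P(2) P(3) P(1)[of j t]] by linarith
      moreover have "W2 \<Omega> (\<rho> s) (\<rho> t) \<le> W2 \<Omega> (\<rho> s) (?\<rho> j s) + (W2 \<Omega> (?\<rho> j s) (?\<rho> j t) + W2 \<Omega> (?\<rho> j t) (\<rho> t))"
        using tri[OF P(2) P(1)[of j s] P(3)] tri[OF P(1)[of j s] P(1)[of j t] P(3)] by linarith
      ultimately show "norm (W2 \<Omega> (?\<rho> j s) (?\<rho> j t) - W2 \<Omega> (\<rho> s) (\<rho> t)) \<le> W2 \<Omega> (?\<rho> j s) (\<rho> s) + W2 \<Omega> (?\<rho> j t) (\<rho> t)"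
        using sym[OF P(1)[of j s] P(2)] sym[OF P(1)[of j t] P(3)] unfolding real_norm_def by linarith
    qed
    show "(\<lambda>j. W2 \<Omega> (?\<rho> j s) (\<rho> s) + W2 \<Omega> (?\<rho> j t) (\<rho> t)) \<longlonglongrightarrow> 0"
      using tendsto_add[OF curve_pointwise[OF assms(1)] curve_pointwise[OF assms(2)]] by simp
  qed
  then show ?thesis by (rule LIM_zero_cancel)
qed

text \<open>On a uniform grid of mesh \<open>\<delta>\<close> the discrete curve has squared increments summing to at most \<open>(\<delta> + h) C\<close>; the
  extra \<open>h\<close> comes from the rounding of times to steps and vanishes in the limit.\<close>

lemma abs_continuous_holds: "W2_abs_continuous \<Omega> T \<rho>"
proof -
  obtain C where C: "C \<ge> 0" "\<And>h N. h > 0 \<Longrightarrow> (\<Sum>k<N. (W2 \<Omega> (R h (Suc k)) (R h k))\<^sup>2) \<le> h * C"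
    using total_cost_bound by blast
  show ?thesis
    unfolding W2_abs_continuous_def
  proof (rule finite_energy_curve_abs_continuous[of T C "\<lambda>s t. W2 \<Omega> (\<rho> s) (\<rho> t)", OF final_time C(1)])
    fix s \<delta> :: real and N :: nat
    assume s: "0 \<le> s" and \<delta>: "0 \<le> \<delta>" and sT: "s + real N * \<delta> \<le> T"
    let ?u = "\<lambda>i. s + real i * \<delta>"
    let ?\<rho> = "\<lambda>j. interp_curve (\<tau> j) (R (\<tau> j))"
    have u: "?u i \<in> {0..T}" if "i \<le> N" for i
    proof -
      have "real i * \<delta> \<le> real N * \<delta>" using that \<delta> by (intro mult_right_mono) auto
      moreover have "0 \<le> real i * \<delta>" using \<delta> by simp
      ultimately show ?thesis using s sT by simp
    qed
    have bound: "(\<Sum>i<N. (W2 \<Omega> (interp_curve h (R h) (?u i)) (interp_curve h (R h) (?u (Suc i))))\<^sup>2) \<le> (\<delta> + h) * C"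
      if h: "h > 0" for h
    proof -
      let ?a = "\<lambda>m. (W2 \<Omega> (R h (Suc m)) (R h m))\<^sup>2" and ?k = "\<lambda>i. nat \<lceil>?u i / h\<rceil>"
      have k_mono: "?k i \<le> ?k (Suc i)" for i
        using \<delta> h by (intro nat_mono ceiling_mono divide_right_mono) (auto simp: distrib_right)
      have concat: "(\<Sum>i<n. \<Sum>m=?k i..<?k (Suc i). ?a m) = (\<Sum>m=?k 0..<?k n. ?a m)" for n
      proof (induction n)
        case (Suc n)
        have "?k 0 \<le> ?k n" by (rule lift_Suc_mono_le[of ?k, OF k_mono]) simp
        from sum.atLeastLessThan_concat[OF this k_mono] Suc show ?case by simp
      qed simp
      have "(\<Sum>i<N. (W2 \<Omega> (interp_curve h (R h) (?u i)) (interp_curve h (R h) (?u (Suc i))))\<^sup>2)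
        \<le> (\<Sum>i<N. (\<delta> / h + 1) * (\<Sum>m=?k i..<?k (Suc i). ?a m))"
      proof (rule sum_mono)
        fix i assume "i \<in> {..<N}"
        then have "0 \<le> ?u i" using u[of i] by simp
        moreover have "?u i \<le> ?u (Suc i)" using \<delta> by (simp add: distrib_right)
        moreover have "?u (Suc i) - ?u i = \<delta>" by (simp add: distrib_right)
        ultimately show "(W2 \<Omega> (interp_curve h (R h) (?u i)) (interp_curve h (R h) (?u (Suc i))))\<^sup>2
          \<le> (\<delta> / h + 1) * (\<Sum>m=?k i..<?k (Suc i). ?a m)"
          using interp_distance_squared[OF h, of "?u i" "?u (Suc i)"] by metis
      qed
      also have "\<dots> = (\<delta> / h + 1) * (\<Sum>m=?k 0..<?k N. ?a m)"
        by (simp only: concat sum_distrib_left[symmetric])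
      also have "\<dots> \<le> (\<delta> / h + 1) * (\<Sum>m<?k N. ?a m)"
        using \<delta> h by (intro mult_left_mono sum_mono2) auto
      also have "\<dots> \<le> (\<delta> / h + 1) * (h * C)"
        using \<delta> h by (intro mult_left_mono C(2)) auto
      also have "\<dots> = (\<delta> + h) * C" using h by (simp add: field_simps)
      finally show ?thesis .
    qed
    have "(\<lambda>j. \<Sum>i<N. (W2 \<Omega> (?\<rho> j (?u i)) (?\<rho> j (?u (Suc i))))\<^sup>2) \<longlonglongrightarrow> (\<Sum>i<N. (W2 \<Omega> (\<rho> (?u i)) (\<rho> (?u (Suc i))))\<^sup>2)"
      by (intro tendsto_sum tendsto_power interp_distance_tendsto u) auto
    moreover have "(\<lambda>j. (\<delta> + \<tau> j) * C) \<longlonglongrightarrow> (\<delta> + 0) * C"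
      by (intro tendsto_intros steps(2))
    ultimately have "(\<Sum>i<N. (W2 \<Omega> (\<rho> (?u i)) (\<rho> (?u (Suc i))))\<^sup>2) \<le> (\<delta> + 0) * C"
      by (rule LIMSEQ_le) (use bound[OF steps(1)] in blast)
    then show "(\<Sum>i<N. (W2 \<Omega> (\<rho> (?u i)) (\<rho> (?u (Suc i))))\<^sup>2) \<le> \<delta> * C" by simp
  next
    fix g assume "set_integrable lborel {0..T} g"
      "\<And>s t. 0 \<le> s \<Longrightarrow> s \<le> t \<Longrightarrow> t \<le> T \<Longrightarrow> W2 \<Omega> (\<rho> s) (\<rho> t) \<le> (LINT r:{s..t}|lborel. g r)"
    then show "\<exists>g. set_integrable lborel {0..T} g \<and>
      (\<forall>s t. 0 \<le> s \<and> s \<le> t \<and> t \<le> T \<longrightarrow> W2 \<Omega> (\<rho> s) (\<rho> t) \<le> (LINT r:{s..t}|lborel. g r))"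
      by blast
  qed (intro W2_nonneg[OF compact_domain_facts(2)] W2_self[OF compact_domain_facts(2)]
    W2_triangle[OF compact_domain_facts(1)] limit_curve; assumption)+
qed

end

theorem proposition4p19:
  fixes \<Omega> :: "'a::euclidean_space set"
    and V :: "'a \<Rightarrow> real" and gradV :: "'a \<Rightarrow> 'a"
    and T :: real
    and \<rho>0 :: "'a measure"
    and R :: "real \<Rightarrow> nat \<Rightarrow> 'a measure"
    and S :: "real \<Rightarrow> nat \<Rightarrow> 'a \<Rightarrow> 'a"
    and \<tau> :: "nat \<Rightarrow> real"
    and \<rho> :: "real \<Rightarrow> 'a measure"
    and E :: "(real \<times> 'a, 'a) vmeasure"
  assumes domain: "compact_domain \<Omega>"
    and potential: "C1_closure \<Omega> V gradV"
    and final_time: "T > 0"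
    and initial: "\<rho>0 \<in> prob_on \<Omega>" "energy \<Omega> V \<rho>0 < \<infinity>"
    and scheme: "\<And>h. h > 0 \<Longrightarrow> jko_scheme \<Omega> V h \<rho>0 (R h)"
    and maps: "\<And>h k. h > 0 \<Longrightarrow> optimal_map \<Omega> (R h (Suc k)) (R h k) (S h k)"
    and steps: "\<And>j. \<tau> j > 0" "\<tau> \<longlonglongrightarrow> 0"
    and limit_curve: "\<And>t. t \<in> {0..T} \<Longrightarrow> \<rho> t \<in> prob_on \<Omega>"
    and curve_convergence:
      "uniform_limit {0..T} (\<lambda>j t. W2 \<Omega> (interp_curve (\<tau> j) (R (\<tau> j)) t) (\<rho> t)) (\<lambda>t. 0) sequentially"
    and limit_momentum: "vector_measure_on ({0..T} \<times> \<Omega>) E"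
    and momentum_convergence:
      "\<And>f. continuous_on ({0..T} \<times> \<Omega>) f \<Longrightarrow>
         (\<lambda>j. discrete_momentum_integral \<Omega> T (\<tau> j) (R (\<tau> j)) (S (\<tau> j)) f)
           \<longlonglongrightarrow> vintegral ({0..T} \<times> \<Omega>) E f"
  shows "continuity_eq_noflux \<Omega> T \<rho> E \<and> flux_law \<Omega> gradV T \<rho> E \<and>
         fokker_planck_noflux \<Omega> gradV T \<rho> E \<and>
         W2_abs_continuous \<Omega> T \<rho> \<and> \<rho> 0 = \<rho>0"
proof -
  interpret jko_limit \<Omega> V gradV T \<rho>0 R S \<tau> \<rho> E
    by unfold_locales (fact assms)+
  show ?thesis
    using continuity_eq_holds flux_law_holds fokker_planck_interior_holds abs_continuous_holds initial_value
    by (simp add: fokker_planck_noflux_def)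
qed

end
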